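(* Let $\mathfrak h$ be a CSLAT of dimension $6$ and let $H$ be the simply connected Lie group with Lie algebra $\mathfrak h$. Then $\mathcal M(H)/{\sim_0}$ is a smooth manifold. Moreover, $\mathcal M(H)/{\sim_0}$ is diffeomorphic to a submanifold $\Sigma$ of $\mathrm T_6^+$ which is transversal to $\operatorname{Aut}_0(\mathfrak h)$; explicitly, $\Sigma$ can be taken to be the submanifold $\Sigma(F)$ associated with the set $F$ of free positions listed for $\mathfrak h$ in the context.
   Context: A real nilpotent Lie algebra $\mathfrak h$ is a CSLAT if $\operatorname{Der}(\mathfrak h)$ is solvable and every $D\in\operatorname{Der}(\mathfrak h)$ has only real eigenvalues. A tuple such as $(0,0,0,12,13,14+23)$ denotes $\mathbb R^6$ with canonical basis $e_1,\dots,e_6$, where a term $ij$ in the $k$-th entry contributes $-e_k$ to $[e_i,e_j]$ (and a term preceded by a minus sign contributes $+e_k$); all other brackets vanish up to skew-symmetry. Every 6-dimensional CSLAT is isomorphic to exactly one of the Lie algebras listed below, and is identified with it; $e_1,\dots,e_6$ is its standard basis. $\mathcal M(H)$ is the space of left-invariant Riemannian metrics on $H$, identified (using the standard basis) with the space $\operatorname{Sym}_6^+$ of symmetric positive definite real $6\times6$ matrices. $\operatorname{Aut}(\mathfrak h)\subset\operatorname{GL}_6(\mathbb R)$ acts on the right on $\operatorname{Sym}_6^+$ by $g\cdot\varphi=\varphi^Tg\varphi$. $\operatorname{Aut}_0(\mathfrak h)$ is the identity component of $\operatorname{Aut}(\mathfrak h)$, and $\mathcal M(H)/{\sim_0}$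 is the orbit space of $\operatorname{Sym}_6^+$ under $\operatorname{Aut}_0(\mathfrak h)$. $\mathrm T_6^+$ is the group of lower triangular real $6\times 6$ matrices with positive diagonal entries; in the standard basis $\operatorname{Aut}_0(\mathfrak h)\subset\mathrm T_6^+$. For a set $F$ of positions $(i,j)$, $i\ge j$ (written $ij$), let $\Sigma(F)$ be the set of lower triangular matrices $\sigma$ with: $\sigma_{ij}\in\mathbb R$ arbitrary if $i>j$ and $ij\in F$; $\sigma_{ij}=0$ if $i>j$ and $ij\notin F$; $\sigma_{ii}>0$ arbitrary if $ii\in F$; $\sigma_{ii}=1$ if $ii\notin F$. The list (Lie algebra in standard basis; $F$): $\mathfrak h_9=(0,0,0,0,12,51+23)$; $F=\{33,53,54,55,65,66\}$. $\mathfrak h_{10}=(0,0,0,12,13,14)$; $F=\{44,54,55,64,65,66\}$. $\mathfrak h_{11}=(0,0,0,12,13,14+23)$; $F=\{33,44,54,55,64,65,66\}$. $\mathfrak h_{12}=(0,0,0,12,13,24)$; $F=\{21,43,44,54,55,64,65,66\}$. $\mathfrak h_{13}=(0,0,0,12,13+14,24)$; $F=\{21,33,43,44,54,55,64,65,66\}$. $\mathfrak h_{14}=(0,0,0,12,14,13+42)$; $F=\{33,43,44,54,55,64,65,66\}$. $\mathfrak h_{18}=(0,0,0,12,13,15+24)$; $F=\{32,33,43,44,54,55,64,65,66\}$. $\mathfrak h_{19}^+=(0,0,0,23,21,14+35)$; $F=\{21,31,32,44,51,54,55,64,65,66\}$. $\mathfrak h_{21}=(0,0,0,12,14,15)$;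 $F=\{43,44,53,54,55,64,65,66\}$. $\mathfrak h_{22}=(0,0,0,12,14,15+24)$; $F=\{22,43,44,53,54,55,64,65,66\}$. $\mathfrak h_{23}=(0,0,12,13,23,14)$; $F=\{33,43,44,53,54,55,63,64,65,66\}$. $\mathfrak h_{24}=(0,0,0,12,14,15+23+24)$; $F=\{22,33,43,44,53,54,55,64,65,66\}$. $\mathfrak h_{25}=(0,0,0,12,14,15+23)$; $F=\{33,43,44,53,54,55,64,65,66\}$. $\mathfrak h_{26}^-=(0,0,12,31,32,15+24)$; $F=\{21,33,43,44,53,54,55,63,64,65,66\}$. $\mathfrak h_{27}=(0,0,0,12,14-23,15+34)$; $F=\{31,32,33,43,44,53,54,55,64,65,66\}$. $\mathfrak h_{28}=(0,0,12,13,14,15)$; $F=\{33,43,44,53,54,55,63,64,65,66\}$. $\mathfrak h_{29}=(0,0,12,13,14,23+15)$; $F=\{22,33,43,44,53,54,55,63,64,65,66\}$. $\mathfrak h_{30}=(0,0,12,13,14+23,24+15)$; $F=\{21,22,33,43,44,53,54,55,63,64,65,66\}$. $\mathfrak h_{31}=(0,0,12,13,14,34+52)$; $F=\{21,33,42,43,44,53,54,55,63,64,65,66\}$. $\mathfrak h_{32}=(0,0,12,13,14+23,34+52)$; $F=\{21,22,33,42,43,44,53,54,55,63,64,65,66\}$. *)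

theory Defs
  imports "HOL-Analysis.Analysis"
begin

section \<open>Smooth maps and manifolds\<close>

primrec Ck_on :: "nat \<Rightarrow> 'a::euclidean_space set \<Rightarrow> ('a \<Rightarrow> 'b::real_normed_vector) \<Rightarrow> bool" where
  "Ck_on 0 U f \<longleftrightarrow> continuous_on U f"
| "Ck_on (Suc k) U f \<longleftrightarrow> (\<forall>x\<in>U. f differentiable (at x)) \<and>
     (\<forall>v. Ck_on k U (\<lambda>x. frechet_derivative f (at x) v))"

text \<open>Smoothness on an arbitrary subset means local extendability to a smooth map on an open set.\<close>

definition smooth_on :: "'a::euclidean_space set \<Rightarrow> ('a \<Rightarrow> 'b::real_normed_vector) \<Rightarrow> bool" where
  "smooth_on S f \<longleftrightarrow> (\<forall>x\<in>S. \<exists>U g. open U \<and> x \<in> U \<and> (\<forall>k. Ck_on k U g) \<and> (\<forall>y\<in>S \<inter> U. g y = f y))"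

text \<open>
  The model space of a \<open>k\<close>-dimensional manifold is a \<open>k\<close>-dimensional linear subspace \<open>V\<close> of a
  Euclidean space, since the dimensions needed here depend on a parameter. A chart is a pair
  \<open>(U, \<phi>)\<close>; the values of \<open>\<phi>\<close> outside \<open>U\<close> are irrelevant.
\<close>

definition chart_on :: "'e::euclidean_space set \<Rightarrow> 'x topology \<Rightarrow> 'x set \<times> ('x \<Rightarrow> 'e) \<Rightarrow> bool" where
  "chart_on V X = (\<lambda>(U, \<phi>). openin X U \<and> openin (top_of_set V) (\<phi> ` U) \<and>
     homeomorphic_map (subtopology X U) (top_of_set (\<phi> ` U)) \<phi>)"

definition smooth_manifold ::
    "'e::euclidean_space set \<Rightarrow> 'x topology \<Rightarrow> ('x set \<times> ('x \<Rightarrow> 'e)) set \<Rightarrow> bool" where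
  "smooth_manifold V X A \<longleftrightarrow>
     subspace V \<and> Hausdorff_space X \<and> second_countable X \<and>
     (\<forall>c\<in>A. chart_on V X c) \<and> (\<Union>(U, \<phi>)\<in>A. U) = topspace X \<and>
     (\<forall>(U, \<phi>)\<in>A. \<forall>(W, \<psi>)\<in>A. smooth_on (\<phi> ` (U \<inter> W)) (\<psi> \<circ> inv_into U \<phi>))"

definition smooth_map ::
    "'x topology \<Rightarrow> ('x set \<times> ('x \<Rightarrow> 'e::euclidean_space)) set \<Rightarrow>
     'y topology \<Rightarrow> ('y set \<times> ('y \<Rightarrow> 'f::euclidean_space)) set \<Rightarrow> ('x \<Rightarrow> 'y) \<Rightarrow> bool" where
  "smooth_map X A Y B f \<longleftrightarrow> continuous_map X Y f \<and>
     (\<forall>(U, \<phi>)\<in>A. \<forall>(W, \<psi>)\<in>B. smooth_on (\<phi> ` {p \<in> U. f p \<in> W}) (\<psi> \<circ> f \<circ> inv_into U \<phi>))"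

definition diffeomorphic ::
    "'x topology \<Rightarrow> ('x set \<times> ('x \<Rightarrow> 'e::euclidean_space)) set \<Rightarrow>
     'y topology \<Rightarrow> ('y set \<times> ('y \<Rightarrow> 'f::euclidean_space)) set \<Rightarrow> bool" where
  "diffeomorphic X A Y B \<longleftrightarrow>
     (\<exists>f g. homeomorphic_maps X Y f g \<and> smooth_map X A Y B f \<and> smooth_map Y B X A g)"

text \<open>
  In charts the derivative is taken within a relatively open subset of the model space \<open>V\<close>;
  this determines \<open>L\<close> on \<open>V\<close>, but not outside it.
\<close>

definition smooth_submersion ::
    "'e::euclidean_space set \<Rightarrow> 'x topology \<Rightarrow> ('x set \<times> ('x \<Rightarrow> 'e)) set \<Rightarrow>
     'f::euclidean_space set \<Rightarrow> 'y topology \<Rightarrow> ('y set \<times> ('y \<Rightarrow> 'f)) set \<Rightarrow> ('x \<Rightarrow> 'y) \<Rightarrow> bool" where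
  "smooth_submersion V X A V' Y B f \<longleftrightarrow> smooth_map X A Y B f \<and>
     (\<forall>(U, \<phi>)\<in>A. \<forall>(W, \<psi>)\<in>B. \<forall>p\<in>U. f p \<in> W \<longrightarrow>
        (\<exists>L. (\<psi> \<circ> f \<circ> inv_into U \<phi> has_derivative L) (at (\<phi> p) within \<phi> ` {q \<in> U. f q \<in> W}) \<and>
             L ` V = V'))"

subsection \<open>Embedded submanifolds of a Euclidean space\<close>

definition slice_chart ::
    "'e::euclidean_space set \<Rightarrow> 'e set \<Rightarrow> 'e set \<Rightarrow> ('e \<Rightarrow> 'e) \<Rightarrow> bool" where
  "slice_chart V S U \<psi> \<longleftrightarrow> (\<exists>W \<psi>'. open U \<and> open W \<and> homeomorphism U W \<psi> \<psi>' \<and>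
     smooth_on U \<psi> \<and> smooth_on W \<psi>' \<and> \<psi> ` (S \<inter> U) = V \<inter> W)"

text \<open>
  A subset of an embedded submanifold \<open>N\<close> is an embedded submanifold of \<open>N\<close> iff it is one of the
  ambient Euclidean space, so there is no separate relative notion.
\<close>

definition submanifold :: "'e::euclidean_space set \<Rightarrow> 'e set \<Rightarrow> bool" where
  "submanifold V S \<longleftrightarrow> subspace V \<and> (\<forall>p\<in>S. \<exists>U \<psi>. p \<in> U \<and> slice_chart V S U \<psi>)"

definition slice_atlas :: "'e::euclidean_space set \<Rightarrow> 'e set \<Rightarrow> ('e set \<times> ('e \<Rightarrow> 'e)) set" where
  "slice_atlas V S = {(S \<inter> U, \<psi>) |U \<psi>. slice_chart V S U \<psi>}"

definition tangent_space :: "'e::euclidean_space set \<Rightarrow> 'e \<Rightarrow> 'e set" where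
  "tangent_space S p = {v. \<exists>\<gamma> \<epsilon>. (0::real) < \<epsilon> \<and> smooth_on {-\<epsilon><..<\<epsilon>} \<gamma> \<and> \<gamma> ` {-\<epsilon><..<\<epsilon>} \<subseteq> S \<and>
     \<gamma> 0 = p \<and> (\<gamma> has_vector_derivative v) (at 0)}"

definition transversal_in :: "'e::euclidean_space set \<Rightarrow> 'e set \<Rightarrow> 'e set \<Rightarrow> bool" where
  "transversal_in N S S' \<longleftrightarrow> (\<forall>p \<in> S \<inter> S'.
     {u + v |u v. u \<in> tangent_space S p \<and> v \<in> tangent_space S' p} = tangent_space N p)"

section \<open>Lie algebras on \<open>\<real>\<^sup>n\<close>\<close>

definition lie_bracket :: "(real^'n \<Rightarrow> real^'n \<Rightarrow> real^'n) \<Rightarrow> bool" where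
  "lie_bracket h \<longleftrightarrow> bilinear h \<and> (\<forall>x. h x x = 0) \<and>
     (\<forall>x y z. h x (h y z) + h y (h z x) + h z (h x y) = 0)"

primrec lower_central :: "(real^'n \<Rightarrow> real^'n \<Rightarrow> real^'n) \<Rightarrow> nat \<Rightarrow> (real^'n) set" where
  "lower_central h 0 = UNIV"
| "lower_central h (Suc k) = span {h x y |x y. y \<in> lower_central h k}"

definition nilpotent_lie :: "(real^'n \<Rightarrow> real^'n \<Rightarrow> real^'n) \<Rightarrow> bool" where
  "nilpotent_lie h \<longleftrightarrow> lie_bracket h \<and> (\<exists>k. lower_central h k = {0})"

text \<open>Endomorphisms of \<open>\<real>\<^sup>n\<close> are identified with their matrices.\<close>

definition Der :: "(real^'n \<Rightarrow> real^'n \<Rightarrow> real^'n) \<Rightarrow> (real^'n^'n) set" where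
  "Der h = {D. \<forall>x y. D *v h x y = h (D *v x) y + h x (D *v y)}"

definition Aut :: "(real^'n \<Rightarrow> real^'n \<Rightarrow> real^'n) \<Rightarrow> (real^'n^'n) set" where
  "Aut h = {\<phi>. invertible \<phi> \<and> (\<forall>x y. \<phi> *v h x y = h (\<phi> *v x) (\<phi> *v y))}"

primrec derived_series :: "(real^'n^'n) set \<Rightarrow> nat \<Rightarrow> (real^'n^'n) set" where
  "derived_series L 0 = L"
| "derived_series L (Suc k) =
     span {A ** B - B ** A |A B. A \<in> derived_series L k \<and> B \<in> derived_series L k}"

definition solvable_matrix_lie :: "(real^'n^'n) set \<Rightarrow> bool" where
  "solvable_matrix_lie L \<longleftrightarrow> (\<exists>k. derived_series L k = {0})"

definition only_real_eigenvalues :: "real^'n^'n \<Rightarrow> bool" where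
  "only_real_eigenvalues D \<longleftrightarrow>
     (\<forall>(c::complex) v. v \<noteq> 0 \<and> map_matrix complex_of_real D *v v = c *s v \<longrightarrow> c \<in> \<real>)"

definition cslat :: "(real^'n \<Rightarrow> real^'n \<Rightarrow> real^'n) \<Rightarrow> bool" where
  "cslat h \<longleftrightarrow> nilpotent_lie h \<and> solvable_matrix_lie (Der h) \<and> (\<forall>D\<in>Der h. only_real_eigenvalues D)"

section \<open>The six-dimensional CSLATs\<close>

datatype cslat6 = H9 | H10 | H11 | H12 | H13 | H14 | H18 | H19p | H21 | H22
  | H23 | H24 | H25 | H26m | H27 | H28 | H29 | H30 | H31 | H32

text \<open>
  The structure tuples: each of the six entries is a list of signed terms, where \<open>(c, i, j)\<close>
  stands for \<open>c\<close> times the term \<open>ij\<close>. \<open>H19p\<close> and \<open>H26m\<close> are the algebras usually written with a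
  superscript plus and minus, respectively.
\<close>

fun tuple :: "cslat6 \<Rightarrow> (real \<times> 6 \<times> 6) list list" where
  "tuple H9 = [[], [], [], [], [(1,1,2)], [(1,5,1), (1,2,3)]]"
| "tuple H10 = [[], [], [], [(1,1,2)], [(1,1,3)], [(1,1,4)]]"
| "tuple H11 = [[], [], [], [(1,1,2)], [(1,1,3)], [(1,1,4), (1,2,3)]]"
| "tuple H12 = [[], [], [], [(1,1,2)], [(1,1,3)], [(1,2,4)]]"
| "tuple H13 = [[], [], [], [(1,1,2)], [(1,1,3), (1,1,4)], [(1,2,4)]]"
| "tuple H14 = [[], [], [], [(1,1,2)], [(1,1,4)], [(1,1,3), (1,4,2)]]"
| "tuple H18 = [[], [], [], [(1,1,2)], [(1,1,3)], [(1,1,5), (1,2,4)]]"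
| "tuple H19p = [[], [], [], [(1,2,3)], [(1,2,1)], [(1,1,4), (1,3,5)]]"
| "tuple H21 = [[], [], [], [(1,1,2)], [(1,1,4)], [(1,1,5)]]"
| "tuple H22 = [[], [], [], [(1,1,2)], [(1,1,4)], [(1,1,5), (1,2,4)]]"
| "tuple H23 = [[], [], [(1,1,2)], [(1,1,3)], [(1,2,3)], [(1,1,4)]]"
| "tuple H24 = [[], [], [], [(1,1,2)], [(1,1,4)], [(1,1,5), (1,2,3), (1,2,4)]]"
| "tuple H25 = [[], [], [], [(1,1,2)], [(1,1,4)], [(1,1,5), (1,2,3)]]"
| "tuple H26m = [[], [], [(1,1,2)], [(1,3,1)], [(1,3,2)], [(1,1,5), (1,2,4)]]"
| "tuple H27 = [[], [], [], [(1,1,2)], [(1,1,4), (- 1,2,3)], [(1,1,5), (1,3,4)]]"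
| "tuple H28 = [[], [], [(1,1,2)], [(1,1,3)], [(1,1,4)], [(1,1,5)]]"
| "tuple H29 = [[], [], [(1,1,2)], [(1,1,3)], [(1,1,4)], [(1,2,3), (1,1,5)]]"
| "tuple H30 = [[], [], [(1,1,2)], [(1,1,3)], [(1,1,4), (1,2,3)], [(1,2,4), (1,1,5)]]"
| "tuple H31 = [[], [], [(1,1,2)], [(1,1,3)], [(1,1,4)], [(1,3,4), (1,5,2)]]"
| "tuple H32 = [[], [], [(1,1,2)], [(1,1,3)], [(1,1,4), (1,2,3)], [(1,3,4), (1,5,2)]]"

fun free :: "cslat6 \<Rightarrow> (6 \<times> 6) set" where
  "free H9 = {(3,3), (5,3), (5,4), (5,5), (6,5), (6,6)}"
| "free H10 = {(4,4), (5,4), (5,5), (6,4), (6,5), (6,6)}"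
| "free H11 = {(3,3), (4,4), (5,4), (5,5), (6,4), (6,5), (6,6)}"
| "free H12 = {(2,1), (4,3), (4,4), (5,4), (5,5), (6,4), (6,5), (6,6)}"
| "free H13 = {(2,1), (3,3), (4,3), (4,4), (5,4), (5,5), (6,4), (6,5), (6,6)}"
| "free H14 = {(3,3), (4,3), (4,4), (5,4), (5,5), (6,4), (6,5), (6,6)}"
| "free H18 = {(3,2), (3,3), (4,3), (4,4), (5,4), (5,5), (6,4), (6,5), (6,6)}"
| "free H19p = {(2,1), (3,1), (3,2), (4,4), (5,1), (5,4), (5,5), (6,4), (6,5), (6,6)}"
| "free H21 = {(4,3), (4,4), (5,3), (5,4), (5,5), (6,4), (6,5), (6,6)}"
| "free H22 = {(2,2), (4,3), (4,4), (5,3), (5,4), (5,5), (6,4), (6,5), (6,6)}"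
| "free H23 = {(3,3), (4,3), (4,4), (5,3), (5,4), (5,5), (6,3), (6,4), (6,5), (6,6)}"
| "free H24 = {(2,2), (3,3), (4,3), (4,4), (5,3), (5,4), (5,5), (6,4), (6,5), (6,6)}"
| "free H25 = {(3,3), (4,3), (4,4), (5,3), (5,4), (5,5), (6,4), (6,5), (6,6)}"
| "free H26m = {(2,1), (3,3), (4,3), (4,4), (5,3), (5,4), (5,5), (6,3), (6,4), (6,5), (6,6)}"
| "free H27 = {(3,1), (3,2), (3,3), (4,3), (4,4), (5,3), (5,4), (5,5), (6,4), (6,5), (6,6)}"
| "free H28 = {(3,3), (4,3), (4,4), (5,3), (5,4), (5,5), (6,3), (6,4), (6,5), (6,6)}"
| "free H29 = {(2,2), (3,3), (4,3), (4,4), (5,3), (5,4), (5,5), (6,3), (6,4), (6,5), (6,6)}"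
| "free H30 = {(2,1), (2,2), (3,3), (4,3), (4,4), (5,3), (5,4), (5,5), (6,3), (6,4), (6,5), (6,6)}"
| "free H31 = {(2,1), (3,3), (4,2), (4,3), (4,4), (5,3), (5,4), (5,5), (6,3), (6,4), (6,5), (6,6)}"
| "free H32 = {(2,1), (2,2), (3,3), (4,2), (4,3), (4,4), (5,3), (5,4), (5,5), (6,3), (6,4), (6,5), (6,6)}"

text \<open>
  In the index type \<open>6\<close> the numeral \<open>6\<close> equals \<open>0\<close> and is therefore the least element.
  \<open>pos\<close> restores the order \<open>1 < 2 < \<dots> < 6\<close>.
\<close>

definition pos :: "6 \<Rightarrow> nat" where
  "pos i = (if i = 1 then 1 else if i = 2 then 2 else if i = 3 then 3 else if i = 4 then 4
     else if i = 5 then 5 else 6)"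

text \<open>The sign is as in \<open>de\<^sup>k(x, y) = - e\<^sup>k([x, y])\<close>.\<close>

definition bracket :: "cslat6 \<Rightarrow> real^6 \<Rightarrow> real^6 \<Rightarrow> real^6" where
  "bracket n x y =
     (\<chi> k. - (\<Sum>(c, i, j)\<leftarrow>tuple n ! (pos k - 1). c * (x $ i * y $ j - x $ j * y $ i)))"

text \<open>The columns of \<open>E\<close> form a basis of \<open>h\<close> with the structure constants of the algebra \<open>n\<close>.\<close>

definition standard_basis :: "cslat6 \<Rightarrow> (real^6 \<Rightarrow> real^6 \<Rightarrow> real^6) \<Rightarrow> real^6^6 \<Rightarrow> bool" where
  "standard_basis n h E \<longleftrightarrow> invertible E \<and> (\<forall>x y. h (E *v x) (E *v y) = E *v bracket n x y)"

definition Aut0 :: "(real^6 \<Rightarrow> real^6 \<Rightarrow> real^6) \<Rightarrow> (real^6^6) set" where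
  "Aut0 h = connected_component_set (Aut h) (mat 1)"

definition Aut0_in_basis :: "(real^6 \<Rightarrow> real^6 \<Rightarrow> real^6) \<Rightarrow> real^6^6 \<Rightarrow> (real^6^6) set" where
  "Aut0_in_basis h E = (\<lambda>\<phi>. matrix_inv E ** \<phi> ** E) ` Aut0 h"

section \<open>Left-invariant metrics\<close>

definition sym_matrices :: "(real^6^6) set" where
  "sym_matrices = {g. transpose g = g}"

text \<open>
  A left-invariant metric is an inner product on the Lie algebra, given by its Gram matrix in the
  standard basis.
\<close>

definition metrics :: "(real^6^6) set" where
  "metrics = {g \<in> sym_matrices. \<forall>x. x \<noteq> 0 \<longrightarrow> 0 < x \<bullet> (g *v x)}"

definition orbit :: "(real^6^6) set \<Rightarrow> real^6^6 \<Rightarrow> (real^6^6) set" where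
  "orbit G g = {transpose \<phi> ** g ** \<phi> |\<phi>. \<phi> \<in> G}"

definition orbit_space :: "(real^6^6) set \<Rightarrow> (real^6^6) set topology" where
  "orbit_space G = topology (\<lambda>U. U \<subseteq> orbit G ` metrics \<and>
     openin (top_of_set metrics) {g \<in> metrics. orbit G g \<in> U})"

lemma openin_orbit_space:
  "openin (orbit_space G) U \<longleftrightarrow> U \<subseteq> orbit G ` metrics \<and>
     openin (top_of_set metrics) {g \<in> metrics. orbit G g \<in> U}"
proof -
  have "istopology (\<lambda>U. U \<subseteq> orbit G ` metrics \<and>
     openin (top_of_set metrics) {g \<in> metrics. orbit G g \<in> U})"
    unfolding istopology_def
  proof (intro conjI allI impI)
    fix S T
    assume S: "S \<subseteq> orbit G ` metrics \<and> openin (top_of_set metrics) {g \<in> metrics. orbit G g \<in> S}"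
      and T: "T \<subseteq> orbit G ` metrics \<and> openin (top_of_set metrics) {g \<in> metrics. orbit G g \<in> T}"
    show "S \<inter> T \<subseteq> orbit G ` metrics" using S by blast
    have "{g \<in> metrics. orbit G g \<in> S \<inter> T} =
        {g \<in> metrics. orbit G g \<in> S} \<inter> {g \<in> metrics. orbit G g \<in> T}"
      by auto
    then show "openin (top_of_set metrics) {g \<in> metrics. orbit G g \<in> S \<inter> T}"
      using S T by (simp add: openin_Int)
  next
    fix K
    assume K: "\<forall>S\<in>K. S \<subseteq> orbit G ` metrics \<and>
      openin (top_of_set metrics) {g \<in> metrics. orbit G g \<in> S}"
    then show "\<Union>K \<subseteq> orbit G ` metrics" by blast
    have "{g \<in> metrics. orbit G g \<in> \<Union>K} = (\<Union>S\<in>K. {g \<in> metrics. orbit G g \<in> S})"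
      by auto
    then show "openin (top_of_set metrics) {g \<in> metrics. orbit G g \<in> \<Union>K}"
      using K by (auto intro!: openin_Union)
  qed
  then show ?thesis by (simp add: orbit_space_def)
qed

lemma quotient_map_orbit: "quotient_map (top_of_set metrics) (orbit_space G) (orbit G)"
proof -
  have "{g \<in> metrics. orbit G g \<in> orbit G ` metrics} = metrics"
    by blast
  then have "openin (orbit_space G) (orbit G ` metrics)"
    by (simp add: openin_orbit_space)
  moreover have "topspace (orbit_space G) \<subseteq> orbit G ` metrics"
    using openin_topspace[of "orbit_space G"] unfolding openin_orbit_space by blast
  ultimately have "topspace (orbit_space G) = orbit G ` metrics"
    by (simp add: openin_subset subset_antisym)
  then show ?thesis by (auto simp: quotient_map_def openin_orbit_space)
qed

definition T6 :: "(real^6^6) set" where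
  "T6 = {\<sigma>. (\<forall>i j. pos i < pos j \<longrightarrow> \<sigma> $ i $ j = 0) \<and> (\<forall>i. 0 < \<sigma> $ i $ i)}"

definition Sigma_free :: "(6 \<times> 6) set \<Rightarrow> (real^6^6) set" where
  "Sigma_free F = {\<sigma>. (\<forall>i j. pos i < pos j \<longrightarrow> \<sigma> $ i $ j = 0) \<and>
     (\<forall>i j. pos i > pos j \<and> (i, j) \<notin> F \<longrightarrow> \<sigma> $ i $ j = 0) \<and>
     (\<forall>i. if (i, i) \<in> F then 0 < \<sigma> $ i $ i else \<sigma> $ i $ i = 1)}"

end

theory Submission
  imports Defs
begin

text \<open>
  Let \<open>G\<close> be the identity component of the automorphism group, in the standard basis, and write
  \<open>F\<close> for the set of free positions. The Cholesky decomposition \<open>g = t\<^sup>T t\<close> with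
  \<open>t\<close> lower triangular of positive diagonal identifies the metrics with \<open>T6\<close>, and it turns
  the action of \<open>G\<close> into right multiplication. Hence the orbit space is the coset space \<open>T6 / G\<close>,
  and everything follows once each \<open>t \<in> T6\<close> has a unique factorization \<open>t = s a\<close> with
  \<open>s \<in> \<Sigma>(F)\<close> and \<open>a \<in> G\<close>, and \<open>s\<close> and \<open>a\<close> depend smoothly on \<open>t\<close>: the factor
  \<open>s\<close> is a smooth complete invariant of the orbits (locale \<open>cross_section\<close>).

  The factorization exists because \<open>G\<close> is a graph: an element of \<open>G\<close> is determined by its
  leading entries, those at the lower triangular positions outside \<open>F\<close>, and its entry at a position
  in \<open>F\<close> is a rational function of leading entries that come earlier when the positions are read row
  by row. In that order the equation \<open>t\<^sub>i\<^sub>j = s\<^sub>i\<^sub>i a\<^sub>i\<^sub>j + s\<^sub>i\<^sub>j a\<^sub>j\<^sub>j + \<dots>\<close> involves exactly one new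
  unknown, namely \<open>s\<^sub>i\<^sub>j\<close> if the position is in \<open>F\<close> and \<open>a\<^sub>i\<^sub>j\<close> otherwise, and its
  coefficient is a positive diagonal entry (\<open>factorization_exists\<close>, \<open>factorization_unique\<close>).

  To identify \<open>G\<close> with an explicit graph, the equations for automorphisms need not be solved
  completely. Two finite verifications suffice for each algebra: the members of the given family are
  automorphisms, and a derivation whose leading entries vanish is zero. The family is connected, being
  parametrized by a convex set, and closed in the automorphism group. It is also open there: an
  automorphism near a member of the family factors as \<open>u s a\<close> with \<open>u\<close> unipotent upper
  triangular, \<open>s \<in> \<Sigma>(F)\<close> and \<open>a\<close> in the family, so \<open>u s\<close> is an automorphism near the
  identity; to first order \<open>u s - 1\<close> is a derivation without leading entries, which forces \<open>u s = 1\<close>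
  (\<open>no_transversal_automorphism\<close>, \<open>graph_locally_Aut\<close>, \<open>identity_component\<close>).
\<close>

section \<open>Calculus of smooth maps\<close>

lemma Ck_on_Suc_imp: "Ck_on (Suc k) U f \<Longrightarrow> Ck_on k U f"
proof (induction k arbitrary: f)
  case 0
  then show ?case
    by (simp add: continuous_at_imp_continuous_on differentiable_imp_continuous_within)
next
  case (Suc k)
  then show ?case by (metis Ck_on.simps(2))
qed

lemma Ck_on_subset: "Ck_on k U f \<Longrightarrow> T \<subseteq> U \<Longrightarrow> Ck_on k T f"
  by (induction k arbitrary: f) (auto intro: continuous_on_subset)

lemma Ck_on_cong:
  assumes "open U" "\<And>x. x \<in> U \<Longrightarrow> f x = g x" "Ck_on k U f"
  shows "Ck_on k U g"
  using assms(2,3)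
proof (induction k arbitrary: f g)
  case 0
  then show ?case by (simp cong: continuous_on_cong)
next
  case (Suc k)
  have der: "(g has_derivative frechet_derivative f (at x)) (at x)" if x: "x \<in> U" for x
  proof -
    have "(f has_derivative frechet_derivative f (at x)) (at x)"
      using Suc.prems(2) x by (simp flip: frechet_derivative_works)
    then show ?thesis
      using has_derivative_transform_within_open[OF _ assms(1) x] Suc.prems(1) by blast
  qed
  then have eq: "frechet_derivative f (at x) v = frechet_derivative g (at x) v" if "x \<in> U" for x v
    using frechet_derivative_at that by metis
  have "g differentiable (at x)" if "x \<in> U" for x
    using der[OF that] by (auto simp: differentiable_def)
  moreover have "Ck_on k U (\<lambda>x. frechet_derivative g (at x) v)" for v
    using Suc.IH[of "\<lambda>x. frechet_derivative f (at x) v" "\<lambda>x. frechet_derivative g (at x) v"] eq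
      Suc.prems(2) by simp
  ultimately show ?case by simp
qed

text \<open>
  All closure properties below are proved by exhibiting the derivative as an expression in maps
  that are already known to be of class \<open>C\<^sup>k\<close>.
\<close>

lemma Ck_on_SucI:
  assumes "open U" "\<And>x. x \<in> U \<Longrightarrow> (f has_derivative f' x) (at x)"
    "\<And>v. Ck_on k U (\<lambda>x. f' x v)"
  shows "Ck_on (Suc k) U f"
proof -
  have "frechet_derivative f (at x) = f' x" if "x \<in> U" for x
    using frechet_derivative_at[OF assms(2)[OF that]] by simp
  then have "Ck_on k U (\<lambda>x. frechet_derivative f (at x) v)" for v
    using Ck_on_cong[OF assms(1) _ assms(3)[of v]] by simp
  then show ?thesis using assms(2) by (auto simp: differentiable_def)
qed

lemma Ck_on_SucD:
  assumes "Ck_on (Suc k) U f" "x \<in> U"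
  shows "(f has_derivative frechet_derivative f (at x)) (at x)"
  using assms by (simp flip: frechet_derivative_works)

lemma Ck_on_const: "open U \<Longrightarrow> Ck_on k U (\<lambda>x. c)"
proof (induction k arbitrary: c)
  case (Suc k)
  show ?case by (rule Ck_on_SucI[OF Suc.prems]) (auto intro: Suc derivative_eq_intros)
qed simp

lemma Ck_on_linear:
  assumes "bounded_linear f" "open U"
  shows "Ck_on k U f"
proof (cases k)
  case 0
  then show ?thesis
    using bounded_linear.continuous_on[OF assms(1) continuous_on_id] by simp
next
  case (Suc m)
  show ?thesis unfolding Suc
    by (rule Ck_on_SucI[OF assms(2)])
      (use assms in \<open>auto intro: Ck_on_const bounded_linear_imp_has_derivative\<close>)
qed

lemma Ck_on_add:
  assumes "open U"
  shows "Ck_on k U f \<Longrightarrow> Ck_on k U g \<Longrightarrow> Ck_on k U (\<lambda>x. f x + g x)"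
proof (induction k arbitrary: f g)
  case 0
  then show ?case by (simp add: continuous_on_add)
next
  case (Suc k)
  show ?case
    by (rule Ck_on_SucI[OF assms has_derivative_add[OF Ck_on_SucD[OF Suc.prems(1)] Ck_on_SucD[OF Suc.prems(2)]]])
      (use Suc in auto)
qed

lemma Ck_on_bilinear:
  assumes "bounded_bilinear b" "open U"
  shows "Ck_on k U f \<Longrightarrow> Ck_on k U g \<Longrightarrow> Ck_on k U (\<lambda>x. b (f x) (g x))"
proof (induction k arbitrary: f g)
  case 0
  then show ?case using bounded_bilinear.continuous_on[OF assms(1)] by simp
next
  case (Suc k)
  note d = bounded_bilinear.FDERIV[OF assms(1) Ck_on_SucD[OF Suc.prems(1)] Ck_on_SucD[OF Suc.prems(2)]]
  have fg: "Ck_on k U f" "Ck_on k U g"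
    using Suc.prems Ck_on_Suc_imp by blast+
  show ?case
    by (rule Ck_on_SucI[OF assms(2) d]) (use Suc fg in \<open>auto intro!: Ck_on_add[OF assms(2)]\<close>)
qed

lemma Ck_on_sum:
  assumes "open U" "finite I" "\<And>i. i \<in> I \<Longrightarrow> Ck_on k U (f i)"
  shows "Ck_on k U (\<lambda>x. \<Sum>i\<in>I. f i x)"
  using assms(2,3) by (induction I rule: finite_induct) (auto intro!: Ck_on_add Ck_on_const assms(1))

text \<open>
  The chain rule turns the derivative of a composition into
  \<open>\<Sum>\<^sub>b \<langle>Df(x) v, b\<rangle> Dg(f x) b\<close>, where the factors are covered by the induction hypothesis.
\<close>

lemma Ck_on_compose:
  fixes f :: "'a::euclidean_space \<Rightarrow> 'b::euclidean_space" and g :: "'b \<Rightarrow> 'c::real_normed_vector"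
  assumes "open U" "open W" "f ` U \<subseteq> W"
  shows "Ck_on k U f \<Longrightarrow> Ck_on k W g \<Longrightarrow> Ck_on k U (\<lambda>x. g (f x))"
proof (induction k arbitrary: g)
  case 0
  then show ?case
    using continuous_on_compose2[of W g U f] assms(3) by simp
next
  case (Suc k)
  let ?f' = "\<lambda>x. frechet_derivative f (at x)" and ?g' = "\<lambda>x. frechet_derivative g (at x)"
  have d: "((\<lambda>x. g (f x)) has_derivative (\<lambda>v. ?g' (f x) (?f' x v))) (at x)" if x: "x \<in> U" for x
    using has_derivative_compose[OF Ck_on_SucD[OF Suc.prems(1) x] Ck_on_SucD[OF Suc.prems(2)]] assms x
    by blast
  have lin: "linear (?g' y)" if "y \<in> W" for y
    using Ck_on_SucD[OF Suc.prems(2) that] has_derivative_linear by blast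
  have eq: "(\<Sum>b\<in>Basis. (?f' x v \<bullet> b) *\<^sub>R ?g' (f x) b) = ?g' (f x) (?f' x v)" if "x \<in> U" for x v
  proof -
    have "linear (?g' (f x))" using lin that assms(3) by blast
    then have "?g' (f x) (\<Sum>b\<in>Basis. (?f' x v \<bullet> b) *\<^sub>R b) = (\<Sum>b\<in>Basis. (?f' x v \<bullet> b) *\<^sub>R ?g' (f x) b)"
      by (simp add: linear_sum linear_scale)
    then show ?thesis by (simp add: euclidean_representation)
  qed
  have f: "Ck_on k U f" using Suc.prems Ck_on_Suc_imp by blast
  have "Ck_on k U (\<lambda>x. ?g' (f x) (?f' x v))" for v
  proof (rule Ck_on_cong[OF assms(1) eq])
    show "Ck_on k U (\<lambda>x. \<Sum>b\<in>Basis. (?f' x v \<bullet> b) *\<^sub>R ?g' (f x) b)"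
    proof (rule Ck_on_sum[OF assms(1) finite_Basis], rule Ck_on_bilinear[OF bounded_bilinear_scaleR assms(1)])
      fix b :: 'b
      show "Ck_on k U (\<lambda>x. ?f' x v \<bullet> b)"
        using Suc.prems(1) by (intro Ck_on_bilinear[OF bounded_bilinear_inner assms(1)] Ck_on_const[OF assms(1)]) simp
      show "Ck_on k U (\<lambda>x. ?g' (f x) b)"
        using Suc.IH[OF f, of "\<lambda>y. ?g' y b"] Suc.prems(2) by simp
    qed
  qed
  from Ck_on_SucI[OF assms(1) d this] show ?case .
qed

lemma Ck_on_inverse: "Ck_on k {x::real. x \<noteq> 0} inverse"
proof (induction k)
  case 0
  then show ?case by (auto intro!: continuous_intros)
next
  case (Suc k)
  have o: "open {x::real. x \<noteq> 0}" by (simp add: open_Collect_neq)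
  have d: "(inverse has_derivative (\<lambda>h. - (inverse x * h * inverse x))) (at x)"
    if "x \<in> {x::real. x \<noteq> 0}" for x
    using that by (auto intro: has_derivative_inverse')
  have "Ck_on k {x::real. x \<noteq> 0} (\<lambda>x. (- v) * (inverse x * inverse x))" for v
    by (intro Ck_on_bilinear[OF bounded_bilinear_mult] Ck_on_const o Suc)
  then have "Ck_on k {x::real. x \<noteq> 0} (\<lambda>x. - (inverse x * v * inverse x))" for v
    by (simp add: mult_ac)
  from Ck_on_SucI[OF o d this] show ?case .
qed

lemma Ck_on_sqrt: "Ck_on k {x::real. x > 0} sqrt"
proof (induction k)
  case 0
  then show ?case by (auto intro!: continuous_intros)
next
  case (Suc k)
  have o: "open {x::real. x > 0}" "open {x::real. x \<noteq> 0}"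
    by (simp_all add: open_Collect_neq open_Collect_less)
  have d: "(sqrt has_derivative (\<lambda>h. h * (inverse (sqrt x) / 2))) (at x)"
    if "x \<in> {x::real. x > 0}" for x
    by (rule has_derivative_eq_rhs[OF DERIV_real_sqrt[unfolded has_field_derivative_def]])
      (use that in auto)
  have i: "Ck_on k {x::real. x > 0} (\<lambda>x. inverse (sqrt x))"
    by (rule Ck_on_compose[OF o _ Suc Ck_on_inverse]) auto
  have "Ck_on k {x::real. x > 0} (\<lambda>x. (v / 2) * inverse (sqrt x))" for v
    by (intro Ck_on_bilinear[OF bounded_bilinear_mult] Ck_on_const o i)
  then have "Ck_on k {x::real. x > 0} (\<lambda>x. v * (inverse (sqrt x) / 2))" for v
    by (simp add: mult_ac)
  from Ck_on_SucI[OF o(1) d this] show ?case .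
qed

lemma smooth_on_openI: "open U \<Longrightarrow> (\<And>k. Ck_on k U f) \<Longrightarrow> smooth_on U f"
  unfolding smooth_on_def by blast

lemma smooth_onE:
  assumes "smooth_on S f" "x \<in> S"
  obtains U g where "open U" "x \<in> U" "\<And>k. Ck_on k U g" "\<And>y. y \<in> S \<Longrightarrow> y \<in> U \<Longrightarrow> g y = f y"
proof -
  obtain U g where "open U \<and> x \<in> U \<and> (\<forall>k. Ck_on k U g) \<and> (\<forall>y\<in>S \<inter> U. g y = f y)"
    using assms unfolding smooth_on_def by (drule_tac bspec) blast+
  then show thesis by (intro that[of U g]) auto
qed

lemma smooth_onI:
  assumes "\<And>x. x \<in> S \<Longrightarrow> \<exists>U g. open U \<and> x \<in> U \<and> (\<forall>k. Ck_on k U g) \<and> (\<forall>y. y \<in> S \<and> y \<in> U \<longrightarrow> g y = f y)"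
  shows "smooth_on S f"
  unfolding smooth_on_def using assms by (simp add: Ball_def)

lemma smooth_on_subset:
  assumes "smooth_on T f" "S \<subseteq> T" shows "smooth_on S f"
proof (rule smooth_onI)
  fix x assume "x \<in> S"
  with assms(2) have "x \<in> T" by blast
  then obtain U g where "open U" "x \<in> U" "\<And>k. Ck_on k U g" "\<And>y. y \<in> T \<Longrightarrow> y \<in> U \<Longrightarrow> g y = f y"
    using smooth_onE[OF assms(1)] by blast
  then show "\<exists>U g. open U \<and> x \<in> U \<and> (\<forall>k. Ck_on k U g) \<and> (\<forall>y. y \<in> S \<and> y \<in> U \<longrightarrow> g y = f y)"
    using assms(2) by (intro exI[of _ U] exI[of _ g]) auto
qed

lemma smooth_on_cong:
  assumes "\<And>x. x \<in> S \<Longrightarrow> f x = g x" "smooth_on S f" shows "smooth_on S g"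
  using assms(2) unfolding smooth_on_def by (simp add: assms(1))

lemma smooth_on_const: "smooth_on S (\<lambda>x. c)"
  by (rule smooth_on_subset[OF smooth_on_openI[OF open_UNIV]]) (auto intro: Ck_on_const)

lemma smooth_on_linear: "bounded_linear f \<Longrightarrow> smooth_on S f"
  by (rule smooth_on_subset[OF smooth_on_openI[OF open_UNIV]]) (auto intro: Ck_on_linear)

lemma smooth_on_id: "smooth_on S (\<lambda>x. x)"
  by (rule smooth_on_linear) (rule bounded_linear_ident)

lemma smooth_on_bilinear:
  assumes b: "bounded_bilinear b" and f: "smooth_on S f" and g: "smooth_on S g"
  shows "smooth_on S (\<lambda>x. b (f x) (g x))"
  unfolding smooth_on_def
proof
  fix x assume x: "x \<in> S"
  obtain U u where U: "open U" "x \<in> U" "\<And>k. Ck_on k U u" "\<And>y. y \<in> S \<inter> U \<Longrightarrow> u y = f y"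
    using f x unfolding smooth_on_def by metis
  obtain W w where W: "open W" "x \<in> W" "\<And>k. Ck_on k W w" "\<And>y. y \<in> S \<inter> W \<Longrightarrow> w y = g y"
    using g x unfolding smooth_on_def by metis
  have "Ck_on k (U \<inter> W) (\<lambda>x. b (u x) (w x))" for k
    by (rule Ck_on_bilinear[OF b]) (use U W in \<open>auto intro: Ck_on_subset\<close>)
  then show "\<exists>U g'. open U \<and> x \<in> U \<and> (\<forall>k. Ck_on k U g') \<and> (\<forall>y\<in>S \<inter> U. g' y = b (f y) (g y))"
    using U W by (intro exI[of _ "U \<inter> W"] exI[of _ "\<lambda>x. b (u x) (w x)"]) auto
qed

lemma smooth_on_add:
  assumes f: "smooth_on S f" and g: "smooth_on S g"
  shows "smooth_on S (\<lambda>x. f x + g x)"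
  unfolding smooth_on_def
proof
  fix x assume x: "x \<in> S"
  obtain U u where U: "open U" "x \<in> U" "\<And>k. Ck_on k U u" "\<And>y. y \<in> S \<inter> U \<Longrightarrow> u y = f y"
    using f x unfolding smooth_on_def by metis
  obtain W w where W: "open W" "x \<in> W" "\<And>k. Ck_on k W w" "\<And>y. y \<in> S \<inter> W \<Longrightarrow> w y = g y"
    using g x unfolding smooth_on_def by metis
  have "Ck_on k (U \<inter> W) (\<lambda>x. u x + w x)" for k
    by (rule Ck_on_add) (use U W in \<open>auto intro: Ck_on_subset\<close>)
  then show "\<exists>U g'. open U \<and> x \<in> U \<and> (\<forall>k. Ck_on k U g') \<and> (\<forall>y\<in>S \<inter> U. g' y = f y + g y)"
    using U W by (intro exI[of _ "U \<inter> W"] exI[of _ "\<lambda>x. u x + w x"]) auto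
qed

lemma smooth_on_compose:
  fixes f :: "'a::euclidean_space \<Rightarrow> 'b::euclidean_space" and g :: "'b \<Rightarrow> 'c::real_normed_vector"
  assumes g: "smooth_on T g" and f: "smooth_on S f" and "f ` S \<subseteq> T"
  shows "smooth_on S (\<lambda>x. g (f x))"
  unfolding smooth_on_def
proof
  fix x assume x: "x \<in> S"
  obtain U u where U: "open U" "x \<in> U" "\<And>k. Ck_on k U u" "\<And>y. y \<in> S \<inter> U \<Longrightarrow> u y = f y"
    using f x unfolding smooth_on_def by metis
  have fx: "f x \<in> T" using x assms by auto
  obtain W w where W: "open W" "f x \<in> W" "\<And>k. Ck_on k W w" "\<And>y. y \<in> T \<inter> W \<Longrightarrow> w y = g y"
    using g fx unfolding smooth_on_def by metis
  have "continuous_on U u" using U(3)[of 0] by simp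
  then have o: "open (U \<inter> u -` W)"
    using U W continuous_on_open_vimage by (metis inf_commute)
  have "Ck_on k (U \<inter> u -` W) (\<lambda>x. w (u x))" for k
    by (rule Ck_on_compose[OF o W(1) _ Ck_on_subset[OF U(3)] W(3)]) auto
  moreover have "w (u y) = g (f y)" if "y \<in> S \<inter> (U \<inter> u -` W)" for y
    using that U W assms by auto
  moreover have "x \<in> U \<inter> u -` W" using U W x by simp
  ultimately show "\<exists>U g'. open U \<and> x \<in> U \<and> (\<forall>k. Ck_on k U g') \<and> (\<forall>y\<in>S \<inter> U. g' y = g (f y))"
    using o by blast
qed

lemma smooth_on_bounded_linear:
  fixes f :: "'a::euclidean_space \<Rightarrow> 'b::euclidean_space" and g :: "'b \<Rightarrow> 'c::real_normed_vector"
  assumes "bounded_linear g" "smooth_on S f" shows "smooth_on S (\<lambda>x. g (f x))"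
  using smooth_on_compose[OF smooth_on_linear[OF assms(1), of UNIV] assms(2)] by simp

lemma smooth_on_sum:
  assumes "finite I" "\<And>i. i \<in> I \<Longrightarrow> smooth_on S (f i)"
  shows "smooth_on S (\<lambda>x. \<Sum>i\<in>I. f i x)"
  using assms by (induction I rule: finite_induct) (auto intro!: smooth_on_add smooth_on_const)

lemma smooth_on_uminus:
  fixes f :: "'a::euclidean_space \<Rightarrow> 'b::euclidean_space"
  shows "smooth_on S f \<Longrightarrow> smooth_on S (\<lambda>x. - f x)"
  by (rule smooth_on_bounded_linear[OF bounded_linear_minus[OF bounded_linear_ident]])

lemma smooth_on_diff:
  fixes f :: "'a::euclidean_space \<Rightarrow> 'b::euclidean_space"
  assumes "smooth_on S f" "smooth_on S g"
  shows "smooth_on S (\<lambda>x. f x - g x)"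
  using smooth_on_add[OF assms(1) smooth_on_uminus[OF assms(2)]] by simp

lemma smooth_on_mult:
  fixes f :: "'a::euclidean_space \<Rightarrow> real"
  shows "smooth_on S f \<Longrightarrow> smooth_on S g \<Longrightarrow> smooth_on S (\<lambda>x. f x * g x)"
  by (rule smooth_on_bilinear[OF bounded_bilinear_mult])

lemma smooth_on_power:
  fixes f :: "'a::euclidean_space \<Rightarrow> real"
  shows "smooth_on S f \<Longrightarrow> smooth_on S (\<lambda>x. f x ^ m)"
  by (induction m) (auto intro: smooth_on_const smooth_on_mult)

lemma smooth_on_divide:
  fixes f :: "'a::euclidean_space \<Rightarrow> real"
  assumes "smooth_on S f" "smooth_on S g" "\<And>x. x \<in> S \<Longrightarrow> g x \<noteq> 0"
  shows "smooth_on S (\<lambda>x. f x / g x)"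
proof -
  have o: "open {x::real. x \<noteq> 0}" by (simp add: open_Collect_neq)
  have "smooth_on S (\<lambda>x. inverse (g x))"
    by (rule smooth_on_compose[OF smooth_on_openI[OF o Ck_on_inverse] assms(2)]) (use assms(3) in auto)
  then show ?thesis using smooth_on_mult[OF assms(1)] by (simp add: divide_inverse)
qed

lemma smooth_on_sqrt:
  fixes f :: "'a::euclidean_space \<Rightarrow> real"
  assumes "smooth_on S f" "\<And>x. x \<in> S \<Longrightarrow> 0 < f x"
  shows "smooth_on S (\<lambda>x. sqrt (f x))"
proof -
  have o: "open {x::real. x > 0}" by (simp add: open_Collect_less)
  show ?thesis
    by (rule smooth_on_compose[OF smooth_on_openI[OF o Ck_on_sqrt] assms(1)]) (use assms(2) in auto)
qed

lemma smooth_on_component: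
  fixes f :: "'a::euclidean_space \<Rightarrow> 'b::euclidean_space^'n"
  shows "smooth_on S f \<Longrightarrow> smooth_on S (\<lambda>x. f x $ i)"
  by (rule smooth_on_bounded_linear[OF bounded_linear_vec_nth])

lemma smooth_on_vec:
  fixes f :: "'a::euclidean_space \<Rightarrow> 'b::euclidean_space^'n"
  assumes "\<And>i. smooth_on S (\<lambda>x. f x $ i)"
  shows "smooth_on S f"
proof -
  have bl: "bounded_linear (axis i :: 'b \<Rightarrow> 'b^'n)" for i
    by (intro linear_conv_bounded_linear[THEN iffD1] linearI) (auto simp: axis_def vec_eq_iff)
  have "smooth_on S (\<lambda>x. \<Sum>i\<in>UNIV. axis i (f x $ i) :: 'b^'n)"
    by (intro smooth_on_sum smooth_on_bounded_linear[OF bl] assms) simp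
  moreover have "(\<Sum>i\<in>UNIV. axis i (f x $ i)) = f x" for x
    by (simp add: vec_eq_iff axis_def if_distrib[of "\<lambda>x. x $ _"] sum.delta cong: if_cong)
  ultimately show ?thesis by simp
qed

lemmas smooth_intros = smooth_on_const smooth_on_id smooth_on_add smooth_on_diff smooth_on_uminus
  smooth_on_mult smooth_on_power smooth_on_component

lemma smooth_on_continuous_on:
  assumes "smooth_on S f" shows "continuous_on S f"
  unfolding continuous_on_eq_continuous_within
proof
  fix x assume x: "x \<in> S"
  obtain U u where U: "open U" "x \<in> U" "\<And>k. Ck_on k U u" "\<And>y. y \<in> S \<inter> U \<Longrightarrow> u y = f y"
    using assms x unfolding smooth_on_def by metis
  have "continuous_on (S \<inter> U) u" using U(3)[of 0] by (auto intro: continuous_on_subset)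
  then have "continuous_on (S \<inter> U) f" using U(4) by (metis (no_types, lifting) continuous_on_cong)
  then have "continuous (at x within (S \<inter> U)) f"
    using x U by (simp add: continuous_on_eq_continuous_within)
  moreover have "at x within (S \<inter> U) = at x within S"
    using at_within_nhd[of x U "S \<inter> U" S] U(1,2) by auto
  ultimately show "continuous (at x within S) f" by (simp add: continuous_within)
qed

text \<open>The derivative of a local extension; it is not determined by \<open>f\<close> if \<open>S\<close> is thin.\<close>

lemma smooth_on_local_extension:
  assumes "smooth_on S f" "x \<in> S"
  obtains U g g' where "open U" "x \<in> U" "\<And>y. y \<in> S \<inter> U \<Longrightarrow> g y = f y" "(g has_derivative g') (at x)"
proof -
  obtain U u where U: "open U" "x \<in> U" "\<And>k. Ck_on k U u" "\<And>y. y \<in> S \<inter> U \<Longrightarrow> u y = f y"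
    using assms unfolding smooth_on_def by metis
  then show thesis using that Ck_on_SucD[OF U(3)] by blast
qed

lemma smooth_on_open_has_derivative:
  assumes "smooth_on S f" "open S" "x \<in> S"
  obtains f' where "(f has_derivative f') (at x)"
proof -
  obtain U g g' where "open U" "x \<in> U" "\<And>y. y \<in> S \<inter> U \<Longrightarrow> g y = f y" "(g has_derivative g') (at x)"
    using smooth_on_local_extension[OF assms(1,3)] by blast
  then have "(f has_derivative g') (at x)"
    using has_derivative_transform_within_open[of g g' x UNIV "S \<inter> U" f] assms by auto
  then show thesis using that by blast
qed

section \<open>Triangular matrices\<close>

lemma exhaust_6: "x = 1 \<or> x = 2 \<or> x = 3 \<or> x = 4 \<or> x = 5 \<or> x = 6" for x :: 6
proof (induct x)
  case (of_int z)
  then have "0 \<le> z \<and> z < 6" by simp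
  then have "z = 0 \<or> z = 1 \<or> z = 2 \<or> z = 3 \<or> z = 4 \<or> z = 5" by arith
  then show ?case by auto
qed

lemma UNIV_6: "(UNIV :: 6 set) = {1, 2, 3, 4, 5, 6}"
  using exhaust_6 by auto

lemma forall_6: "(\<forall>i::6. P i) \<longleftrightarrow> P 1 \<and> P 2 \<and> P 3 \<and> P 4 \<and> P 5 \<and> P 6"
  by (metis exhaust_6)

lemma pos_simps [simp]: "pos 1 = 1" "pos 2 = 2" "pos 3 = 3" "pos 4 = 4" "pos 5 = 5" "pos 6 = 6" "pos 0 = 6"
  by (simp_all add: pos_def)

lemma sum_6: "(\<Sum>i\<in>(UNIV::6 set). f i) = f 1 + f 2 + f 3 + f 4 + f 5 + f 6"
  unfolding UNIV_6 by (simp add: add_ac)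

lemma pos_inject [simp]: "pos i = pos j \<longleftrightarrow> i = j"
  using exhaust_6[of i] exhaust_6[of j] by auto

lemma pos_bounds: "1 \<le> pos i" "pos i \<le> 6"
  using exhaust_6[of i] by auto

lemma pos_neqD: "i \<noteq> j \<Longrightarrow> pos i < pos j \<or> pos j < pos i"
  using pos_inject[of i j] by linarith

lemma pos_induct [case_names less]:
  assumes "\<And>i. (\<And>k. pos k < pos i \<Longrightarrow> P k) \<Longrightarrow> P i" shows "P i"
  using assms by (induction "pos i" arbitrary: i rule: less_induct) blast

lemma bounded_bilinear_matrix_mult:
  "bounded_bilinear ((**) :: real^'n^'m \<Rightarrow> real^'p^'n \<Rightarrow> real^'p^'m)"
proof -
  have "bilinear ((**) :: real^'n^'m \<Rightarrow> real^'p^'n \<Rightarrow> real^'p^'m)"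
    unfolding bilinear_def
    by (auto intro!: linearI simp: vec_eq_iff matrix_matrix_mult_def sum.distrib algebra_simps sum_distrib_left)
  then show ?thesis by (simp add: bilinear_conv_bounded_bilinear)
qed

lemma bounded_linear_transpose: "bounded_linear (transpose :: real^'n^'m \<Rightarrow> real^'m^'n)"
  by (intro linear_conv_bounded_linear[THEN iffD1] linearI) (auto simp: vec_eq_iff transpose_def)

lemmas smooth_on_matrix_mult = smooth_on_bilinear[OF bounded_bilinear_matrix_mult]
lemmas smooth_on_transpose = smooth_on_bounded_linear[OF bounded_linear_transpose]

lemma smooth_on_matrix:
  fixes f :: "'a::euclidean_space \<Rightarrow> real^'n^'m"
  assumes "\<And>i j. smooth_on S (\<lambda>x. f x $ i $ j)" shows "smooth_on S f"
  by (intro smooth_on_vec assms)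

lemma mat_nth: "mat c $ i $ j = (if i = j then c else 0)"
  by (simp add: mat_def)

definition lower_triangular :: "real^6^6 \<Rightarrow> bool" where
  "lower_triangular A \<longleftrightarrow> (\<forall>i j. pos i < pos j \<longrightarrow> A $ i $ j = 0)"

lemma T6_iff: "A \<in> T6 \<longleftrightarrow> lower_triangular A \<and> (\<forall>i. 0 < A $ i $ i)"
  by (auto simp: T6_def lower_triangular_def)

lemma lower_triangularD: "lower_triangular A \<Longrightarrow> pos i < pos j \<Longrightarrow> A $ i $ j = 0"
  by (simp add: lower_triangular_def)

lemma lower_triangular_mat [simp]: "lower_triangular (mat c)"
  by (auto simp: lower_triangular_def mat_nth)

lemma lower_triangular_mult_zero:
  assumes "lower_triangular A" "lower_triangular B" "k \<noteq> i" "k \<noteq> j" "\<not> (pos j < pos k \<and> pos k < pos i)"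
  shows "A $ i $ k * B $ k $ j = 0"
  using assms pos_neqD[of k i] pos_neqD[of k j] lower_triangularD[of A i k] lower_triangularD[of B k j] by auto

lemma lower_triangular_mult:
  assumes "lower_triangular A" "lower_triangular B"
  shows "lower_triangular (A ** B)"
  unfolding lower_triangular_def matrix_matrix_mult_def
proof (auto intro!: sum.neutral)
  fix i j k assume "pos i < pos j" "B $ k $ j \<noteq> 0"
  then show "A $ i $ k = 0" using assms by (metis lower_triangularD not_less_iff_gr_or_eq order_less_trans pos_inject)
qed

lemma lower_triangular_mult_diag:
  assumes "lower_triangular A" "lower_triangular B"
  shows "(A ** B) $ i $ i = A $ i $ i * B $ i $ i"
proof -
  have "(\<Sum>k\<in>UNIV. A $ i $ k * B $ k $ i) = (\<Sum>k\<in>{i}. A $ i $ k * B $ k $ i)"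
    by (rule sum.mono_neutral_right) (use lower_triangular_mult_zero[OF assms] in auto)
  then show ?thesis by (simp add: matrix_matrix_mult_def)
qed

lemma T6_mult: "A \<in> T6 \<Longrightarrow> B \<in> T6 \<Longrightarrow> A ** B \<in> T6"
  by (simp add: T6_iff lower_triangular_mult lower_triangular_mult_diag)

lemma mat_1_T6: "mat 1 \<in> T6"
  by (simp add: T6_iff mat_nth)

text \<open>
  Forward substitution: row \<open>i\<close> of \<open>A ** B = 1\<close> determines row \<open>i\<close> of \<open>B\<close> from the previous ones.
  In particular the diagonal of an invertible lower triangular matrix does not vanish.
\<close>

lemma lower_triangular_right_inverse:
  assumes A: "lower_triangular A" and AB: "A ** B = mat 1"
  shows "lower_triangular B" and "A $ i $ i * B $ i $ i = 1"
proof -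
  have main: "A $ i $ i * B $ i $ i = 1 \<and> (\<forall>j. pos i < pos j \<longrightarrow> B $ i $ j = 0)" for i
  proof (induction i rule: pos_induct)
    case (less i)
    have eq: "A $ i $ i * B $ i $ j = (if i = j then 1 else 0)" if "pos i \<le> pos j" for j
    proof -
      have "A $ i $ k * B $ k $ j = 0" if "k \<noteq> i" for k
        using pos_neqD[OF that] less.IH[of k] lower_triangularD[OF A, of i k] \<open>pos i \<le> pos j\<close> by fastforce
      then have "(\<Sum>k\<in>UNIV. A $ i $ k * B $ k $ j) = (\<Sum>k\<in>{i}. A $ i $ k * B $ k $ j)"
        by (intro sum.mono_neutral_right) auto
      then have "A $ i $ i * B $ i $ j = (A ** B) $ i $ j"
        by (simp add: matrix_matrix_mult_def)
      then show ?thesis by (simp add: AB mat_nth)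
    qed
    from eq[of i] have "A $ i $ i * B $ i $ i = 1" by simp
    moreover from this have "A $ i $ i \<noteq> 0" by auto
    ultimately show ?case using eq by (metis less_imp_le mult_eq_0_iff pos_inject less_irrefl)
  qed
  then show "lower_triangular B" by (simp add: lower_triangular_def)
  show "A $ i $ i * B $ i $ i = 1" using main by blast
qed

lemma T6_kernel:
  assumes A: "A \<in> T6" and x: "A *v x = 0" shows "x = 0"
proof -
  have "x $ i = 0" for i
  proof (induction i rule: pos_induct)
    case (less i)
    have "A $ i $ k * x $ k = 0" if "k \<noteq> i" for k
      using pos_neqD[OF that] less.IH[of k] A by (auto simp: T6_iff lower_triangularD)
    then have "(\<Sum>k\<in>UNIV. A $ i $ k * x $ k) = (\<Sum>k\<in>{i}. A $ i $ k * x $ k)"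
      by (intro sum.mono_neutral_right) auto
    then have "A $ i $ i * x $ i = (A *v x) $ i"
      by (simp add: matrix_vector_mult_def)
    then show ?case using A x by (auto simp: T6_iff) (metis less_irrefl)
  qed
  then show ?thesis by (simp add: vec_eq_iff)
qed

lemma matrix_inv_mult: 
  fixes A :: "real^'n^'n" assumes "invertible A" 
  shows "A ** matrix_inv A = mat 1" "matrix_inv A ** A = mat 1"
  using someI_ex[OF assms[unfolded invertible_def]] unfolding matrix_inv_def by auto

lemma T6_invertible: "A \<in> T6 \<Longrightarrow> invertible A"
  using T6_kernel by (metis invertible_left_inverse matrix_left_invertible_ker)

lemma T6_inverse:
  assumes "A \<in> T6" shows "matrix_inv A \<in> T6"
proof -
  have A: "lower_triangular A" "\<And>i. 0 < A $ i $ i" using assms by (auto simp: T6_iff)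
  note inv = lower_triangular_right_inverse[OF A(1) matrix_inv_mult(1)[OF T6_invertible[OF assms]]]
  have "0 < matrix_inv A $ i $ i" for i
    using inv(2)[of i] A(2)[of i] by (metis zero_less_mult_pos zero_less_one)
  then show ?thesis using inv(1) by (simp add: T6_iff)
qed

section \<open>The Cholesky decomposition\<close>

lemma metricsD:
  assumes "g \<in> metrics"
  shows "transpose g = g" "g $ i $ j = g $ j $ i" "x \<noteq> 0 \<Longrightarrow> 0 < x \<bullet> (g *v x)" "0 < g $ i $ i"
proof -
  show t: "transpose g = g" and p: "x \<noteq> 0 \<Longrightarrow> 0 < x \<bullet> (g *v x)" for x
    using assms by (auto simp: metrics_def sym_matrices_def)
  have "g $ i $ j = transpose g $ i $ j" by (simp add: t)
  then show "g $ i $ j = g $ j $ i" by (simp add: transpose_def)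
  have "0 < axis i 1 \<bullet> (g *v axis i 1)" by (rule p) (simp add: axis_eq_0_iff)
  also have "\<dots> = g $ i $ i"
    by (simp add: inner_axis' matrix_vector_mul_component column_def matrix_vector_mult_basis)
  finally show "0 < g $ i $ i" .
qed

lemma congruence_inner:
  fixes A g :: "real^'n^'n"
  shows "x \<bullet> ((transpose A ** g ** A) *v x) = (A *v x) \<bullet> (g *v (A *v x))"
proof -
  have "x \<bullet> (transpose A *v w) = (A *v x) \<bullet> w" for w
    by (simp add: transpose_matrix_vector inner_commute[of x] dot_lmul_matrix inner_commute[of w])
  then show ?thesis by (simp flip: matrix_vector_mul_assoc)
qed

lemma congruence_metrics:
  assumes "g \<in> metrics" "invertible A" shows "transpose A ** g ** A \<in> metrics"
proof -
  have "transpose (transpose A ** g ** A) = transpose A ** g ** A"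
    using metricsD(1)[OF assms(1)] by (simp add: matrix_transpose_mul matrix_mul_assoc)
  moreover have "0 < x \<bullet> ((transpose A ** g ** A) *v x)" if "x \<noteq> 0" for x
  proof -
    have "A *v x \<noteq> 0" using that assms(2) by (metis invertible_left_inverse matrix_left_invertible_ker)
    then show ?thesis using metricsD(3)[OF assms(1)] by (simp add: congruence_inner)
  qed
  ultimately show ?thesis by (simp add: metrics_def sym_matrices_def)
qed

lemma mat_1_metrics: "mat 1 \<in> metrics"
  by (auto simp: metrics_def sym_matrices_def)

definition pivot_row :: "6 \<Rightarrow> real^6^6 \<Rightarrow> real^6^6" where
  "pivot_row i h = (\<chi> k j. if k = i then h $ i $ j / sqrt (h $ i $ i) else mat 1 $ k $ j)"

text \<open>The Schur complement with respect to the pivot \<open>(i, i)\<close>, completed by the unit vector.\<close>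

definition schur :: "6 \<Rightarrow> real^6^6 \<Rightarrow> real^6^6" where
  "schur i h = (\<chi> k j. if k = i \<and> j = i then 1 else h $ k $ j - h $ i $ k * h $ i $ j / h $ i $ i)"

text \<open>
  One step of elimination. With \<open>w\<close> the pivot row of \<open>h\<close>, the complement subtracts the rank one
  matrix \<open>w\<^sup>T w / h\<^sub>i\<^sub>i\<close>, and the pivot row \<open>w / \<surd>h\<^sub>i\<^sub>i\<close> together with the unit
  vector at \<open>(i, i)\<close> puts it back.
\<close>

lemma pivot_schur:
  assumes h: "h \<in> metrics"
  shows "transpose (pivot_row i h) ** schur i h ** pivot_row i h = h"
proof -
  let ?P = "pivot_row i h" and ?S = "schur i h"
  have hii: "0 < h $ i $ i" by (rule metricsD(4)[OF h])
  have off: "?S $ a $ i = (if a = i then 1 else 0)" "?S $ i $ a = (if a = i then 1 else 0)" for a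
    using hii metricsD(2)[OF h, of a i] by (simp_all add: schur_def)
  have 1: "(?S ** ?P) $ a $ j = (if a = i then ?P $ i $ j else if j = i then 0 else ?S $ a $ j)" for a j
  proof -
    have "(?S ** ?P) $ a $ j = (\<Sum>b\<in>UNIV. (if b = i then ?S $ a $ i * ?P $ i $ j else 0)
        + (if b = j then (if j = i then 0 else ?S $ a $ j) else 0))"
      unfolding matrix_matrix_mult_def vec_lambda_beta
      by (rule sum.cong[OF refl]) (auto simp: pivot_row_def mat_nth)
    also have "\<dots> = ?S $ a $ i * ?P $ i $ j + (if j = i then 0 else ?S $ a $ j)"
      by (simp add: sum.distrib sum.delta)
    finally show ?thesis by (auto simp: off)
  qed
  have "(transpose ?P ** (?S ** ?P)) $ k $ j = h $ k $ j" for k j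
  proof -
    have "(transpose ?P ** (?S ** ?P)) $ k $ j = (\<Sum>a\<in>UNIV. (if a = i then ?P $ i $ k * ?P $ i $ j else 0)
        + (if a = k then (if k = i \<or> j = i then 0 else ?S $ k $ j) else 0))"
      unfolding matrix_matrix_mult_def[of "transpose ?P"] vec_lambda_beta
      by (rule sum.cong[OF refl], simp only: 1 transpose_def vec_lambda_beta)
        (auto simp: pivot_row_def mat_nth)
    also have "\<dots> = ?P $ i $ k * ?P $ i $ j + (if k = i \<or> j = i then 0 else ?S $ k $ j)"
      by (simp add: sum.distrib sum.delta)
    also have "\<dots> = h $ k $ j"
      using hii metricsD(2)[OF h, of k i] by (auto simp: pivot_row_def schur_def)
    finally show ?thesis .
  qed
  then show ?thesis by (simp add: vec_eq_iff matrix_mul_assoc)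
qed

lemma pivot_row_T6:
  assumes "h \<in> metrics" "\<And>k j. pos i < pos k \<Longrightarrow> h $ k $ j = mat 1 $ k $ j"
  shows "pivot_row i h \<in> T6"
proof -
  have "h $ i $ j = 0" if "pos i < pos j" for j
    using assms(2)[OF that, of i] that metricsD(2)[OF assms(1), of i j] by (auto simp: mat_nth split: if_splits)
  then show ?thesis
    using metricsD(4)[OF assms(1)] by (auto simp: T6_iff lower_triangular_def pivot_row_def mat_nth)
qed

lemma schur_metrics:
  assumes h: "h \<in> metrics" and "\<And>k j. pos i < pos k \<Longrightarrow> h $ k $ j = mat 1 $ k $ j"
  shows "schur i h \<in> metrics"
proof -
  let ?P = "pivot_row i h" and ?S = "schur i h"
  have inv: "invertible ?P" by (rule T6_invertible[OF pivot_row_T6[OF assms]])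
  have "?S = transpose (matrix_inv ?P) ** (transpose ?P ** ?S ** ?P) ** matrix_inv ?P"
  proof -
    have "transpose (matrix_inv ?P) ** transpose ?P = mat 1"
      using matrix_inv_mult(1)[OF inv] by (simp flip: matrix_transpose_mul)
    then show ?thesis using matrix_inv_mult(1)[OF inv]
      by (metis matrix_mul_assoc matrix_mul_lid matrix_mul_rid)
  qed
  also have "\<dots> = transpose (matrix_inv ?P) ** h ** matrix_inv ?P" by (simp add: pivot_schur[OF h])
  also have "\<dots> \<in> metrics"
    by (rule congruence_metrics[OF h]) (use inv matrix_inv_mult[OF inv] in \<open>auto simp: invertible_def\<close>)
  finally show ?thesis .
qed

text \<open>
  Symmetric elimination, starting with the last row; after step \<open>m\<close> the remaining factor agrees
  with the identity in all rows below row \<open>m\<close>. All pivots are diagonal entries of metrics, hence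
  positive, so that the factors depend smoothly on the metric.
\<close>

lemma symmetric_elimination:
  assumes "m \<le> 6"
  shows "\<exists>r s. smooth_on metrics r \<and> smooth_on metrics s \<and> (\<forall>g\<in>metrics. r g \<in> T6 \<and> s g \<in> metrics \<and>
    transpose (r g) ** s g ** r g = g \<and> (\<forall>k j. m < pos k \<longrightarrow> s g $ k $ j = mat 1 $ k $ j))"
  using assms
proof (induction m rule: inc_induct)
  case base
  have "\<not> 6 < pos k" for k using pos_bounds[of k] by simp
  then show ?case
    by (intro exI[of _ "\<lambda>g. mat 1"] exI[of _ "\<lambda>g. g"]) (auto intro: smooth_intros mat_1_T6)
next
  case (step m)
  obtain r s where r: "smooth_on metrics r" "smooth_on metrics s" "\<And>g. g \<in> metrics \<Longrightarrow> r g \<in> T6"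
    "\<And>g. g \<in> metrics \<Longrightarrow> s g \<in> metrics" "\<And>g. g \<in> metrics \<Longrightarrow> transpose (r g) ** s g ** r g = g"
    "\<And>g k j. g \<in> metrics \<Longrightarrow> Suc m < pos k \<Longrightarrow> s g $ k $ j = mat 1 $ k $ j"
    using step.IH by auto
  have "\<exists>i. pos i = Suc m"
  proof -
    have "Suc m = 1 \<or> Suc m = 2 \<or> Suc m = 3 \<or> Suc m = 4 \<or> Suc m = 5 \<or> Suc m = 6"
      using step.hyps by arith
    then show ?thesis by (metis pos_simps)
  qed
  then obtain i where i: "pos i = Suc m" by blast
  have rows: "s g $ k $ j = mat 1 $ k $ j" if "g \<in> metrics" "pos i < pos k" for g k j
    using r(6) that i by simp
  have pos_s: "0 < s g $ i $ i" if "g \<in> metrics" for g by (rule metricsD(4)[OF r(4)[OF that]])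
  have nz: "s g $ i $ i \<noteq> 0" if "g \<in> metrics" for g using pos_s[OF that] by simp
  have s1: "smooth_on metrics (\<lambda>g. pivot_row i (s g))"
  proof (rule smooth_on_matrix)
    fix k j
    show "smooth_on metrics (\<lambda>g. pivot_row i (s g) $ k $ j)"
      using pos_s nz r(2)
      by (cases "k = i") (auto simp: pivot_row_def intro!: smooth_on_divide smooth_on_sqrt smooth_intros)
  qed
  have s2: "smooth_on metrics (\<lambda>g. schur i (s g))"
  proof (rule smooth_on_matrix)
    fix k j
    show "smooth_on metrics (\<lambda>g. schur i (s g) $ k $ j)"
      using pos_s nz r(2)
      by (cases "k = i \<and> j = i") (auto simp: schur_def intro!: smooth_on_divide smooth_intros)
  qed
  have T: "pivot_row i (s g) ** r g \<in> T6" if "g \<in> metrics" for g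
    by (rule T6_mult[OF pivot_row_T6 r(3)[OF that]]) (use r(4) rows that in auto)
  have M: "schur i (s g) \<in> metrics" if "g \<in> metrics" for g
    by (rule schur_metrics) (use r(4) rows that in auto)
  have "transpose (pivot_row i (s g) ** r g) ** schur i (s g) ** (pivot_row i (s g) ** r g) = g"
    if "g \<in> metrics" for g
  proof -
    have "transpose (pivot_row i (s g) ** r g) ** schur i (s g) ** (pivot_row i (s g) ** r g)
      = transpose (r g) ** (transpose (pivot_row i (s g)) ** schur i (s g) ** pivot_row i (s g)) ** r g"
      by (simp add: matrix_transpose_mul matrix_mul_assoc)
    then show ?thesis using r(4,5) that by (simp add: pivot_schur)
  qed
  moreover have "schur i (s g) $ k $ j = mat 1 $ k $ j" if "g \<in> metrics" "m < pos k" for g k j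
  proof (cases "k = i")
    case True
    then show ?thesis using pos_s[OF that(1)] by (auto simp: schur_def mat_nth)
  next
    case False
    then have "pos i < pos k" using that i pos_inject[of k i] by linarith
    then have "s g $ i $ k = 0" "s g $ k $ j = mat 1 $ k $ j"
      using rows[OF that(1)] metricsD(2)[OF r(4)[OF that(1)], of i k] False by (auto simp: mat_nth)
    then show ?thesis using False by (simp add: schur_def)
  qed
  ultimately show ?case
    using T M smooth_on_matrix_mult[OF s1 r(1)] s2
    by (intro exI[of _ "\<lambda>g. pivot_row i (s g) ** r g"] exI[of _ "\<lambda>g. schur i (s g)"]) auto
qed

lemma cholesky_exists:
  obtains chol where "smooth_on metrics chol"
    "\<And>g. g \<in> metrics \<Longrightarrow> chol g \<in> T6" "\<And>g. g \<in> metrics \<Longrightarrow> transpose (chol g) ** chol g = g"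
proof -
  obtain r s where r: "smooth_on metrics r"
    "\<forall>g\<in>metrics. r g \<in> T6 \<and> s g \<in> metrics \<and> transpose (r g) ** s g ** r g = g \<and>
      (\<forall>k j. 0 < pos k \<longrightarrow> s g $ k $ j = mat 1 $ k $ j)"
    using symmetric_elimination[of 0] by blast
  have "s g = mat 1" if "g \<in> metrics" for g
    using r(2) that pos_bounds(1) by (simp add: vec_eq_iff Suc_le_eq)
  then have "transpose (r g) ** r g = g" if "g \<in> metrics" for g
    using r(2) that by (metis matrix_mul_rid)
  then show thesis using r that[of r] by blast
qed

text \<open>
  Two Cholesky factors differ by an orthogonal lower triangular matrix with positive diagonal.
  Its transpose is its inverse, hence again lower triangular, so it is diagonal with entries \<open>1\<close>.
\<close>

lemma cholesky_unique:
  assumes A: "A \<in> T6" and B: "B \<in> T6" and eq: "transpose A ** A = transpose B ** B"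
  shows "A = B"
proof -
  let ?B' = "matrix_inv B"
  define R where "R = A ** ?B'"
  note iB = matrix_inv_mult[OF T6_invertible[OF B]]
  have R: "R \<in> T6" unfolding R_def by (intro T6_mult A T6_inverse B)
  have "transpose R ** R = transpose ?B' ** (transpose A ** A) ** ?B'"
    by (simp add: R_def matrix_transpose_mul matrix_mul_assoc)
  also have "\<dots> = transpose (B ** ?B') ** (B ** ?B')"
    by (simp add: eq matrix_transpose_mul matrix_mul_assoc)
  finally have o: "transpose R ** R = mat 1" by (simp add: iB)
  then have o': "R ** transpose R = mat 1" using matrix_left_right_inverse by blast
  have low: "lower_triangular R" using R by (simp add: T6_iff)
  note i = lower_triangular_right_inverse[OF low o']
  have "R $ i $ j = mat 1 $ i $ j" for i j
  proof (cases "i = j")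
    case True
    have "R $ i $ i * R $ i $ i = 1" using i(2)[of i] by (simp add: transpose_def)
    moreover have "0 < R $ i $ i" using R by (simp add: T6_iff)
    ultimately show ?thesis using True by (simp add: mat_nth) (metis less_imp_le power2_eq_square real_sqrt_abs2 abs_of_pos real_sqrt_one)
  next
    case False
    then show ?thesis
      using pos_neqD[OF False] lower_triangularD[OF low, of i j] lower_triangularD[OF i(1), of j i]
      by (auto simp: transpose_def mat_nth)
  qed
  then have "R = mat 1" by (simp add: vec_eq_iff)
  then have "A ** (?B' ** B) = B" by (simp add: R_def matrix_mul_assoc)
  then show ?thesis by (simp add: iB)
qed

section \<open>Groups of triangular matrices as graphs over their leading entries\<close>

definition pos_diag :: "(real^6^6) set" where
  "pos_diag = {x. \<forall>i. 0 < x $ i $ i}"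

lemma pos_diagD: "x \<in> pos_diag \<Longrightarrow> 0 < x $ i $ i"
  by (simp add: pos_diag_def)

lemma T6_subset_pos_diag: "T6 \<subseteq> pos_diag"
  by (auto simp: T6_def pos_diag_def)

lemma open_pos_diag: "open pos_diag"
proof -
  have eq: "pos_diag = (\<Inter>i\<in>UNIV. {x. 0 < x $ i $ i})" by (auto simp: pos_diag_def)
  show ?thesis unfolding eq
    by (intro open_INT finite ballI open_Collect_less continuous_intros)
qed

lemma convex_pos_diag: "convex pos_diag"
proof (rule convexI)
  fix x y :: "real^6^6" and u v :: real
  assume *: "x \<in> pos_diag" "y \<in> pos_diag" "0 \<le> u" "0 \<le> v" "u + v = 1"
  have "0 < u * x $ i $ i + v * y $ i $ i" for i
  proof (cases "u = 0")
    case True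
    then show ?thesis using * by (simp add: pos_diag_def)
  next
    case False
    then have "0 < u * x $ i $ i" using * by (simp add: pos_diag_def)
    moreover have "0 \<le> v * y $ i $ i" using * by (simp add: pos_diag_def less_imp_le)
    ultimately show ?thesis by simp
  qed
  then show "u *\<^sub>R x + v *\<^sub>R y \<in> pos_diag" by (simp add: pos_diag_def)
qed

text \<open>
  The rank enumerates the lower triangular positions row by row, each row starting at the diagonal.
  The entry of a product of lower triangular matrices at a position involves the factors only at
  positions of at most that rank.
\<close>

definition row_rank :: "6 \<Rightarrow> 6 \<Rightarrow> nat" where
  "row_rank i j = 7 * pos i - pos j"

lemma row_rank_inj: "pos j \<le> pos i \<Longrightarrow> pos l \<le> pos k \<Longrightarrow> row_rank i j = row_rank k l \<Longrightarrow> i = k \<and> j = l"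
proof -
  assume le: "pos j \<le> pos i" "pos l \<le> pos k" and eq: "row_rank i j = row_rank k l"
  note b = pos_bounds[of i] pos_bounds[of j] pos_bounds[of k] pos_bounds[of l]
  have eq': "7 * pos i + pos l = 7 * pos k + pos j"
    using eq b unfolding row_rank_def by linarith
  have "\<not> pos i < pos k" "\<not> pos k < pos i" using eq' b by linarith+
  then have "pos i = pos k" by linarith
  moreover from this have "pos j = pos l" using eq' by linarith
  ultimately show ?thesis by simp
qed

lemma row_rank_less: "row_rank i j < 100"
  using pos_bounds[of i] by (simp add: row_rank_def)

lemma row_rank_same_row: "row_rank i l < row_rank i j \<Longrightarrow> pos j < pos l"
  by (simp add: row_rank_def)

lemma row_rank_same_column: "row_rank k j < row_rank i j \<Longrightarrow> pos k < pos i"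
  by (simp add: row_rank_def)

lemma row_rank_row_less: "pos k < pos i \<Longrightarrow> row_rank k l < row_rank i j"
  using pos_bounds[of j] pos_bounds[of l] by (simp add: row_rank_def)

lemma row_rank_column_less: "pos j < pos k \<Longrightarrow> row_rank i k < row_rank i j"
  using pos_bounds[of i] pos_bounds[of j] pos_bounds[of k] by (simp add: row_rank_def)

definition upd :: "real^6^6 \<Rightarrow> 6 \<Rightarrow> 6 \<Rightarrow> real \<Rightarrow> real^6^6" where
  "upd M i j v = (\<chi> k l. if k = i \<and> l = j then v else M $ k $ l)"

lemma upd_nth: "upd M i j v $ k $ l = (if k = i \<and> l = j then v else M $ k $ l)"
  by (simp add: upd_def)

text \<open>
  Changing the entry at \<open>(i, j)\<close> in both factors affects only row \<open>i\<close> and column \<open>j\<close> of the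
  product; the last summand is present only on the diagonal, where both changes meet.
\<close>

lemma upd_mult:
  "(upd s i j x ** upd a i j y) $ k $ l = (s ** a) $ k $ l
    + (if k = i then (x - s $ i $ j) * a $ j $ l else 0)
    + (if l = j then s $ k $ i * (y - a $ i $ j) else 0)
    + (if i = j \<and> k = i \<and> l = i then (x - s $ i $ j) * (y - a $ i $ j) else 0)"
proof -
  define p where "p = (if k = i then x - s $ i $ j else 0)"
  define q where "q = (if l = j then y - a $ i $ j else 0)"
  have "(upd s i j x ** upd a i j y) $ k $ l =
      (\<Sum>n\<in>UNIV. (s $ k $ n + (if n = j then p else 0)) * (a $ n $ l + (if n = i then q else 0)))"
    unfolding matrix_matrix_mult_def vec_lambda_beta
    by (intro sum.cong[OF refl] arg_cong2[of _ _ _ _ "(*)"]) (auto simp: upd_nth p_def q_def)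
  also have "\<dots> = (\<Sum>n\<in>UNIV. s $ k $ n * a $ n $ l + (if n = j then p * a $ n $ l else 0)
      + (if n = i then s $ k $ n * q else 0) + (if n = i then (if i = j then p * q else 0) else 0))"
    by (rule sum.cong[OF refl]) (simp add: algebra_simps)
  also have "\<dots> = (s ** a) $ k $ l + p * a $ j $ l + s $ k $ i * q + (if i = j then p * q else 0)"
    by (simp add: sum.distrib sum.delta matrix_matrix_mult_def)
  finally show ?thesis by (simp add: p_def q_def)
qed

lemma smooth_on_upd:
  assumes "smooth_on S f" "smooth_on S v"
  shows "smooth_on S (\<lambda>x. upd (f x) i j (v x))"
proof (rule smooth_on_matrix)
  fix k l
  show "smooth_on S (\<lambda>x. upd (f x) i j (v x) $ k $ l)"
    using assms by (cases "k = i \<and> l = j") (auto simp: upd_nth intro!: smooth_intros)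
qed

lemma upd_T6:
  assumes "M \<in> T6" "pos j \<le> pos i" "i = j \<Longrightarrow> 0 < v"
  shows "upd M i j v \<in> T6"
  using assms by (auto simp: T6_def upd_nth)

text \<open>
  A matrix is reconstructed by \<open>A\<close> from its leading entries, those at lower triangular positions
  outside \<open>F\<close>; an entry at a position in \<open>F\<close> may depend only on leading entries of smaller rank.
\<close>

locale graph_family =
  fixes F :: "(6 \<times> 6) set" and A :: "real^6^6 \<Rightarrow> real^6^6"
  assumes F_lower: "(i, j) \<in> F \<Longrightarrow> pos j \<le> pos i"
    and A_upper: "pos i < pos j \<Longrightarrow> A x $ i $ j = 0"
    and A_leading: "pos j \<le> pos i \<Longrightarrow> (i, j) \<notin> F \<Longrightarrow> A x $ i $ j = x $ i $ j"
    and A_diag: "x \<in> pos_diag \<Longrightarrow> 0 < A x $ i $ i"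
    and A_dep: "(i, j) \<in> F \<Longrightarrow>
      (\<And>k l. pos l \<le> pos k \<Longrightarrow> (k, l) \<notin> F \<Longrightarrow> row_rank k l < row_rank i j \<Longrightarrow> x $ k $ l = y $ k $ l) \<Longrightarrow>
      A x $ i $ j = A y $ i $ j"
    and A_smooth: "smooth_on pos_diag A"
    and A_one: "A (mat 1) = mat 1"
begin

definition graph :: "(real^6^6) set" where
  "graph = {x \<in> pos_diag. A x = x}"

lemma graph_subset_T6: "graph \<subseteq> T6"
proof
  fix x assume x: "x \<in> graph"
  then have "x $ i $ j = 0" if "pos i < pos j" for i j
    using A_upper[OF that, of x] by (simp add: graph_def)
  then show "x \<in> T6" using x by (auto simp: graph_def T6_def pos_diag_def)
qed

text \<open>
  \<open>A\<close> is idempotent because it copies the leading entries, and these determine its values.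
\<close>

lemma A_in_graph: "x \<in> pos_diag \<Longrightarrow> A x \<in> graph"
proof -
  assume x: "x \<in> pos_diag"
  have "A (A x) $ i $ j = A x $ i $ j" for i j
  proof (cases "(i, j) \<in> F")
    case True
    then show ?thesis by (rule A_dep) (use A_leading in auto)
  next
    case False
    then show ?thesis
      using A_leading[of j i] A_upper[of i j] by (cases "pos j \<le> pos i") auto
  qed
  then show ?thesis using A_diag[OF x] by (simp add: graph_def pos_diag_def vec_eq_iff)
qed

lemma graph_eq_image: "graph = A ` pos_diag"
proof
  show "graph \<subseteq> A ` pos_diag" unfolding graph_def by (force intro: image_eqI[of _ A])
  show "A ` pos_diag \<subseteq> graph" using A_in_graph by blast
qed

lemma mat_1_graph: "mat 1 \<in> graph"
  using A_one by (simp add: graph_def pos_diag_def mat_nth)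

lemma connected_graph: "connected graph"
  unfolding graph_eq_image
  by (intro connected_continuous_image smooth_on_continuous_on A_smooth convex_connected convex_pos_diag)

lemma graphI:
  assumes "a \<in> T6" "\<And>i j. (i, j) \<in> F \<Longrightarrow> a $ i $ j = A a $ i $ j"
  shows "a \<in> graph"
proof -
  have "A a $ i $ j = a $ i $ j" for i j
  proof (cases "pos i < pos j")
    case True
    then show ?thesis using assms(1) A_upper by (simp add: T6_def)
  next
    case False
    then show ?thesis using assms(2) A_leading by (cases "(i, j) \<in> F") auto
  qed
  then show ?thesis using assms(1) T6_subset_pos_diag by (auto simp: graph_def vec_eq_iff)
qed

lemma Sigma_free_eq: "Sigma_free F = {s \<in> T6. \<forall>i j. pos j \<le> pos i \<and> (i, j) \<notin> F \<longrightarrow> s $ i $ j = mat 1 $ i $ j}"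
proof (intro equalityI subsetI)
  fix s assume s: "s \<in> Sigma_free F"
  have d: "0 < s $ i $ i" for i
  proof -
    have "if (i, i) \<in> F then 0 < s $ i $ i else s $ i $ i = 1" using s unfolding Sigma_free_def by blast
    then show ?thesis by (simp split: if_splits)
  qed
  have "s $ i $ j = mat 1 $ i $ j" if "pos j \<le> pos i" "(i, j) \<notin> F" for i j
    using s that pos_neqD[of i j] by (cases "i = j") (auto simp: Sigma_free_def mat_nth)
  then show "s \<in> {s \<in> T6. \<forall>i j. pos j \<le> pos i \<and> (i, j) \<notin> F \<longrightarrow> s $ i $ j = mat 1 $ i $ j}"
    using s d by (auto simp: Sigma_free_def T6_def)
next
  fix s assume "s \<in> {s \<in> T6. \<forall>i j. pos j \<le> pos i \<and> (i, j) \<notin> F \<longrightarrow> s $ i $ j = mat 1 $ i $ j}"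
  then show "s \<in> Sigma_free F" by (auto simp: Sigma_free_def T6_def mat_nth)
qed

text \<open>
  The state of the recursion after all positions of rank below \<open>m\<close> have been treated:
  there the product is already correct, and elsewhere both factors are still trivial.
\<close>

definition partial_factors :: "nat \<Rightarrow> real^6^6 \<Rightarrow> real^6^6 \<Rightarrow> real^6^6 \<Rightarrow> bool" where
  "partial_factors m t s a \<longleftrightarrow> s \<in> T6 \<and> a \<in> T6 \<and> (\<forall>i j. pos j \<le> pos i \<longrightarrow>
    (if row_rank i j < m
     then (s ** a) $ i $ j = t $ i $ j \<and> (if (i, j) \<in> F then a $ i $ j = A a $ i $ j else s $ i $ j = mat 1 $ i $ j)
     else s $ i $ j = mat 1 $ i $ j \<and> a $ i $ j = mat 1 $ i $ j))"

text \<open>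
  Positions treated before are not disturbed: an earlier position in row \<open>i\<close> lies to the right of
  column \<open>j\<close>, an earlier one in column \<open>j\<close> lies above row \<open>i\<close>, and in both cases the changed
  entry is multiplied by an entry above the diagonal.
\<close>

lemma partial_factors_step:
  assumes p: "partial_factors m t s a" and ij: "pos j \<le> pos i" "row_rank i j = m"
    and pos: "i = j \<Longrightarrow> 0 < x \<and> 0 < y"
    and prod: "(if i = j then x * y else (s ** a) $ i $ j + x * a $ j $ j + s $ i $ i * y) = t $ i $ j"
    and val: "if (i, j) \<in> F then y = A a $ i $ j else x = mat 1 $ i $ j"
  shows "partial_factors (Suc m) t (upd s i j x) (upd a i j y)"
proof -
  have T: "s \<in> T6" "a \<in> T6" and low: "lower_triangular s" "lower_triangular a"
    using p by (auto simp: partial_factors_def T6_iff)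
  have old: "s $ i $ j = mat 1 $ i $ j" "a $ i $ j = mat 1 $ i $ j"
    using p ij unfolding partial_factors_def by (metis less_irrefl)+
  have A_eq: "A (upd a i j y) $ k $ l = A a $ k $ l" if "(k, l) \<in> F" "row_rank k l \<le> m" for k l
  proof (rule A_dep[OF that(1)])
    fix k' l' assume "row_rank k' l' < row_rank k l"
    then show "upd a i j y $ k' $ l' = a $ k' $ l'" using that(2) ij by (auto simp: upd_nth)
  qed
  have prod_ij: "(upd s i j x ** upd a i j y) $ i $ j = t $ i $ j"
  proof (cases "i = j")
    case True
    have "(s ** a) $ i $ i = 1" using lower_triangular_mult_diag[OF low] old True by (simp add: mat_nth)
    then show ?thesis using True prod old unfolding upd_mult by (simp add: mat_nth algebra_simps)
  next
    case False
    then show ?thesis using prod old unfolding upd_mult by (simp add: mat_nth)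
  qed
  have prod_kl: "(upd s i j x ** upd a i j y) $ k $ l = (s ** a) $ k $ l" if kl: "row_rank k l < m" for k l
  proof -
    have "a $ j $ l = 0" if "k = i"
      using row_rank_same_row[of i l j] kl ij that lower_triangularD[OF low(2)] by blast
    then have t1: "(if k = i then (x - s $ i $ j) * a $ j $ l else 0) = 0" by (cases "k = i") simp_all
    have "s $ k $ i = 0" if "l = j"
      using row_rank_same_column[of k j i] kl ij that lower_triangularD[OF low(1)] by blast
    then have t2: "(if l = j then s $ k $ i * (y - a $ i $ j) else 0) = 0" by (cases "l = j") simp_all
    have t3: "\<not> (i = j \<and> k = i \<and> l = i)" using kl ij by auto
    show ?thesis unfolding upd_mult t1 t2 using t3 by (simp only: if_False add_0_right)
  qed
  have "if row_rank k l < Suc m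
     then (upd s i j x ** upd a i j y) $ k $ l = t $ k $ l \<and>
       (if (k, l) \<in> F then upd a i j y $ k $ l = A (upd a i j y) $ k $ l else upd s i j x $ k $ l = mat 1 $ k $ l)
     else upd s i j x $ k $ l = mat 1 $ k $ l \<and> upd a i j y $ k $ l = mat 1 $ k $ l"
    if kl: "pos l \<le> pos k" for k l
  proof (cases "k = i \<and> l = j")
    case True
    then show ?thesis using prod_ij val A_eq[of i j] ij by (auto simp: upd_nth)
  next
    case False
    then have ne: "row_rank k l \<noteq> m" using row_rank_inj[OF ij(1) kl] ij(2) by auto
    have st: "if row_rank k l < m
     then (s ** a) $ k $ l = t $ k $ l \<and> (if (k, l) \<in> F then a $ k $ l = A a $ k $ l else s $ k $ l = mat 1 $ k $ l)
     else s $ k $ l = mat 1 $ k $ l \<and> a $ k $ l = mat 1 $ k $ l"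
      using p kl unfolding partial_factors_def by blast
    have u: "upd s i j x $ k $ l = s $ k $ l" "upd a i j y $ k $ l = a $ k $ l"
      using False by (auto simp: upd_nth)
    show ?thesis
    proof (cases "row_rank k l < m")
      case True
      then show ?thesis using st prod_kl[OF True] A_eq[of k l] unfolding u by simp
    next
      case False
      then show ?thesis using st ne unfolding u by simp
    qed
  qed
  then show ?thesis
    unfolding partial_factors_def using upd_T6[OF T(1) ij(1)] upd_T6[OF T(2) ij(1)] pos by blast
qed

text \<open>
  At a new position in \<open>F\<close> the entry of \<open>a\<close> is prescribed by the earlier leading entries and the
  equation is solved for the entry of \<open>s\<close>; outside \<open>F\<close> the roles are exchanged. On the diagonal the
  equation is a product, elsewhere it is linear in the unknown.
\<close>

lemma partial_factors_smooth:
  "\<exists>s a. smooth_on pos_diag s \<and> smooth_on pos_diag a \<and> (\<forall>t\<in>pos_diag. partial_factors m t (s t) (a t))"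
proof (induction m)
  case 0
  have "partial_factors 0 t (mat 1) (mat 1)" for t
    by (simp add: partial_factors_def mat_1_T6)
  then show ?case
    by (intro exI[of _ "\<lambda>t. mat 1"]) (auto intro: smooth_on_const)
next
  case (Suc m)
  then obtain s a where sm: "smooth_on pos_diag s" "smooth_on pos_diag a"
    and p: "\<And>t. t \<in> pos_diag \<Longrightarrow> partial_factors m t (s t) (a t)" by blast
  have sT: "s t \<in> T6" and aT: "a t \<in> T6" if "t \<in> pos_diag" for t
    using p[OF that] by (auto simp: partial_factors_def)
  have aD: "a t \<in> pos_diag" if "t \<in> pos_diag" for t using aT[OF that] T6_subset_pos_diag by blast
  show ?case
  proof (cases "\<exists>i j. pos j \<le> pos i \<and> row_rank i j = m")
    case False
    then have "row_rank i j < Suc m \<longleftrightarrow> row_rank i j < m" if "pos j \<le> pos i" for i j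
      using that by (metis less_Suc_eq)
    then have "partial_factors (Suc m) t (s t) (a t)" if "t \<in> pos_diag" for t
      using p[OF that] unfolding partial_factors_def by (metis (no_types, lifting))
    then show ?thesis using sm by blast
  next
    case True
    then obtain i j where ij: "pos j \<le> pos i" "row_rank i j = m" by blast
    have s_pos: "0 < s t $ k $ k" and a_pos: "0 < a t $ k $ k" if "t \<in> pos_diag" for t k
      using sT[OF that] aT[OF that] by (auto simp: T6_def)
    have nz: "s t $ k $ k \<noteq> 0" "a t $ k $ k \<noteq> 0" if "t \<in> pos_diag" for t k
      using s_pos[OF that, of k] a_pos[OF that, of k] by simp_all
    have Aa: "smooth_on pos_diag (\<lambda>t. A (a t) $ i $ j)"
      by (intro smooth_on_component smooth_on_compose[OF A_smooth sm(2)]) (use aD in auto)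
    have sa: "smooth_on pos_diag (\<lambda>t. (s t ** a t) $ i $ j)"
      by (intro smooth_on_component smooth_on_matrix_mult sm)
    have step: ?thesis if xy: "smooth_on pos_diag x" "smooth_on pos_diag y"
      "\<And>t. t \<in> pos_diag \<Longrightarrow> i = j \<Longrightarrow> 0 < x t \<and> 0 < y t"
      "\<And>t. t \<in> pos_diag \<Longrightarrow>
        (if i = j then x t * y t else (s t ** a t) $ i $ j + x t * a t $ j $ j + s t $ i $ i * y t) = t $ i $ j"
      "\<And>t. t \<in> pos_diag \<Longrightarrow> if (i, j) \<in> F then y t = A (a t) $ i $ j else x t = mat 1 $ i $ j"
      for x y
      using partial_factors_step[OF p ij xy(3,4,5)] smooth_on_upd[OF sm(1) xy(1)] smooth_on_upd[OF sm(2) xy(2)]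
      by (intro exI[of _ "\<lambda>t. upd (s t) i j (x t)"] exI[of _ "\<lambda>t. upd (a t) i j (y t)"]) blast
    show ?thesis
    proof (cases "(i, j) \<in> F")
      case F: True
      show ?thesis
      proof (cases "i = j")
        case True
        have Ap: "0 < A (a t) $ j $ j" if "t \<in> pos_diag" for t using A_diag[OF aD[OF that]] .
        then have nzA: "A (a t) $ i $ j \<noteq> 0" if "t \<in> pos_diag" for t using True that by fastforce
        show ?thesis
        proof (rule step[of "\<lambda>t. t $ i $ j / A (a t) $ i $ j" "\<lambda>t. A (a t) $ i $ j"])
          show "smooth_on pos_diag (\<lambda>t. t $ i $ j / A (a t) $ i $ j)"
            using nzA by (intro smooth_on_divide smooth_intros Aa)
        qed (use F True Ap Aa in \<open>auto simp: pos_diag_def less_imp_neq[THEN not_sym]\<close>)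
      next
        case False
        show ?thesis
        proof (rule step[of "\<lambda>t. (t $ i $ j - (s t ** a t) $ i $ j - s t $ i $ i * A (a t) $ i $ j) / a t $ j $ j"
              "\<lambda>t. A (a t) $ i $ j"])
          show "smooth_on pos_diag
            (\<lambda>t. (t $ i $ j - (s t ** a t) $ i $ j - s t $ i $ i * A (a t) $ i $ j) / a t $ j $ j)"
            using nz by (intro smooth_on_divide smooth_intros Aa sa sm)
        qed (use F False nz Aa in auto)
      qed
    next
      case F: False
      show ?thesis
      proof (cases "i = j")
        case True
        show ?thesis
          by (rule step[of "\<lambda>t. 1" "\<lambda>t. t $ i $ j"])
            (use F True in \<open>auto simp: mat_nth pos_diag_def intro!: smooth_intros\<close>)
      next
        case False
        show ?thesis
        proof (rule step[of "\<lambda>t. 0" "\<lambda>t. (t $ i $ j - (s t ** a t) $ i $ j) / s t $ i $ i"])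
          show "smooth_on pos_diag (\<lambda>t. (t $ i $ j - (s t ** a t) $ i $ j) / s t $ i $ i)"
            using nz by (intro smooth_on_divide smooth_intros sa sm)
        qed (use F False nz in \<open>auto simp: mat_nth intro: smooth_intros\<close>)
      qed
    qed
  qed
qed

lemma factorization_exists:
  obtains s a where "smooth_on pos_diag s" "smooth_on pos_diag a"
    "\<And>t. t \<in> pos_diag \<Longrightarrow> s t \<in> Sigma_free F" "\<And>t. t \<in> pos_diag \<Longrightarrow> a t \<in> graph"
    "\<And>t. t \<in> T6 \<Longrightarrow> s t ** a t = t"
proof -
  obtain s a where sm: "smooth_on pos_diag s" "smooth_on pos_diag a"
    and p: "\<And>t. t \<in> pos_diag \<Longrightarrow> partial_factors 100 t (s t) (a t)"
    using partial_factors_smooth[of 100] by blast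
  have st: "(s t ** a t) $ i $ j = t $ i $ j \<and>
      (if (i, j) \<in> F then a t $ i $ j = A (a t) $ i $ j else s t $ i $ j = mat 1 $ i $ j)"
    if "t \<in> pos_diag" "pos j \<le> pos i" for t i j
    using p[OF that(1)] that(2) row_rank_less[of i j] unfolding partial_factors_def by meson
  have T: "s t \<in> T6" "a t \<in> T6" if "t \<in> pos_diag" for t
    using p[OF that] by (auto simp: partial_factors_def)
  have "s t \<in> Sigma_free F" if "t \<in> pos_diag" for t
    using st[OF that] T[OF that] unfolding Sigma_free_eq by (auto split: if_splits)
  moreover have "a t \<in> graph" if "t \<in> pos_diag" for t
    using st[OF that] by (intro graphI T that) (use F_lower in \<open>auto split: if_splits\<close>)
  moreover have "s t ** a t = t" if t: "t \<in> T6" for t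
  proof -
    have D: "t \<in> pos_diag" using t T6_subset_pos_diag by blast
    have "(s t ** a t) $ i $ j = t $ i $ j" for i j
    proof (cases "pos i < pos j")
      case True
      then show ?thesis using t T6_mult[OF T[OF D]] by (simp add: T6_def)
    next
      case False
      then show ?thesis using st[OF D] by simp
    qed
    then show ?thesis by (simp add: vec_eq_iff)
  qed
  ultimately show thesis using that sm by blast
qed

text \<open>
  The entries of the factors are compared in the order of their rank, by the same dichotomy that
  determines them in the construction.
\<close>

lemma factorization_unique:
  assumes s: "s \<in> Sigma_free F" "s' \<in> Sigma_free F" and a: "a \<in> graph" "a' \<in> graph"
    and eq: "s ** a = s' ** a'"
  shows "s = s' \<and> a = a'"
proof -
  have sT: "s \<in> T6" "s' \<in> T6" and aT: "a \<in> T6" "a' \<in> T6"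
    using s a graph_subset_T6 by (auto simp: Sigma_free_eq)
  have low: "lower_triangular s" "lower_triangular s'" "lower_triangular a" "lower_triangular a'"
    using sT aT by (auto simp: T6_iff)
  have dpos: "0 < s $ i $ i" "0 < s' $ i $ i" "0 < a $ i $ i" "0 < a' $ i $ i" for i
    using sT aT by (auto simp: T6_iff)
  have main: "s $ i $ j = s' $ i $ j \<and> a $ i $ j = a' $ i $ j" if "pos j \<le> pos i" for i j
    using that
  proof (induction "row_rank i j" arbitrary: i j rule: less_induct)
    case less
    have IH: "s $ k $ l = s' $ k $ l" "a $ k $ l = a' $ k $ l" if "row_rank k l < row_rank i j" "pos l \<le> pos k" for k l
      using less.hyps[OF that] by auto
    have F: "a $ i $ j = a' $ i $ j" if "(i, j) \<in> F"
    proof -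
      have "A a $ i $ j = A a' $ i $ j" by (rule A_dep[OF that]) (use IH in auto)
      then show ?thesis using a by (simp add: graph_def)
    qed
    have nF: "s $ i $ j = s' $ i $ j" if "(i, j) \<notin> F"
      using s that less.prems by (simp add: Sigma_free_eq)
    show ?case
    proof (cases "i = j")
      case True
      have "s $ i $ i * a $ i $ i = s' $ i $ i * a' $ i $ i"
        using eq lower_triangular_mult_diag[of s a] lower_triangular_mult_diag[of s' a'] low by metis
      then show ?thesis using F nF dpos(1,3)[of i] True by (cases "(i, j) \<in> F") auto
    next
      case False
      then have ji: "pos j < pos i" using less.prems pos_neqD[of i j] by auto
      have split: "(u ** v) $ i $ j = (\<Sum>k\<in>UNIV - {i, j}. u $ i $ k * v $ k $ j) + u $ i $ i * v $ i $ j + u $ i $ j * v $ j $ j"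
        for u v :: "real^6^6"
        unfolding matrix_matrix_mult_def vec_lambda_beta using False
        by (simp add: sum.remove[of UNIV i] sum.remove[of "UNIV - {i}" j] Diff_insert2[of UNIV i "{j}"])
      have "s $ i $ k * a $ k $ j = s' $ i $ k * a' $ k $ j" if k: "k \<in> UNIV - {i, j}" for k
      proof (cases "pos j < pos k \<and> pos k < pos i")
        case True
        then have "row_rank i k < row_rank i j" "row_rank k j < row_rank i j"
          using row_rank_column_less row_rank_row_less by blast+
        then show ?thesis using IH True by simp
      next
        case False
        have "k \<noteq> i" "k \<noteq> j" using k by auto
        note lower_triangular_mult_zero[OF low(1,3) this False] lower_triangular_mult_zero[OF low(2,4) this False]
        then show ?thesis by metis
      qed
      then have rest: "(\<Sum>k\<in>UNIV - {i, j}. s $ i $ k * a $ k $ j) = (\<Sum>k\<in>UNIV - {i, j}. s' $ i $ k * a' $ k $ j)"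
        by (rule sum.cong[OF refl])
      have "s $ i $ i = s' $ i $ i"
        using IH(1)[of i i] row_rank_column_less[OF ji, of i] by simp
      moreover have "a $ j $ j = a' $ j $ j"
        using IH(2)[of j j] row_rank_row_less[OF ji, of j j] by simp
      moreover have "(s ** a) $ i $ j = (s' ** a') $ i $ j" by (simp add: eq)
      ultimately have "s $ i $ i * a $ i $ j + s $ i $ j * a $ j $ j = s $ i $ i * a' $ i $ j + s' $ i $ j * a $ j $ j"
        unfolding split rest by simp
      then show ?thesis using F nF dpos(1)[of i] dpos(3)[of j] by (cases "(i, j) \<in> F") auto
    qed
  qed
  have "s $ i $ j = s' $ i $ j \<and> a $ i $ j = a' $ i $ j" for i j
    using main[of j i] low by (cases "pos j \<le> pos i") (auto simp: lower_triangular_def)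
  then show ?thesis by (simp add: vec_eq_iff)
qed

end

section \<open>The identity component of the automorphism group\<close>

lemma mat_1_Aut: "mat 1 \<in> Aut h"
  unfolding Aut_def invertible_def by (auto intro!: exI[of _ "mat 1"])

lemma Aut_mult: "a \<in> Aut h \<Longrightarrow> b \<in> Aut h \<Longrightarrow> a ** b \<in> Aut h"
  by (auto simp: Aut_def invertible_mult simp flip: matrix_vector_mul_assoc)

lemma Aut_inverse:
  assumes a: "a \<in> Aut h" shows "matrix_inv a \<in> Aut h"
proof -
  have inv: "invertible a" using a by (simp add: Aut_def)
  note i = matrix_inv_mult[OF inv]
  have "matrix_inv a *v h x y = h (matrix_inv a *v x) (matrix_inv a *v y)" for x y
  proof -
    have "a *v h (matrix_inv a *v x) (matrix_inv a *v y) = h (a *v (matrix_inv a *v x)) (a *v (matrix_inv a *v y))"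
      using a by (simp add: Aut_def)
    also have "\<dots> = h x y" by (simp add: matrix_vector_mul_assoc i)
    finally have "matrix_inv a *v h x y = matrix_inv a *v (a *v h (matrix_inv a *v x) (matrix_inv a *v y))"
      by simp
    then show ?thesis by (simp add: matrix_vector_mul_assoc i)
  qed
  moreover have "invertible (matrix_inv a)" using i by (auto simp: invertible_def)
  ultimately show ?thesis by (simp add: Aut_def)
qed

definition strict_upper :: "real^6^6 \<Rightarrow> real^6^6" where
  "strict_upper M = (\<chi> i j. if pos i < pos j then M $ i $ j else 0)"

definition lower_part :: "real^6^6 \<Rightarrow> real^6^6" where
  "lower_part M = (\<chi> i j. if pos i < pos j then 0 else M $ i $ j)"

lemma upper_plus_lower: "strict_upper M + lower_part M = M"
  by (simp add: vec_eq_iff strict_upper_def lower_part_def)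

lemma bounded_linear_strict_upper: "bounded_linear strict_upper"
  by (intro linear_conv_bounded_linear[THEN iffD1] linearI) (auto simp: vec_eq_iff strict_upper_def)

lemma bounded_linear_lower_part: "bounded_linear lower_part"
  by (intro linear_conv_bounded_linear[THEN iffD1] linearI) (auto simp: vec_eq_iff lower_part_def)

lemma upper_lower_decompose:
  assumes "lower_triangular L"
  shows "strict_upper (strict_upper M + L) = strict_upper M" "lower_part (strict_upper M + L) = L"
  using assms by (auto simp: vec_eq_iff strict_upper_def lower_part_def lower_triangular_def)

lemma lower_triangular_lower_part: "lower_triangular (lower_part M)"
  by (simp add: lower_triangular_def lower_part_def)

lemma lower_part_id: "lower_triangular L \<Longrightarrow> lower_part L = L" "lower_triangular L \<Longrightarrow> strict_upper L = 0"
  by (auto simp: vec_eq_iff strict_upper_def lower_part_def lower_triangular_def)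

lemma lower_part_pos_diag: "M \<in> pos_diag \<Longrightarrow> lower_part M \<in> T6"
  by (simp add: pos_diag_def T6_def lower_part_def)

lemma has_derivative_vec:
  fixes f :: "'a::euclidean_space \<Rightarrow> 'b::euclidean_space^'n"
  assumes "\<And>i. ((\<lambda>x. f x $ i) has_derivative (\<lambda>x. f' x $ i)) (at a within S)"
  shows "(f has_derivative f') (at a within S)"
  unfolding has_derivative_componentwise_within[of f]
  using assms by (auto simp: Basis_vec_def inner_axis intro: has_derivative_inner_left)

locale automorphism_graph = graph_family F A
  for F :: "(6 \<times> 6) set" and A :: "real^6^6 \<Rightarrow> real^6^6" +
  fixes b :: "real^6 \<Rightarrow> real^6 \<Rightarrow> real^6"
  assumes bilinear_b: "bilinear b"
    and A_Aut: "x \<in> pos_diag \<Longrightarrow> A x \<in> Aut b"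
    and rigid: "X \<in> Der b \<Longrightarrow> (\<And>i j. pos j \<le> pos i \<Longrightarrow> (i, j) \<notin> F \<Longrightarrow> X $ i $ j = 0) \<Longrightarrow> X = 0"
begin

lemma graph_subset_Aut: "graph \<subseteq> Aut b"
  using A_Aut unfolding graph_eq_image by blast

text \<open>
  The failure of \<open>M\<close> to be an automorphism, recorded on pairs of basis vectors so that it takes values
  in a Euclidean space. Its derivative at the identity is the failure to be a derivation.
\<close>

definition defect :: "real^6^6 \<Rightarrow> ((real^6)^6)^6" where
  "defect M = (\<chi> i j. M *v b (axis i 1) (axis j 1) - b (M *v axis i 1) (M *v axis j 1))"

definition defect_derivative :: "real^6^6 \<Rightarrow> ((real^6)^6)^6" where
  "defect_derivative X = (\<chi> i j. X *v b (axis i 1) (axis j 1)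
    - (b (axis i 1) (X *v axis j 1) + b (X *v axis i 1) (axis j 1)))"

lemma defect_Aut: "M \<in> Aut b \<Longrightarrow> defect M = 0"
  by (simp add: defect_def Aut_def vec_eq_iff)

lemma bounded_bilinear_b: "bounded_bilinear b"
  using bilinear_b by (simp add: bilinear_conv_bounded_bilinear)

lemma bounded_linear_apply: "bounded_linear (\<lambda>M :: real^6^6. M *v x)"
  by (intro linear_conv_bounded_linear[THEN iffD1] linearI)
    (auto simp: matrix_vector_mult_add_rdistrib scaleR_matrix_vector_assoc)

lemma defect_derivative_Der:
  assumes "defect_derivative X = 0" shows "X \<in> Der b"
proof -
  note lin = bilinear_ladd[OF bilinear_b] bilinear_radd[OF bilinear_b] bilinear_lmul[OF bilinear_b]
    bilinear_rmul[OF bilinear_b] matrix_vector_right_distrib matrix_vector_mult_scaleR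
  have "(\<lambda>x y. X *v b x y) = (\<lambda>x y. b (X *v x) y + b x (X *v y))"
  proof (rule bilinear_eq_stdbasis)
    show "bilinear (\<lambda>x y. X *v b x y)"
      unfolding bilinear_def by (intro conjI allI linearI) (simp_all add: lin)
    show "bilinear (\<lambda>x y. b (X *v x) y + b x (X *v y))"
      unfolding bilinear_def by (intro conjI allI linearI) (simp_all add: lin algebra_simps)
    fix i j :: "real^6" assume "i \<in> Basis" "j \<in> Basis"
    then obtain k l where "i = axis k 1" "j = axis l 1" by (auto simp: Basis_vec_def)
    moreover have "defect_derivative X $ k $ l = 0" using assms by simp
    ultimately show "X *v b i j = b (X *v i) j + b i (X *v j)"
      by (simp add: defect_derivative_def algebra_simps)
  qed
  then show ?thesis by (simp add: Der_def fun_eq_iff)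
qed

lemma defect_has_derivative:
  "((\<lambda>Y. defect ((mat 1 + strict_upper Y) ** (mat 1 + lower_part Y))) has_derivative defect_derivative) (at 0)"
proof -
  define M where "M Y = (mat 1 + strict_upper Y) ** (mat 1 + lower_part Y)" for Y
  have U: "((\<lambda>Y. mat 1 + strict_upper Y) has_derivative strict_upper) (at 0)"
    using has_derivative_add[OF has_derivative_const bounded_linear_imp_has_derivative[OF bounded_linear_strict_upper]]
    by simp
  have L: "((\<lambda>Y. mat 1 + lower_part Y) has_derivative lower_part) (at 0)"
    using has_derivative_add[OF has_derivative_const bounded_linear_imp_has_derivative[OF bounded_linear_lower_part]]
    by simp
  have zero: "strict_upper 0 = 0" "lower_part 0 = 0"
    by (simp_all add: strict_upper_def lower_part_def vec_eq_iff)
  have M0: "M 0 = mat 1" by (simp add: M_def zero)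
  have dM: "(M has_derivative (\<lambda>H. H)) (at 0)"
    unfolding M_def
    by (rule has_derivative_eq_rhs[OF bounded_bilinear.FDERIV[OF bounded_bilinear_matrix_mult U L]])
      (simp add: zero fun_eq_iff upper_plus_lower add.commute[of "lower_part _"])
  have dMx: "((\<lambda>Y. M Y *v x) has_derivative (\<lambda>H. H *v x)) (at 0)" for x
    using bounded_linear.has_derivative[OF bounded_linear_apply dM] .
  have "((\<lambda>Y. defect (M Y)) has_derivative defect_derivative) (at 0)"
  proof (rule has_derivative_vec, rule has_derivative_vec)
    fix i j
    have "((\<lambda>Y. M Y *v b (axis i 1) (axis j 1) - b (M Y *v axis i 1) (M Y *v axis j 1)) has_derivative
      (\<lambda>H. H *v b (axis i 1) (axis j 1) - (b (M 0 *v axis i 1) (H *v axis j 1) + b (H *v axis i 1) (M 0 *v axis j 1)))) (at 0)"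
      by (intro has_derivative_diff dMx bounded_bilinear.FDERIV[OF bounded_bilinear_b])
    then show "((\<lambda>Y. defect (M Y) $ i $ j) has_derivative (\<lambda>H. defect_derivative H $ i $ j)) (at 0)"
      by (simp add: defect_def defect_derivative_def M0)
  qed
  then show ?thesis by (simp add: M_def)
qed

text \<open>
  No automorphism near the identity is transversal to the graph. To first order the condition of
  being an automorphism is that of being a derivation, and a derivation without leading entries
  vanishes; a linear map that is injective on a subspace dominates the error of the linearisation.
\<close>

lemma no_transversal_automorphism:
  obtains e where "0 < e" "\<And>Y. norm Y < e \<Longrightarrow> (\<And>i j. pos j \<le> pos i \<Longrightarrow> (i, j) \<notin> F \<Longrightarrow> Y $ i $ j = 0) \<Longrightarrow>
    (mat 1 + strict_upper Y) ** (mat 1 + lower_part Y) \<in> Aut b \<Longrightarrow> Y = 0"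
proof -
  define C where "C = {Y :: real^6^6. \<forall>i j. pos j \<le> pos i \<longrightarrow> (i, j) \<notin> F \<longrightarrow> Y $ i $ j = 0}"
  note d = defect_has_derivative
  have bl: "bounded_linear defect_derivative" by (rule has_derivative_bounded_linear[OF d])
  have sC: "subspace C" by (auto simp: subspace_def C_def)
  obtain c where c: "0 < c" "\<And>Y. Y \<in> C \<Longrightarrow> c * norm Y \<le> norm (defect_derivative Y)"
    using injective_imp_isometric[OF closed_subspace[OF sC] sC bl] defect_derivative_Der rigid
    unfolding C_def by (auto simp: mult.commute)
  have zero: "strict_upper 0 = 0" "lower_part 0 = 0"
    by (simp_all add: strict_upper_def lower_part_def vec_eq_iff)
  obtain e where e: "0 < e" "\<And>Y. norm Y < e \<Longrightarrow>
    norm (defect ((mat 1 + strict_upper Y) ** (mat 1 + lower_part Y)) - defect (mat 1) - defect_derivative Y)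
      \<le> c / 2 * norm Y"
    using d c(1) unfolding has_derivative_at_alt by (auto simp: zero dest!: spec[of _ "c / 2"])
  have "Y = 0" if "norm Y < e" "\<And>i j. pos j \<le> pos i \<Longrightarrow> (i, j) \<notin> F \<Longrightarrow> Y $ i $ j = 0"
    "(mat 1 + strict_upper Y) ** (mat 1 + lower_part Y) \<in> Aut b" for Y
  proof -
    have "norm (defect_derivative Y) \<le> c / 2 * norm Y"
      using e(2)[OF that(1)] defect_Aut[OF that(3)] defect_Aut[OF mat_1_Aut] by simp
    moreover have "c * norm Y \<le> norm (defect_derivative Y)" using c(2) that(2) by (simp add: C_def)
    ultimately have "c * norm Y \<le> c / 2 * norm Y" by linarith
    then have "norm Y \<le> 0" using c(1) by (simp add: field_simps)
    then show ?thesis by simp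
  qed
  then show thesis using that e(1) by blast
qed

text \<open>
  Near \<open>p\<close> every matrix is a product of a unipotent upper and a lower triangular one, by the open
  mapping property of the map \<open>f\<close> below, whose derivative at \<open>p\<close> has a right inverse. Splitting the
  lower triangular factor as \<open>s a\<close> and dividing an automorphism by \<open>a\<close> leaves an automorphism close to
  the identity and transversal to the graph.
\<close>

lemma graph_locally_Aut:
  assumes p: "p \<in> graph"
  obtains N where "open N" "p \<in> N" "Aut b \<inter> N \<subseteq> graph"
proof -
  obtain s a where sa: "smooth_on pos_diag s" "smooth_on pos_diag a"
    "\<And>t. t \<in> pos_diag \<Longrightarrow> s t \<in> Sigma_free F" "\<And>t. t \<in> pos_diag \<Longrightarrow> a t \<in> graph"
    "\<And>t. t \<in> T6 \<Longrightarrow> s t ** a t = t"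
    using factorization_exists by blast
  obtain e where e: "0 < e" "\<And>Y. norm Y < e \<Longrightarrow>
    (\<And>i j. pos j \<le> pos i \<Longrightarrow> (i, j) \<notin> F \<Longrightarrow> Y $ i $ j = 0) \<Longrightarrow>
    (mat 1 + strict_upper Y) ** (mat 1 + lower_part Y) \<in> Aut b \<Longrightarrow> Y = 0"
    using no_transversal_automorphism by blast
  have pT: "p \<in> T6" and pD: "p \<in> pos_diag" using p graph_subset_T6 T6_subset_pos_diag by blast+
  have plow: "lower_triangular p" using pT by (simp add: T6_iff)
  have one: "mat 1 \<in> Sigma_free F" by (auto simp: Sigma_free_eq mat_1_T6)
  have sp: "s p = mat 1"
    using factorization_unique[OF sa(3)[OF pD] one sa(4)[OF pD] p] sa(5)[OF pT] by simp
  define f where "f Y = (mat 1 + strict_upper Y) ** lower_part Y" for Y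
  define w where "w Y = strict_upper Y + (s (lower_part Y) - mat 1)" for Y
  define t where "t = pos_diag \<inter> (\<lambda>Y. norm (w Y)) -` {..<e}"
  note cU = bounded_linear.continuous_on[OF bounded_linear_strict_upper continuous_on_id]
  note cL = bounded_linear.continuous_on[OF bounded_linear_lower_part continuous_on_id]
  have lower_D: "lower_part Y \<in> pos_diag" if "Y \<in> pos_diag" for Y
    using lower_part_pos_diag[OF that] T6_subset_pos_diag by blast
  have "continuous_on pos_diag (\<lambda>Y. norm (w Y))"
    unfolding w_def
    by (intro continuous_intros cU continuous_on_compose2[OF smooth_on_continuous_on[OF sa(1)] cL])
      (use lower_D in auto)
  then have "open t" unfolding t_def
    by (rule continuous_open_preimage[OF _ open_pos_diag open_lessThan])
  have "p \<in> t" using pD e(1) by (simp add: t_def w_def lower_part_id[OF plow] sp)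
  define f' where "f' H = lower_part H + strict_upper H ** p" for H
  \<comment> \<open>A right inverse of \<open>f'\<close>: split \<open>M p\<^sup>-\<^sup>1\<close> and multiply the lower part back by \<open>p\<close>.\<close>
  define g' where "g' M = strict_upper (M ** matrix_inv p) + lower_part (M ** matrix_inv p) ** p" for M
  have "(f has_derivative f') (at p)"
  proof -
    have U: "((\<lambda>Y. mat 1 + strict_upper Y) has_derivative strict_upper) (at p)"
      using has_derivative_add[OF has_derivative_const bounded_linear_imp_has_derivative[OF bounded_linear_strict_upper]]
      by simp
    show ?thesis unfolding f_def f'_def
      by (rule has_derivative_eq_rhs[OF bounded_bilinear.FDERIV[OF bounded_bilinear_matrix_mult U
            bounded_linear_imp_has_derivative[OF bounded_linear_lower_part]]])
        (simp add: fun_eq_iff lower_part_id[OF plow])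
  qed
  moreover have "bounded_linear g'"
    unfolding g'_def
    by (intro bounded_linear_add bounded_linear_compose[OF bounded_linear_strict_upper]
        bounded_linear_compose[OF bounded_linear_lower_part]
        bounded_linear_compose[OF bounded_bilinear.bounded_linear_left[OF bounded_bilinear_matrix_mult]]
        bounded_bilinear.bounded_linear_left[OF bounded_bilinear_matrix_mult])
  moreover have "f' \<circ> g' = id"
  proof
    fix M
    have low: "lower_triangular (lower_part (M ** matrix_inv p) ** p)"
      by (intro lower_triangular_mult lower_triangular_lower_part plow)
    have "f' (g' M) = (strict_upper (M ** matrix_inv p) + lower_part (M ** matrix_inv p)) ** p"
      unfolding f'_def g'_def upper_lower_decompose[OF low]
      by (simp add: bounded_bilinear.add_left[OF bounded_bilinear_matrix_mult] add.commute)
    also have "\<dots> = M ** (matrix_inv p ** p)" by (simp add: upper_plus_lower matrix_mul_assoc)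
    finally show "(f' \<circ> g') M = id M" by (simp add: matrix_inv_mult T6_invertible[OF pT])
  qed
  moreover have "continuous_on UNIV f"
    unfolding f_def
    by (intro bounded_bilinear.continuous_on[OF bounded_bilinear_matrix_mult] continuous_intros cU cL)
  ultimately have "f p \<in> interior (f ` t)"
    using \<open>open t\<close> \<open>p \<in> t\<close> by (intro sussmann_open_mapping[of UNIV f p f' g' t]) (auto simp: interior_open)
  moreover have "f p = p" by (simp add: f_def lower_part_id[OF plow])
  ultimately have "p \<in> interior (f ` t)" by simp
  moreover have "Aut b \<inter> interior (f ` t) \<subseteq> graph"
  proof
    fix x assume x: "x \<in> Aut b \<inter> interior (f ` t)"
    then obtain Y where Y: "Y \<in> t" "x = f Y" using interior_subset by blast
    let ?L = "lower_part Y"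
    have YD: "Y \<in> pos_diag" and small: "norm (w Y) < e" using Y by (auto simp: t_def)
    have LT: "?L \<in> T6" and LD: "?L \<in> pos_diag" using lower_part_pos_diag[OF YD] lower_D[OF YD] by blast+
    have S: "s ?L \<in> Sigma_free F" "a ?L \<in> graph" "s ?L ** a ?L = ?L" using sa LT LD by blast+
    have lowS: "lower_triangular (s ?L - mat 1)"
      using S(1) by (auto simp: Sigma_free_def lower_triangular_def mat_nth)
    note w = upper_lower_decompose[OF lowS, of Y, folded w_def]
    have "a ?L \<in> Aut b" using S(2) graph_subset_Aut by blast
    then have "x ** matrix_inv (a ?L) \<in> Aut b" using x Aut_mult Aut_inverse by blast
    also have "x ** matrix_inv (a ?L) = (mat 1 + strict_upper Y) ** s ?L ** (a ?L ** matrix_inv (a ?L))"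
      by (simp add: Y(2) f_def S(3) matrix_mul_assoc[symmetric])
         (metis S(3) matrix_mul_assoc)
    also have "\<dots> = (mat 1 + strict_upper (w Y)) ** (mat 1 + lower_part (w Y))"
      using matrix_inv_mult(1)[OF T6_invertible] S(2) graph_subset_T6 by (auto simp: w)
    finally have aut: "(mat 1 + strict_upper (w Y)) ** (mat 1 + lower_part (w Y)) \<in> Aut b" .
    have "w Y = 0"
    proof (rule e(2)[OF small _ aut])
      fix i j assume "pos j \<le> pos i" "(i, j) \<notin> F"
      then show "w Y $ i $ j = 0"
        using S(1) by (simp add: w_def strict_upper_def Sigma_free_eq)
    qed
    then have "strict_upper Y = 0" "s ?L - mat 1 = 0"
      using w by (metis linear_0 bounded_linear.linear bounded_linear_strict_upper bounded_linear_lower_part)+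
    then have "x = a ?L" using S(3) by (simp add: Y(2) f_def)
    then show "x \<in> graph" using S(2) by simp
  qed
  ultimately show thesis using that[of "interior (f ` t)"] by blast
qed

lemma openin_graph: "openin (top_of_set (Aut b)) graph"
proof (subst openin_subopen, intro ballI)
  fix p assume p: "p \<in> graph"
  then obtain N where "open N" "p \<in> N" "Aut b \<inter> N \<subseteq> graph" using graph_locally_Aut by blast
  then show "\<exists>T. openin (top_of_set (Aut b)) T \<and> p \<in> T \<and> T \<subseteq> graph"
    using p graph_subset_Aut by (intro exI[of _ "Aut b \<inter> N"]) auto
qed

text \<open>
  Passing to a limit could only violate the positivity of the diagonal, and the diagonal of an
  invertible lower triangular matrix does not vanish.
\<close>

lemma closedin_graph: "closedin (top_of_set (Aut b)) graph"
proof -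
  have "x \<in> graph" if x: "x \<in> Aut b" "x \<in> closure graph" for x
  proof -
    obtain u where u: "\<And>n. u n \<in> graph" "u \<longlonglongrightarrow> x"
      using x(2) unfolding closure_sequential by blast
    have comp: "(\<lambda>n. u n $ i $ j) \<longlonglongrightarrow> x $ i $ j" for i j by (intro tendsto_vec_nth u(2))
    have uT: "u n \<in> T6" for n using u(1) graph_subset_T6 by blast
    have low: "lower_triangular x" unfolding lower_triangular_def
    proof (intro allI impI)
      fix i j assume "pos i < pos j"
      then have "(\<lambda>n. u n $ i $ j) = (\<lambda>n. 0)" using uT by (auto simp: T6_def)
      then show "x $ i $ j = 0" using comp[of i j] by (simp add: LIMSEQ_const_iff)
    qed
    have "0 \<le> x $ i $ i" for i
      by (rule LIMSEQ_le_const[OF comp]) (use uT in \<open>auto simp: T6_def less_imp_le\<close>)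
    moreover have "x $ i $ i \<noteq> 0" for i
      using lower_triangular_right_inverse(2)[OF low matrix_inv_mult(1), of i] x(1) by (auto simp: Aut_def)
    ultimately have D: "x \<in> pos_diag" by (simp add: pos_diag_def less_le)
    have "(\<lambda>n. A (u n)) \<longlonglongrightarrow> A x"
      by (rule continuous_on_tendsto_compose[OF smooth_on_continuous_on[OF A_smooth] u(2) D])
        (use u(1) in \<open>auto simp: graph_def\<close>)
    moreover have "A (u n) = u n" for n using u(1)[of n] by (simp add: graph_def)
    ultimately have "u \<longlonglongrightarrow> A x" by simp
    then have "A x = x" by (rule LIMSEQ_unique[OF _ u(2)])
    then show ?thesis using D by (simp add: graph_def)
  qed
  then have "graph = Aut b \<inter> closure graph" using graph_subset_Aut closure_subset by blast
  then show ?thesis unfolding closedin_closed by blast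
qed

lemma identity_component: "connected_component_set (Aut b) (mat 1) = graph"
proof
  show "graph \<subseteq> connected_component_set (Aut b) (mat 1)"
    by (rule connected_component_maximal[OF mat_1_graph connected_graph graph_subset_Aut])
  let ?C = "connected_component_set (Aut b) (mat 1)"
  have sub: "?C \<subseteq> Aut b" by (rule connected_component_subset)
  have "openin (top_of_set ?C) (?C \<inter> graph)"
    using openin_graph sub unfolding openin_open by blast
  moreover have "closedin (top_of_set ?C) (?C \<inter> graph)"
    using closedin_graph sub unfolding closedin_closed by blast
  moreover have "mat 1 \<in> ?C \<inter> graph"
    using mat_1_graph mat_1_Aut by simp
  ultimately have "?C \<inter> graph = ?C"
    using connected_connected_component connected_clopen by blast
  then show "?C \<subseteq> graph" by blast
qed

text \<open>
  Right translation by an automorphism permutes the connected components of the automorphism group.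
\<close>

lemma translate_graph:
  assumes c: "c \<in> Aut b" and a: "a \<in> graph" and ac: "a ** c \<in> graph"
  shows "(\<lambda>x. x ** c) ` graph \<subseteq> graph"
proof -
  have "continuous_on graph (\<lambda>x. x ** c)"
    using bounded_linear.continuous_on[OF bounded_bilinear.bounded_linear_left[OF bounded_bilinear_matrix_mult] continuous_on_id] .
  then have "connected ((\<lambda>x. x ** c) ` graph)" by (rule connected_continuous_image[OF _ connected_graph])
  moreover have "(\<lambda>x. x ** c) ` graph \<subseteq> Aut b" using Aut_mult[OF _ c] graph_subset_Aut by blast
  moreover have "a ** c \<in> (\<lambda>x. x ** c) ` graph" using a by blast
  ultimately have "(\<lambda>x. x ** c) ` graph \<subseteq> connected_component_set (Aut b) (a ** c)"
    by (intro connected_component_maximal)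
  also have "\<dots> = connected_component_set (Aut b) (mat 1)"
    by (rule connected_component_eq) (use ac identity_component in simp)
  finally show ?thesis using identity_component by simp
qed

lemma graph_mult: "a \<in> graph \<Longrightarrow> c \<in> graph \<Longrightarrow> a ** c \<in> graph"
  using translate_graph[OF _ mat_1_graph, of c] graph_subset_Aut by auto

lemma graph_inverse:
  assumes "c \<in> graph" shows "matrix_inv c \<in> graph"
proof -
  have "c ** matrix_inv c = mat 1"
    using assms graph_subset_T6 T6_invertible matrix_inv_mult(1) by blast
  then have "(\<lambda>x. x ** matrix_inv c) ` graph \<subseteq> graph"
    using assms graph_subset_Aut mat_1_graph by (intro translate_graph[of _ c] Aut_inverse) auto
  then show ?thesis using mat_1_graph by force
qed

end

section \<open>Orbit spaces of groups with a global cross-section\<close>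

lemma vector_derivative_in_subspace:
  fixes \<gamma> :: "real \<Rightarrow> 'a::euclidean_space"
  assumes d: "(\<gamma> has_vector_derivative v) (at 0)" and V: "subspace V"
    and ev: "\<forall>\<^sub>F t in at 0. \<gamma> t - \<gamma> 0 \<in> V"
  shows "v \<in> V"
proof -
  let ?q = "\<lambda>h. (1 / h) *\<^sub>R (\<gamma> h - \<gamma> 0)"
  have "((\<lambda>h. norm (\<gamma> (0 + h) - \<gamma> 0 - h *\<^sub>R v) / norm h) \<longlongrightarrow> 0) (at 0)"
    using d unfolding has_vector_derivative_def has_derivative_at by blast
  moreover have "\<forall>\<^sub>F h in at 0. norm (\<gamma> (0 + h) - \<gamma> 0 - h *\<^sub>R v) / norm h = norm (?q h - v)"
    unfolding eventually_at_filter
  proof (intro always_eventually allI impI)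
    fix h :: real assume h: "h \<noteq> 0"
    then have "?q h - v = (1 / h) *\<^sub>R (\<gamma> (0 + h) - \<gamma> 0 - h *\<^sub>R v)" by (simp add: scaleR_diff_right)
    then show "norm (\<gamma> (0 + h) - \<gamma> 0 - h *\<^sub>R v) / norm h = norm (?q h - v)" by simp
  qed
  ultimately have "((\<lambda>h. norm (?q h - v)) \<longlongrightarrow> 0) (at 0)"
    by (rule Lim_transform_eventually)
  then have "(?q \<longlongrightarrow> v) (at 0)"
    using tendsto_norm_zero_iff Lim_null by blast
  moreover have "\<forall>\<^sub>F h in at 0. ?q h \<in> V"
    by (rule eventually_mono[OF ev]) (simp add: subspace_mul[OF V])
  ultimately show ?thesis
    using Lim_in_closed_set[OF closed_subspace[OF V]] by (metis trivial_limit_at)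
qed

lemma eventually_in_open:
  assumes "isCont f x" "open U" "f x \<in> U"
  shows "\<forall>\<^sub>F y in at x. f y \<in> U"
  using assms unfolding isCont_def by (rule topological_tendstoD)

lemma has_derivative_imp_vector_derivative:
  assumes "(f has_derivative f') (at x)" shows "(f has_vector_derivative f' 1) (at x)"
  unfolding has_vector_derivative_def
proof (rule has_derivative_eq_rhs[OF assms], rule ext)
  fix h show "f' h = h *\<^sub>R f' 1"
    using linear_scale[OF has_derivative_linear[OF assms], of h 1] by simp
qed

text \<open>
  In a slice chart the inverse used by the atlas, which is chosen on the slice only, agrees with the
  smooth inverse of the ambient chart.
\<close>

lemma slice_chartE:
  assumes "slice_chart V S U \<psi>"
  obtains W \<psi>' where "open U" "open W" "\<And>x. x \<in> U \<Longrightarrow> \<psi> x \<in> W" "\<And>x. x \<in> U \<Longrightarrow> \<psi>' (\<psi> x) = x"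
    "\<And>y. y \<in> W \<Longrightarrow> \<psi>' y \<in> U" "\<And>y. y \<in> W \<Longrightarrow> \<psi> (\<psi>' y) = y" "smooth_on U \<psi>" "smooth_on W \<psi>'"
    "\<psi> ` (S \<inter> U) = V \<inter> W" "\<And>x. x \<in> S \<Longrightarrow> x \<in> U \<Longrightarrow> inv_into (S \<inter> U) \<psi> (\<psi> x) = x"
proof -
  obtain W \<psi>' where *: "open U" "open W" "homeomorphism U W \<psi> \<psi>'" "smooth_on U \<psi>" "smooth_on W \<psi>'"
    "\<psi> ` (S \<inter> U) = V \<inter> W"
    using assms unfolding slice_chart_def by blast
  have h: "\<And>x. x \<in> U \<Longrightarrow> \<psi> x \<in> W" "\<And>x. x \<in> U \<Longrightarrow> \<psi>' (\<psi> x) = x"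
    "\<And>y. y \<in> W \<Longrightarrow> \<psi>' y \<in> U" "\<And>y. y \<in> W \<Longrightarrow> \<psi> (\<psi>' y) = y"
    using *(3) by (auto simp: homeomorphism_def)
  have "inj_on \<psi> (S \<inter> U)" using h(2) by (metis IntE inj_onI)
  then have "inv_into (S \<inter> U) \<psi> (\<psi> x) = x" if "x \<in> S" "x \<in> U" for x
    using that by (simp add: inv_into_f_f)
  from that[OF *(1,2) h *(4,5,6) this] show thesis .
qed

lemma tangent_space_mono: "S \<subseteq> T \<Longrightarrow> tangent_space S p \<subseteq> tangent_space T p"
  unfolding tangent_space_def by blast

text \<open>
  \<open>T6\<close> is open in the space of lower triangular matrices.
\<close>

lemma tangent_space_T6: "tangent_space T6 (mat 1) = {X. lower_triangular X}"
proof
  have sub: "subspace {X. lower_triangular X}"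
    by (auto simp: subspace_def lower_triangular_def)
  show "tangent_space T6 (mat 1) \<subseteq> {X. lower_triangular X}"
  proof
    fix v assume "v \<in> tangent_space T6 (mat 1)"
    then obtain \<gamma> e where g: "0 < (e::real)" "\<gamma> ` {-e<..<e} \<subseteq> T6" "(\<gamma> has_vector_derivative v) (at 0)"
      unfolding tangent_space_def by blast
    have low: "lower_triangular (\<gamma> t)" if "t \<in> {-e<..<e}" for t
    proof -
      have "\<gamma> t \<in> T6" using g(2) that by blast
      then show ?thesis by (simp add: T6_iff)
    qed
    have "\<forall>\<^sub>F t in at 0. t \<in> {-e<..<e}"
      unfolding eventually_at by (rule exI[of _ e]) (use g(1) in \<open>auto simp: dist_real_def abs_less_iff\<close>)
    then have "\<forall>\<^sub>F t in at 0. \<gamma> t - \<gamma> 0 \<in> {X. lower_triangular X}"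
      by (rule eventually_mono) (use low low[of 0] g(1) subspace_diff[OF sub] in auto)
    then show "v \<in> {X. lower_triangular X}"
      by (rule vector_derivative_in_subspace[OF g(3) sub])
  qed
  show "{X. lower_triangular X} \<subseteq> tangent_space T6 (mat 1)"
  proof
    fix X assume X: "X \<in> {X. lower_triangular X}"
    define \<gamma> where "\<gamma> t = mat 1 + t *\<^sub>R X" for t :: real
    have "open (\<gamma> -` pos_diag)"
      unfolding \<gamma>_def by (intro open_vimage open_pos_diag continuous_intros)
    moreover have "0 \<in> \<gamma> -` pos_diag" by (simp add: \<gamma>_def pos_diag_def mat_nth)
    ultimately obtain e where e: "0 < e" "ball 0 e \<subseteq> \<gamma> -` pos_diag"
      using open_contains_ball by blast
    have "lower_triangular (\<gamma> t)" for t
      using X by (auto simp: \<gamma>_def lower_triangular_def mat_nth)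
    then have "\<gamma> ` {-e<..<e} \<subseteq> T6"
      using e(2) by (auto simp: T6_iff pos_diag_def ball_def dist_real_def subset_iff abs_less_iff)
    moreover have "smooth_on {-e<..<e} \<gamma>"
      unfolding \<gamma>_def by (intro smooth_intros smooth_on_bilinear[OF bounded_bilinear_scaleR])
    moreover have "(\<gamma> has_vector_derivative X) (at 0)"
      unfolding \<gamma>_def by (auto intro!: derivative_eq_intros)
    moreover have "\<gamma> 0 = mat 1" by (simp add: \<gamma>_def)
    ultimately show "X \<in> tangent_space T6 (mat 1)"
      unfolding tangent_space_def using e(1) by blast
  qed
qed

lemma second_countable_euclidean: "second_countable (euclidean :: 'a::second_countable_topology topology)"
proof -
  obtain B :: "'a set set" where B: "countable B" "topological_basis B"
    using ex_countable_basis by blast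
  show ?thesis unfolding second_countable_def
  proof (intro exI conjI ballI allI impI)
    show "countable B" by (rule B(1))
    fix U and x :: 'a assume "openin euclidean U \<and> x \<in> U"
    then show "\<exists>V\<in>B. x \<in> V \<and> V \<subseteq> U" using topological_basisE[OF B(2)] by (metis open_openin)
  qed (use B topological_basis_open in auto)
qed

definition cholesky :: "real^6^6 \<Rightarrow> real^6^6" where
  "cholesky = (SOME c. smooth_on metrics c \<and> (\<forall>g\<in>metrics. c g \<in> T6 \<and> transpose (c g) ** c g = g))"

lemma cholesky:
  shows smooth_on_cholesky: "smooth_on metrics cholesky"
    and cholesky_T6: "g \<in> metrics \<Longrightarrow> cholesky g \<in> T6"
    and cholesky_gram: "g \<in> metrics \<Longrightarrow> transpose (cholesky g) ** cholesky g = g"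
proof -
  have "\<exists>c. smooth_on metrics c \<and> (\<forall>g\<in>metrics. c g \<in> T6 \<and> transpose (c g) ** c g = g)"
    using cholesky_exists by metis
  from someI_ex[OF this, folded cholesky_def]
  show "smooth_on metrics cholesky" "g \<in> metrics \<Longrightarrow> cholesky g \<in> T6"
    "g \<in> metrics \<Longrightarrow> transpose (cholesky g) ** cholesky g = g" by auto
qed

lemma gram_metrics: "A \<in> T6 \<Longrightarrow> transpose A ** A \<in> metrics"
  using congruence_metrics[OF mat_1_metrics T6_invertible] by simp

lemma cholesky_gram_eq: "A \<in> T6 \<Longrightarrow> cholesky (transpose A ** A) = A"
  using cholesky_unique cholesky gram_metrics by blast

text \<open>
  A group of lower triangular matrices for which \<open>\<Sigma>(F)\<close> is a smooth global cross-section of the cosets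
  \<open>t G\<close>: \<open>s\<close> and \<open>a\<close> are the factors, defined on a neighbourhood of \<open>T6\<close>.
\<close>

locale cross_section =
  fixes F :: "(6 \<times> 6) set" and G :: "(real^6^6) set" and s a :: "real^6^6 \<Rightarrow> real^6^6"
  assumes F_lower: "(i, j) \<in> F \<Longrightarrow> pos j \<le> pos i"
    and G_T6: "G \<subseteq> T6" and G_one: "mat 1 \<in> G"
    and G_mult: "x \<in> G \<Longrightarrow> y \<in> G \<Longrightarrow> x ** y \<in> G" and G_inverse: "x \<in> G \<Longrightarrow> matrix_inv x \<in> G"
    and s_smooth: "smooth_on pos_diag s" and a_smooth: "smooth_on pos_diag a"
    and s_Sigma: "t \<in> T6 \<Longrightarrow> s t \<in> Sigma_free F" and a_G: "t \<in> T6 \<Longrightarrow> a t \<in> G"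
    and s_a: "t \<in> T6 \<Longrightarrow> s t ** a t = t"
    and unique: "x \<in> Sigma_free F \<Longrightarrow> x' \<in> Sigma_free F \<Longrightarrow> y \<in> G \<Longrightarrow> y' \<in> G \<Longrightarrow> x ** y = x' ** y' \<Longrightarrow>
      x = x' \<and> y = y'"
begin

definition V :: "(real^6^6) set" where
  "V = {M. \<forall>i j. (i, j) \<notin> F \<longrightarrow> M $ i $ j = 0}"

abbreviation "\<Sigma> \<equiv> Sigma_free F"

lemma subspace_V: "subspace V"
  by (auto simp: subspace_def V_def)

lemma Sigma_iff: "x \<in> \<Sigma> \<longleftrightarrow> x \<in> pos_diag \<and> x - mat 1 \<in> V"
proof
  assume x: "x \<in> \<Sigma>"
  have *: "if (i, i) \<in> F then 0 < x $ i $ i else x $ i $ i = 1" for i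
    using x unfolding Sigma_free_def by blast
  have "0 < x $ i $ i" for i using *[of i] by (simp split: if_splits)
  moreover have "(x - mat 1) $ i $ j = 0" if "(i, j) \<notin> F" for i j
    using x that *[of i] pos_neqD[of i j] by (cases "i = j") (auto simp: Sigma_free_def mat_nth)
  ultimately show "x \<in> pos_diag \<and> x - mat 1 \<in> V" by (simp add: pos_diag_def V_def)
next
  assume x: "x \<in> pos_diag \<and> x - mat 1 \<in> V"
  then have *: "x $ i $ j = mat 1 $ i $ j" if "(i, j) \<notin> F" for i j
    using that by (auto simp: V_def)
  have "x $ i $ j = 0" if "pos i < pos j \<or> pos j < pos i \<and> (i, j) \<notin> F" for i j
  proof -
    have "(i, j) \<notin> F" "i \<noteq> j" using that F_lower[of i j] by auto
    then show ?thesis using * by (simp add: mat_nth)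
  qed
  moreover have "if (i, i) \<in> F then 0 < x $ i $ i else x $ i $ i = 1" for i
    using x *[of i i] by (simp add: mat_nth pos_diag_def)
  ultimately show "x \<in> \<Sigma>" unfolding Sigma_free_def by blast
qed

lemma Sigma_T6: "\<Sigma> \<subseteq> T6"
proof
  fix x assume x: "x \<in> \<Sigma>"
  then show "x \<in> T6" using Sigma_iff[of x] by (auto simp: T6_def Sigma_free_def pos_diag_def)
qed

lemma Sigma_one: "mat 1 \<in> \<Sigma>"
  by (auto simp: Sigma_free_def mat_nth)

text \<open>
  Uniqueness of the factorization makes \<open>s\<close> invariant under right multiplication.
\<close>

lemma s_mult: "t \<in> T6 \<Longrightarrow> y \<in> G \<Longrightarrow> s (t ** y) = s t"
proof -
  assume t: "t \<in> T6" and y: "y \<in> G"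
  have ty: "t ** y \<in> T6" using t y G_T6 T6_mult by blast
  have "s (t ** y) ** a (t ** y) = s t ** (a t ** y)"
    using s_a[OF ty] s_a[OF t] by (simp add: matrix_mul_assoc)
  then show ?thesis using unique s_Sigma[OF ty] s_Sigma[OF t] a_G[OF ty] G_mult[OF a_G[OF t] y] by blast
qed

lemma s_Sigma_mult: "x \<in> \<Sigma> \<Longrightarrow> y \<in> G \<Longrightarrow> s (x ** y) = x"
proof -
  assume x: "x \<in> \<Sigma>" and y: "y \<in> G"
  have xy: "x ** y \<in> T6" using x y G_T6 Sigma_T6 T6_mult by blast
  show ?thesis using unique[OF s_Sigma[OF xy] x a_G[OF xy] y s_a[OF xy]] by blast
qed

text \<open>The representative in \<open>\<Sigma>\<close> of the orbit of a metric.\<close>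

definition Q :: "real^6^6 \<Rightarrow> real^6^6" where
  "Q g = s (cholesky g)"

lemma Q_smooth: "smooth_on metrics Q"
  unfolding Q_def
  by (rule smooth_on_compose[OF s_smooth smooth_on_cholesky]) (use cholesky_T6 T6_subset_pos_diag in blast)

lemma Q_Sigma: "g \<in> metrics \<Longrightarrow> Q g \<in> \<Sigma>"
  by (simp add: Q_def s_Sigma cholesky_T6)

lemma act_metrics: "g \<in> metrics \<Longrightarrow> y \<in> G \<Longrightarrow> transpose y ** g ** y \<in> metrics"
  using congruence_metrics T6_invertible G_T6 by blast

lemma act_gram: "transpose y ** (transpose x ** x) ** y = transpose (x ** y) ** (x ** y)"
  for x y :: "real^6^6"
  by (simp add: matrix_transpose_mul matrix_mul_assoc)

lemma Q_act: "g \<in> metrics \<Longrightarrow> y \<in> G \<Longrightarrow> Q (transpose y ** g ** y) = Q g"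
proof -
  assume g: "g \<in> metrics" and y: "y \<in> G"
  have "transpose y ** g ** y = transpose (cholesky g ** y) ** (cholesky g ** y)"
    using act_gram[of y "cholesky g"] cholesky_gram[OF g] by simp
  then have "cholesky (transpose y ** g ** y) = cholesky g ** y"
    using cholesky_gram_eq T6_mult cholesky_T6[OF g] y G_T6 by auto
  then show ?thesis using s_mult[OF cholesky_T6[OF g] y] by (simp add: Q_def)
qed

lemma Q_section: "x \<in> \<Sigma> \<Longrightarrow> y \<in> G \<Longrightarrow> Q (transpose y ** (transpose x ** x) ** y) = x"
proof -
  assume x: "x \<in> \<Sigma>" and y: "y \<in> G"
  then have "x ** y \<in> T6" using T6_mult Sigma_T6 G_T6 by blast
  then show ?thesis
    unfolding act_gram Q_def using cholesky_gram_eq s_Sigma_mult[OF x y] by simp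
qed

lemma gram_Sigma_metrics: "x \<in> \<Sigma> \<Longrightarrow> transpose x ** x \<in> metrics"
  using gram_metrics Sigma_T6 by blast

lemma Q_gram: "x \<in> \<Sigma> \<Longrightarrow> Q (transpose x ** x) = x"
  using Q_section[OF _ G_one] by simp

lemma metric_in_orbit_of_Q:
  assumes "g \<in> metrics"
  obtains y where "y \<in> G" "transpose y ** (transpose (Q g) ** Q g) ** y = g"
proof
  show "a (cholesky g) \<in> G" by (rule a_G[OF cholesky_T6[OF assms]])
  show "transpose (a (cholesky g)) ** (transpose (Q g) ** Q g) ** a (cholesky g) = g"
    unfolding act_gram Q_def by (simp add: s_a cholesky_T6 cholesky_gram assms)
qed

lemma orbit_act_subset:
  assumes "y \<in> G" shows "orbit G (transpose y ** g ** y) \<subseteq> orbit G g"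
proof
  fix h assume "h \<in> orbit G (transpose y ** g ** y)"
  then obtain z where "z \<in> G" "h = transpose z ** (transpose y ** g ** y) ** z"
    unfolding orbit_def by blast
  then have "h = transpose (y ** z) ** g ** (y ** z)" "y ** z \<in> G"
    using assms G_mult by (simp_all add: matrix_transpose_mul matrix_mul_assoc)
  then show "h \<in> orbit G g" unfolding orbit_def by blast
qed

lemma orbit_act: "y \<in> G \<Longrightarrow> orbit G (transpose y ** g ** y) = orbit G g"
proof
  assume y: "y \<in> G"
  show "orbit G (transpose y ** g ** y) \<subseteq> orbit G g" by (rule orbit_act_subset[OF y])
  have i: "y ** matrix_inv y = mat 1" using matrix_inv_mult(1) T6_invertible G_T6 y by blast
  then have "transpose (matrix_inv y) ** transpose y = mat 1" by (simp flip: matrix_transpose_mul)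
  then have "transpose (matrix_inv y) ** (transpose y ** g ** y) ** matrix_inv y = g"
    using i by (metis matrix_mul_assoc matrix_mul_lid matrix_mul_rid)
  then show "orbit G g \<subseteq> orbit G (transpose y ** g ** y)"
    using orbit_act_subset[OF G_inverse[OF y], of "transpose y ** g ** y"] by simp
qed

lemma orbit_self: "g \<in> orbit G g"
  unfolding orbit_def using G_one by (auto intro!: exI[of _ "mat 1"])

lemma orbit_eq_Q: "g \<in> metrics \<Longrightarrow> orbit G (transpose (Q g) ** Q g) = orbit G g"
  using metric_in_orbit_of_Q orbit_act by metis

lemma Q_orbit_cong: "g \<in> metrics \<Longrightarrow> g' \<in> metrics \<Longrightarrow> orbit G g = orbit G g' \<Longrightarrow> Q g = Q g'"
  using orbit_self[of g] Q_act[of g'] unfolding orbit_def by auto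

abbreviation "X \<equiv> orbit_space G"

definition coord :: "(real^6^6) set \<Rightarrow> real^6^6" where
  "coord p = Q (SOME g. g \<in> metrics \<and> orbit G g = p)"

definition point :: "real^6^6 \<Rightarrow> (real^6^6) set" where
  "point x = orbit G (transpose x ** x)"

definition chart :: "(real^6^6) set \<Rightarrow> real^6^6" where
  "chart p = coord p - mat 1"

lemma topspace_X: "topspace X = orbit G ` metrics"
  using quotient_imp_surjective_map[OF quotient_map_orbit[of G]] by simp

lemma coord_orbit: "g \<in> metrics \<Longrightarrow> coord (orbit G g) = Q g"
  unfolding coord_def
  by (rule Q_orbit_cong) (use someI_ex[of "\<lambda>h. h \<in> metrics \<and> orbit G h = orbit G g"] in blast)+

lemma coord_Sigma: "p \<in> topspace X \<Longrightarrow> coord p \<in> \<Sigma>"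
  unfolding topspace_X using coord_orbit Q_Sigma by auto

lemma point_topspace: "x \<in> \<Sigma> \<Longrightarrow> point x \<in> topspace X"
  unfolding topspace_X point_def using gram_Sigma_metrics by blast

lemma point_coord: "p \<in> topspace X \<Longrightarrow> point (coord p) = p"
  unfolding topspace_X point_def using coord_orbit orbit_eq_Q by auto

lemma coord_point: "x \<in> \<Sigma> \<Longrightarrow> coord (point x) = x"
  unfolding point_def using coord_orbit gram_Sigma_metrics Q_gram by simp

lemma continuous_map_orbit: "continuous_map (top_of_set metrics) X (orbit G)"
  by (rule quotient_imp_continuous_map[OF quotient_map_orbit])

lemma continuous_map_coord: "continuous_map X (top_of_set \<Sigma>) coord"
proof (rule continuous_compose_quotient_map[OF quotient_map_orbit])
  have "continuous_map (top_of_set metrics) (top_of_set \<Sigma>) Q"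
    using smooth_on_continuous_on[OF Q_smooth] Q_Sigma by (simp add: continuous_map_subtopology_eu image_subset_iff Pi_iff)
  then show "continuous_map (top_of_set metrics) (top_of_set \<Sigma>) (coord \<circ> orbit G)"
    by (rule continuous_map_eq) (simp add: coord_orbit)
qed

lemma smooth_on_gram: "smooth_on S (\<lambda>x :: real^6^6. transpose x ** x)"
  by (intro smooth_on_matrix_mult smooth_on_transpose smooth_on_id)

lemma continuous_map_point: "continuous_map (top_of_set \<Sigma>) X point"
proof -
  have "continuous_map (top_of_set \<Sigma>) (top_of_set metrics) (\<lambda>x. transpose x ** x)"
    using smooth_on_continuous_on[OF smooth_on_gram] gram_Sigma_metrics
    by (simp add: continuous_map_subtopology_eu image_subset_iff Pi_iff)
  from continuous_map_compose[OF this continuous_map_orbit] show ?thesis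
    by (simp add: o_def point_def[abs_def])
qed

lemma homeomorphic_maps_coord_point: "homeomorphic_maps X (top_of_set \<Sigma>) coord point"
  unfolding homeomorphic_maps_def
  using continuous_map_coord continuous_map_point point_coord coord_point by simp

lemma chart_image: "chart ` topspace X = V \<inter> {M. M + mat 1 \<in> pos_diag}"
proof
  show "chart ` topspace X \<subseteq> V \<inter> {M. M + mat 1 \<in> pos_diag}"
    using coord_Sigma by (auto simp: chart_def Sigma_iff)
  show "V \<inter> {M. M + mat 1 \<in> pos_diag} \<subseteq> chart ` topspace X"
  proof
    fix M assume "M \<in> V \<inter> {M. M + mat 1 \<in> pos_diag}"
    then have "M + mat 1 \<in> \<Sigma>" by (simp add: Sigma_iff)
    then show "M \<in> chart ` topspace X"
      using point_topspace coord_point by (intro image_eqI[of _ _ "point (M + mat 1)"]) (auto simp: chart_def)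
  qed
qed

lemma open_shifted_pos_diag: "open {M. M + mat 1 \<in> pos_diag}"
proof -
  have "open ((\<lambda>M. M + mat 1) -` pos_diag)" by (intro open_vimage open_pos_diag continuous_intros)
  then show ?thesis by (simp add: vimage_def)
qed

lemma chart_on_chart: "chart_on V X (topspace X, chart)"
proof -
  let ?W = "chart ` topspace X"
  have "homeomorphic_maps X (top_of_set ?W) chart (\<lambda>M. point (M + mat 1))"
    unfolding homeomorphic_maps_def
  proof (intro conjI ballI)
    have "continuous_map X euclidean coord" using continuous_map_coord by (simp add: continuous_map_in_subtopology)
    then show "continuous_map X (top_of_set ?W) chart"
      unfolding continuous_map_in_subtopology chart_def[abs_def]
      by (intro conjI continuous_map_diff) auto
    have "(\<lambda>M. M + mat 1) ` ?W \<subseteq> \<Sigma>" using chart_image by (auto simp: Sigma_iff)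
    then have "continuous_map (top_of_set ?W) (top_of_set \<Sigma>) (\<lambda>M. M + mat 1)"
      by (auto simp: continuous_map_subtopology_eu intro!: continuous_intros)
    from continuous_map_compose[OF this continuous_map_point]
    show "continuous_map (top_of_set ?W) X (\<lambda>M. point (M + mat 1))" by (simp add: o_def)
    show "point (chart p + mat 1) = p" if "p \<in> topspace X" for p
      using point_coord[OF that] by (simp add: chart_def)
    show "chart (point (M + mat 1)) = M" if "M \<in> topspace (top_of_set ?W)" for M
      using that chart_image coord_point[of "M + mat 1"] by (simp add: chart_def Sigma_iff)
  qed
  moreover have "openin (top_of_set V) ?W"
    unfolding chart_image using open_shifted_pos_diag by (rule openin_open_Int)
  ultimately show ?thesis
    unfolding chart_on_def using homeomorphic_maps_imp_map by auto
qed

lemma inv_into_chart: "p \<in> topspace X \<Longrightarrow> inv_into (topspace X) chart (chart p) = p"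
proof -
  have "inj_on chart (topspace X)"
    by (rule inj_onI) (metis chart_def diff_add_cancel point_coord)
  then show "p \<in> topspace X \<Longrightarrow> inv_into (topspace X) chart (chart p) = p" by (rule inv_into_f_f)
qed

text \<open>
  One chart suffices, since the cross-section is open in an affine space.
\<close>

lemma smooth_manifold_orbit_space: "smooth_manifold V X {(topspace X, chart)}"
proof -
  have "X homeomorphic_space (top_of_set \<Sigma>)"
    using homeomorphic_maps_coord_point unfolding homeomorphic_space_def by blast
  then have "Hausdorff_space X"
    by (simp add: homeomorphic_Hausdorff_space Hausdorff_space_subtopology)
  moreover have "second_countable X"
  proof (rule second_countable_open_map_image)
    have "homeomorphic_map (top_of_set \<Sigma>) X point"
      using homeomorphic_maps_coord_point homeomorphic_maps_map by blast
    then show "continuous_map (top_of_set \<Sigma>) X point" "open_map (top_of_set \<Sigma>) X point"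
      "point ` topspace (top_of_set \<Sigma>) = topspace X"
      by (auto simp: homeomorphic_eq_everything_map)
    show "second_countable (top_of_set \<Sigma>)"
      by (rule second_countable_subtopology[OF second_countable_euclidean])
  qed
  moreover have "smooth_on (chart ` (topspace X \<inter> topspace X)) (chart \<circ> inv_into (topspace X) chart)"
    by (rule smooth_on_cong[OF _ smooth_on_id]) (auto simp: inv_into_chart)
  ultimately show ?thesis
    unfolding smooth_manifold_def using subspace_V chart_on_chart by auto
qed

lemma shift_smooth: "smooth_on S (\<lambda>M :: real^6^6. M + mat 1)" "smooth_on S (\<lambda>M :: real^6^6. M - mat 1)"
  by (intro smooth_intros)+

lemma submanifold_Sigma: "submanifold V \<Sigma>"
proof -
  have "slice_chart V \<Sigma> pos_diag (\<lambda>x. x - mat 1)"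
    unfolding slice_chart_def
  proof (intro exI conjI)
    show "open pos_diag" "open {M. M + mat 1 \<in> pos_diag}"
      by (rule open_pos_diag, rule open_shifted_pos_diag)
    show "homeomorphism pos_diag {M. M + mat 1 \<in> pos_diag} (\<lambda>x. x - mat 1) (\<lambda>M. M + mat 1)"
      by (rule homeomorphismI) (auto intro!: continuous_intros)
    show "(\<lambda>x. x - mat 1) ` (\<Sigma> \<inter> pos_diag) = V \<inter> {M. M + mat 1 \<in> pos_diag}"
      by (auto simp: Sigma_iff image_iff intro!: bexI[of _ "_ + mat 1"])
  qed (rule shift_smooth)+
  then show ?thesis
    unfolding submanifold_def using subspace_V Sigma_iff by blast
qed

lemma diffeomorphic_Sigma: "diffeomorphic X {(topspace X, chart)} (top_of_set \<Sigma>) (slice_atlas V \<Sigma>)"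
proof -
  have "smooth_map X {(topspace X, chart)} (top_of_set \<Sigma>) (slice_atlas V \<Sigma>) coord"
    unfolding smooth_map_def
  proof (intro conjI continuous_map_coord, clarsimp simp: slice_atlas_def)
    fix U \<psi> assume "slice_chart V \<Sigma> U \<psi>"
    then obtain W \<psi>' where U: "smooth_on U \<psi>" by (rule slice_chartE)
    show "smooth_on (chart ` {p \<in> topspace X. coord p \<in> \<Sigma> \<and> coord p \<in> U}) (\<psi> \<circ> coord \<circ> inv_into (topspace X) chart)"
    proof (rule smooth_on_cong[OF _ smooth_on_compose[OF U shift_smooth(1)]])
      show "(\<lambda>M. M + mat 1) ` (chart ` {p \<in> topspace X. coord p \<in> \<Sigma> \<and> coord p \<in> U}) \<subseteq> U"
        by (auto simp: chart_def)
      fix M assume "M \<in> chart ` {p \<in> topspace X. coord p \<in> \<Sigma> \<and> coord p \<in> U}"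
      then show "\<psi> (M + mat 1) = (\<psi> \<circ> coord \<circ> inv_into (topspace X) chart) M"
        by (auto simp: inv_into_chart) (simp add: chart_def)
    qed
  qed
  moreover have "smooth_map (top_of_set \<Sigma>) (slice_atlas V \<Sigma>) X {(topspace X, chart)} point"
    unfolding smooth_map_def
  proof (intro conjI continuous_map_point, clarsimp simp: slice_atlas_def)
    fix U \<psi> assume "slice_chart V \<Sigma> U \<psi>"
    then obtain W \<psi>' where U: "\<And>x. x \<in> U \<Longrightarrow> \<psi> x \<in> W" "\<And>x. x \<in> U \<Longrightarrow> \<psi>' (\<psi> x) = x" "smooth_on W \<psi>'"
      "\<And>x. x \<in> \<Sigma> \<Longrightarrow> x \<in> U \<Longrightarrow> inv_into (\<Sigma> \<inter> U) \<psi> (\<psi> x) = x"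
      by (rule slice_chartE) blast
    let ?D = "{p. p \<in> \<Sigma> \<and> p \<in> U \<and> point p \<in> topspace X}"
    have D: "\<psi> ` ?D \<subseteq> W" using U(1) by auto
    show "smooth_on (\<psi> ` ?D) (chart \<circ> point \<circ> inv_into (\<Sigma> \<inter> U) \<psi>)"
    proof (rule smooth_on_cong[OF _ smooth_on_diff[OF smooth_on_subset[OF U(3) D] smooth_on_const]])
      fix y assume "y \<in> \<psi> ` ?D"
      then obtain x where x: "x \<in> \<Sigma>" "x \<in> U" "y = \<psi> x" by auto
      then show "\<psi>' y - mat 1 = (chart \<circ> point \<circ> inv_into (\<Sigma> \<inter> U) \<psi>) y"
        by (simp add: U chart_def coord_point)
    qed
  qed
  ultimately show ?thesis
    unfolding diffeomorphic_def using homeomorphic_maps_coord_point by blast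
qed

lemma orbit_in_chart:
  assumes "slice_chart sym_matrices metrics U \<psi>"
  shows "smooth_on (\<psi> ` (metrics \<inter> U)) (chart \<circ> orbit G \<circ> inv_into (metrics \<inter> U) \<psi>)"
    and "g \<in> metrics \<Longrightarrow> g \<in> U \<Longrightarrow> (chart \<circ> orbit G \<circ> inv_into (metrics \<inter> U) \<psi>) (\<psi> g) = Q g - mat 1"
proof -
  obtain W \<psi>' where U: "\<And>x. x \<in> U \<Longrightarrow> \<psi> x \<in> W" "\<And>x. x \<in> U \<Longrightarrow> \<psi>' (\<psi> x) = x" "smooth_on W \<psi>'"
    "\<And>x. x \<in> metrics \<Longrightarrow> x \<in> U \<Longrightarrow> inv_into (metrics \<inter> U) \<psi> (\<psi> x) = x"
    using assms by (rule slice_chartE) blast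
  show eq: "(chart \<circ> orbit G \<circ> inv_into (metrics \<inter> U) \<psi>) (\<psi> g) = Q g - mat 1" if "g \<in> metrics" "g \<in> U" for g
    using that by (simp add: U chart_def coord_orbit)
  have sub: "\<psi> ` (metrics \<inter> U) \<subseteq> W" using U(1) by auto
  show "smooth_on (\<psi> ` (metrics \<inter> U)) (chart \<circ> orbit G \<circ> inv_into (metrics \<inter> U) \<psi>)"
  proof (rule smooth_on_cong[OF _ smooth_on_diff[OF
          smooth_on_compose[OF Q_smooth smooth_on_subset[OF U(3) sub]] smooth_on_const]])
    show "\<psi>' ` (\<psi> ` (metrics \<inter> U)) \<subseteq> metrics" using U(2) by auto
    fix y assume "y \<in> \<psi> ` (metrics \<inter> U)"
    then obtain g where "g \<in> metrics" "g \<in> U" "y = \<psi> g" by auto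
    then show "Q (\<psi>' y) - mat 1 = (chart \<circ> orbit G \<circ> inv_into (metrics \<inter> U) \<psi>) y"
      using eq U(2) by simp
  qed
qed

text \<open>
  Moving the representative of an orbit along \<open>\<Sigma>\<close>, while keeping the group element fixed, gives
  curves of metrics whose images under the projection have any prescribed velocity in \<open>V\<close>.
\<close>

lemma orbit_chart_derivative:
  assumes sl: "slice_chart sym_matrices metrics U \<psi>" and p: "p \<in> metrics" "p \<in> U"
  shows "\<exists>L. (chart \<circ> orbit G \<circ> inv_into (metrics \<inter> U) \<psi> has_derivative L) (at (\<psi> p) within \<psi> ` (metrics \<inter> U)) \<and>
    L ` sym_matrices = V"
proof -
  let ?f = "chart \<circ> orbit G \<circ> inv_into (metrics \<inter> U) \<psi>"
  obtain W \<psi>' where U: "open U" "open W" "\<And>x. x \<in> U \<Longrightarrow> \<psi> x \<in> W" "smooth_on U \<psi>"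
    "\<psi> ` (metrics \<inter> U) = sym_matrices \<inter> W"
    using sl by (rule slice_chartE) blast
  have fV: "?f y \<in> V" if "y \<in> sym_matrices \<inter> W" for y
  proof -
    obtain g where "g \<in> metrics" "g \<in> U" "y = \<psi> g" using \<open>y \<in> sym_matrices \<inter> W\<close> U(5) by blast
    then show ?thesis using orbit_in_chart(2)[OF sl] Q_Sigma Sigma_iff by metis
  qed
  have sym: "subspace sym_matrices"
    by (auto simp: subspace_def sym_matrices_def transpose_def vec_eq_iff)
  have y0: "\<psi> p \<in> sym_matrices \<inter> W" using p U(5) by blast
  obtain N k L where N: "open N" "\<psi> p \<in> N" "\<And>y. y \<in> (sym_matrices \<inter> W) \<inter> N \<Longrightarrow> k y = ?f y"
    and L: "(k has_derivative L) (at (\<psi> p))"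
    using smooth_on_local_extension[OF orbit_in_chart(1)[OF sl], of "\<psi> p"] y0 unfolding U(5) by metis
  have "(?f has_derivative L) (at (\<psi> p) within sym_matrices \<inter> W)"
  proof (rule has_derivative_transform_eventually[OF has_derivative_at_withinI[OF L]])
    show "\<forall>\<^sub>F y in at (\<psi> p) within sym_matrices \<inter> W. k y = ?f y"
      unfolding eventually_at_topological using N by blast
    show "k (\<psi> p) = ?f (\<psi> p)" using N y0 by blast
  qed (rule y0)
  moreover have "L ` sym_matrices = V"
  proof
    show "L ` sym_matrices \<subseteq> V"
    proof
      fix w assume "w \<in> L ` sym_matrices"
      then obtain v where v: "v \<in> sym_matrices" "w = L v" by blast
      define \<gamma> where "\<gamma> t = \<psi> p + t *\<^sub>R v" for t :: real
      have \<gamma>0: "\<gamma> 0 = \<psi> p" by (simp add: \<gamma>_def)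
      have d: "(\<gamma> has_vector_derivative v) (at 0)"
        unfolding \<gamma>_def by (auto intro!: derivative_eq_intros)
      have "((\<lambda>t. k (\<gamma> t)) has_vector_derivative w) (at 0)"
        using vector_derivative_diff_chain_within[OF d, of k L] L \<gamma>0
        by (simp add: o_def v has_derivative_at_withinI)
      moreover have "\<forall>\<^sub>F t in at 0. k (\<gamma> t) - k (\<gamma> 0) \<in> V"
      proof -
        have ev: "\<forall>\<^sub>F t in at 0. \<gamma> t \<in> W \<inter> N"
          by (rule eventually_in_open[OF has_vector_derivative_continuous[OF d]])
            (use U(2) N(1,2) y0 \<gamma>0 in auto)
        have sym\<gamma>: "\<gamma> t \<in> sym_matrices" for t
          unfolding \<gamma>_def using y0 v sym by (auto intro: subspace_add subspace_mul)
        have kV: "k (\<gamma> t) \<in> V" if "\<gamma> t \<in> W \<inter> N" for t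
          using N(3)[of "\<gamma> t"] fV[of "\<gamma> t"] sym\<gamma>[of t] that by auto
        show ?thesis
          by (rule eventually_mono[OF ev], rule subspace_diff[OF subspace_V])
            (use kV kV[of 0] y0 N(2) \<gamma>0 in auto)
      qed
      ultimately show "w \<in> V" by (rule vector_derivative_in_subspace[OF _ subspace_V])
    qed
    show "V \<subseteq> L ` sym_matrices"
    proof
      fix w assume w: "w \<in> V"
      obtain y where y: "y \<in> G" "transpose y ** (transpose (Q p) ** Q p) ** y = p"
        using metric_in_orbit_of_Q[OF p(1)] .
      \<comment> \<open>The representative moves along a line in \<open>\<Sigma>\<close>, so the class of \<open>c t\<close> moves with velocity \<open>w\<close> in the chart.\<close>
      define c where "c t = transpose y ** (transpose (Q p + t *\<^sub>R w) ** (Q p + t *\<^sub>R w)) ** y" for t :: real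
      have c0: "c 0 = p" by (simp add: c_def y)
      have QS: "Q p \<in> \<Sigma>" by (rule Q_Sigma[OF p(1)])
      have line: "smooth_on UNIV (\<lambda>t. Q p + t *\<^sub>R w)"
        by (intro smooth_intros smooth_on_bilinear[OF bounded_bilinear_scaleR])
      have "smooth_on UNIV c" unfolding c_def
        by (intro smooth_on_matrix_mult smooth_on_const smooth_on_transpose line)
      then obtain c' where c': "(c has_derivative c') (at 0)"
        using smooth_on_open_has_derivative[of UNIV c 0] by auto
      obtain \<psi>d where \<psi>d: "(\<psi> has_derivative \<psi>d) (at p)"
        using smooth_on_open_has_derivative[OF U(4,1) p(2)] .
      define \<eta> where "\<eta> t = \<psi> (c t)" for t
      have "(\<eta> has_derivative (\<lambda>t. \<psi>d (c' t))) (at 0)"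
        unfolding \<eta>_def using has_derivative_compose[OF c', of \<psi> \<psi>d] \<psi>d c0 by simp
      then have d\<eta>: "(\<eta> has_vector_derivative \<psi>d (c' 1)) (at 0)"
        by (rule has_derivative_imp_vector_derivative)
      have \<eta>0: "\<eta> 0 = \<psi> p" by (simp add: \<eta>_def c0)
      have "\<forall>\<^sub>F t in at 0. Q p + t *\<^sub>R w \<in> pos_diag"
        using QS by (intro eventually_in_open open_pos_diag continuous_intros) (simp add: Sigma_iff)
      moreover have "\<forall>\<^sub>F t in at 0. c t \<in> U"
        using has_derivative_continuous[OF c'] U(1) p(2) c0 by (intro eventually_in_open) auto
      moreover have "\<forall>\<^sub>F t in at 0. \<eta> t \<in> N"
        using has_vector_derivative_continuous[OF d\<eta>] N(1,2) \<eta>0 by (intro eventually_in_open) auto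
      ultimately have ev: "\<forall>\<^sub>F t in at 0. \<eta> t \<in> sym_matrices \<inter> W \<and> k (\<eta> t) = Q p + t *\<^sub>R w - mat 1"
      proof eventually_elim
        case (elim t)
        have "Q p + t *\<^sub>R w - mat 1 = (Q p - mat 1) + t *\<^sub>R w" by simp
        also have "\<dots> \<in> V" using QS w subspace_V by (auto simp: Sigma_iff intro: subspace_add subspace_mul)
        finally have S: "Q p + t *\<^sub>R w \<in> \<Sigma>" using elim(1) by (simp add: Sigma_iff)
        have m: "c t \<in> metrics" unfolding c_def by (intro act_metrics gram_Sigma_metrics S y)
        have W: "\<eta> t \<in> sym_matrices \<inter> W" unfolding \<eta>_def U(5)[symmetric] using m elim(2) by blast
        have "k (\<eta> t) = ?f (\<eta> t)" using N(3) W elim(3) by blast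
        also have "\<dots> = Q (c t) - mat 1" unfolding \<eta>_def using orbit_in_chart(2)[OF sl m elim(2)] .
        also have "Q (c t) = Q p + t *\<^sub>R w" unfolding c_def by (rule Q_section[OF S y(1)])
        finally show ?case using W by blast
      qed
      have sym\<psi>d: "\<psi>d (c' 1) \<in> sym_matrices"
        by (rule vector_derivative_in_subspace[OF d\<eta> sym], rule eventually_mono[OF ev])
          (use y0 \<eta>0 subspace_diff[OF sym] in auto)
      have at0: "Q p + 0 *\<^sub>R w - mat 1 = k (\<eta> 0)"
        using N(3)[of "\<psi> p"] y0 N(2) orbit_in_chart(2)[OF sl p] \<eta>0 by auto
      have near0: "\<forall>\<^sub>F t in at 0. Q p + t *\<^sub>R w - mat 1 = k (\<eta> t)"
        by (rule eventually_mono[OF ev]) simp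
      have line_d: "((\<lambda>t. Q p + t *\<^sub>R w - mat 1) has_derivative (\<lambda>t. t *\<^sub>R w)) (at 0)"
        by (auto intro!: derivative_eq_intros)
      have "((\<lambda>t. k (\<eta> t)) has_vector_derivative w) (at 0)"
        unfolding has_vector_derivative_def
        by (rule has_derivative_transform_eventually[OF line_d near0 at0 UNIV_I])
      moreover have "((\<lambda>t. k (\<eta> t)) has_vector_derivative L (\<psi>d (c' 1))) (at 0)"
        using vector_derivative_diff_chain_within[OF d\<eta>, of k L] L \<eta>0
        by (simp add: o_def has_derivative_at_withinI)
      ultimately have "w = L (\<psi>d (c' 1))" by (rule vector_derivative_unique_at)
      then show "w \<in> L ` sym_matrices" using sym\<psi>d by blast
    qed
  qed
  ultimately show ?thesis unfolding U(5) by blast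
qed

lemma smooth_submersion_orbit:
  "smooth_submersion sym_matrices (top_of_set metrics) (slice_atlas sym_matrices metrics)
    V X {(topspace X, chart)} (orbit G)"
proof -
  have eq: "{g \<in> metrics. g \<in> U \<and> orbit G g \<in> topspace X} = metrics \<inter> U" for U
    by (auto simp: topspace_X)
  show ?thesis
    unfolding smooth_submersion_def smooth_map_def slice_atlas_def
  proof (intro conjI continuous_map_orbit; clarsimp simp: eq)
    fix U \<psi> assume sl: "slice_chart sym_matrices metrics U \<psi>"
    show "smooth_on (\<psi> ` (metrics \<inter> U)) (chart \<circ> orbit G \<circ> inv_into (metrics \<inter> U) \<psi>)"
      by (rule orbit_in_chart(1)[OF sl])
    fix p assume "p \<in> metrics" "p \<in> U"
    then show "\<exists>L. (chart \<circ> orbit G \<circ> inv_into (metrics \<inter> U) \<psi> has_derivative L)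
        (at (\<psi> p) within \<psi> ` (metrics \<inter> U)) \<and> L ` sym_matrices = V"
      by (rule orbit_chart_derivative[OF sl])
  qed
qed

text \<open>
  The two submanifolds meet only in the identity. A curve in \<open>T6\<close> through the identity factors into a
  curve in \<open>\<Sigma>\<close> and a curve in \<open>G\<close>, and the product rule splits its velocity accordingly.
\<close>

lemma transversal_Sigma: "transversal_in T6 \<Sigma> G"
  unfolding transversal_in_def
proof
  fix p assume p: "p \<in> \<Sigma> \<inter> G"
  have "p ** mat 1 = mat 1 ** p" by simp
  then have "p = mat 1 \<and> mat 1 = p" using p by (intro unique Sigma_one G_one) auto
  then have p1: "p = mat 1" ..
  show "{u + v |u v. u \<in> tangent_space \<Sigma> p \<and> v \<in> tangent_space G p} = tangent_space T6 p"
  proof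
    show "{u + v |u v. u \<in> tangent_space \<Sigma> p \<and> v \<in> tangent_space G p} \<subseteq> tangent_space T6 p"
      using tangent_space_mono[OF Sigma_T6, of "mat 1"] tangent_space_mono[OF G_T6, of "mat 1"]
      unfolding p1 tangent_space_T6 by (auto simp: lower_triangular_def subset_iff)
    show "tangent_space T6 p \<subseteq> {u + v |u v. u \<in> tangent_space \<Sigma> p \<and> v \<in> tangent_space G p}"
    proof
      fix w assume "w \<in> tangent_space T6 p"
      then obtain \<gamma> e where g: "0 < (e::real)" "smooth_on {-e<..<e} \<gamma>" "\<gamma> ` {-e<..<e} \<subseteq> T6" "\<gamma> 0 = mat 1"
        "(\<gamma> has_vector_derivative w) (at 0)"
        unfolding tangent_space_def p1 by blast
      have z: "0 \<in> {-e<..<e}" using g(1) by simp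
      have sg: "smooth_on {-e<..<e} (\<lambda>t. s (\<gamma> t))" "smooth_on {-e<..<e} (\<lambda>t. a (\<gamma> t))"
        using g(3) T6_subset_pos_diag
        by (auto intro!: smooth_on_compose[OF s_smooth g(2)] smooth_on_compose[OF a_smooth g(2)])
      obtain u where "((\<lambda>t. s (\<gamma> t)) has_derivative u) (at 0)"
        using smooth_on_open_has_derivative[OF sg(1) _ z] by auto
      then have u: "((\<lambda>t. s (\<gamma> t)) has_vector_derivative u 1) (at 0)"
        by (rule has_derivative_imp_vector_derivative)
      obtain v where "((\<lambda>t. a (\<gamma> t)) has_derivative v) (at 0)"
        using smooth_on_open_has_derivative[OF sg(2) _ z] by auto
      then have v: "((\<lambda>t. a (\<gamma> t)) has_vector_derivative v 1) (at 0)"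
        by (rule has_derivative_imp_vector_derivative)
      have "s (mat 1) ** a (mat 1) = mat 1 ** mat 1" using s_a[OF mat_1_T6] by simp
      then have one: "s (mat 1) = mat 1 \<and> a (mat 1) = mat 1"
        by (rule unique[OF s_Sigma[OF mat_1_T6] Sigma_one a_G[OF mat_1_T6] G_one])
      have "((\<lambda>t. s (\<gamma> t) ** a (\<gamma> t)) has_vector_derivative v 1 + u 1) (at 0)"
        using bounded_bilinear.has_vector_derivative[OF bounded_bilinear_matrix_mult u v] one g(4) by simp
      moreover have "s (\<gamma> t) ** a (\<gamma> t) = \<gamma> t" if "t \<in> {-e<..<e}" for t
        using g(3) that s_a by blast
      ultimately have "(\<gamma> has_vector_derivative v 1 + u 1) (at 0)"
        by (rule has_vector_derivative_transform_within_open[OF _ open_greaterThanLessThan z])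
      then have "w = u 1 + v 1" using vector_derivative_unique_at[OF g(5)] by (simp add: add.commute)
      moreover have "u 1 \<in> tangent_space \<Sigma> p"
        unfolding tangent_space_def p1
        by (intro CollectI exI[of _ "\<lambda>t. s (\<gamma> t)"] exI[of _ e]) (use u g(1,3,4) sg(1) one s_Sigma in auto)
      moreover have "v 1 \<in> tangent_space G p"
        unfolding tangent_space_def p1
        by (intro CollectI exI[of _ "\<lambda>t. a (\<gamma> t)"] exI[of _ e]) (use v g(1,3,4) sg(2) one a_G in auto)
      ultimately show "w \<in> {u + v |u v. u \<in> tangent_space \<Sigma> p \<and> v \<in> tangent_space G p}" by blast
    qed
  qed
qed

theorem orbit_space_diffeomorphic_cross_section:
  "\<exists>(V :: (real^6^6) set) A.
      smooth_manifold V (orbit_space G) A \<and>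
      smooth_submersion sym_matrices (top_of_set metrics) (slice_atlas sym_matrices metrics)
        V (orbit_space G) A (orbit G) \<and>
      Sigma_free F \<subseteq> T6 \<and> transversal_in T6 (Sigma_free F) G \<and>
      (\<exists>V'. submanifold V' (Sigma_free F) \<and>
        diffeomorphic (orbit_space G) A (top_of_set (Sigma_free F)) (slice_atlas V' (Sigma_free F)))"
  by (rule exI[of _ V], rule exI[of _ "{(topspace X, chart)}"])
    (intro conjI exI[of _ V] smooth_manifold_orbit_space smooth_submersion_orbit Sigma_T6 transversal_Sigma
      submanifold_Sigma diffeomorphic_Sigma)

end

section \<open>The identity components of the automorphism groups of the CSLATs\<close>

definition entry :: "real list list \<Rightarrow> nat \<Rightarrow> nat \<Rightarrow> real" where
  "entry l i j = l ! i ! j"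

text \<open>
  For each algebra, the rows of the general element of the identity component, with \<open>x\<close> supplying
  the leading entries. The remaining entries arise by solving the equations for lower triangular
  automorphisms with positive diagonal: an image of a commutator is the commutator of the images, which
  gives most of the entries to the right, and the other relations fix the diagonal exponents and the
  entries such as \<open>x\<^sub>3\<^sub>2\<^sup>2 / (2 x\<^sub>2\<^sub>2)\<close>, where two expressions for the same entry are compared.
\<close>

fun aut_entry :: "cslat6 \<Rightarrow> (6 \<Rightarrow> 6 \<Rightarrow> real) \<Rightarrow> nat \<Rightarrow> nat \<Rightarrow> real" where
  "aut_entry H9 x = entry
    [[x 1 1], [x 2 1, x 2 2], [x 3 1, x 3 2, x 1 1 ^ 2],
     [x 4 1, x 4 2, x 4 3, x 4 4],
     [x 5 1, x 5 2, x 1 1 * x 2 1, 0, x 1 1 * x 2 2],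
     [x 6 1, x 6 2, x 6 3, x 6 4, x 2 1 * x 3 2 - x 1 1 * x 5 2 - x 2 2 * x 3 1, x 1 1 ^ 2 * x 2 2]]"
| "aut_entry H10 x = entry
    [[x 1 1], [x 2 1, x 2 2], [x 3 1, x 3 2, x 3 3],
     [x 4 1, x 4 2, x 4 3, x 1 1 * x 2 2],
     [x 5 1, x 5 2, x 5 3, x 1 1 * x 3 2, x 1 1 * x 3 3],
     [x 6 1, x 6 2, x 6 3, x 1 1 * x 4 2, x 1 1 * x 4 3, x 1 1 ^ 2 * x 2 2]]"
| "aut_entry H11 x = entry
    [[x 1 1], [x 2 1, x 2 2], [x 3 1, x 3 2, x 1 1 ^ 2],
     [x 4 1, x 4 2, x 4 3, x 1 1 * x 2 2],
     [x 5 1, x 5 2, x 5 3, x 1 1 * x 3 2, x 1 1 ^ 3],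
     [x 6 1, x 6 2, x 6 3, x 1 1 * x 4 2 + x 2 1 * x 3 2 - x 2 2 * x 3 1, x 1 1 * x 4 3 + x 1 1 ^ 2 * x 2 1, x 1 1 ^ 2 * x 2 2]]"
| "aut_entry H12 x = entry
    [[x 1 1], [0, x 2 2], [x 3 1, x 3 2, x 3 3],
     [x 4 1, x 4 2, 0, x 1 1 * x 2 2],
     [x 5 1, x 5 2, x 5 3, x 1 1 * x 3 2, x 1 1 * x 3 3],
     [x 6 1, x 6 2, x 6 3, - (x 2 2 * x 4 1), 0, x 1 1 * x 2 2 ^ 2]]"
| "aut_entry H13 x = entry
    [[x 1 1], [0, x 2 2], [x 3 1, x 3 2, x 1 1 * x 2 2],
     [x 4 1, x 4 2, 0, x 1 1 * x 2 2],
     [x 5 1, x 5 2, x 5 3, x 1 1 * x 3 2 + x 1 1 * x 4 2, x 1 1 ^ 2 * x 2 2],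
     [x 6 1, x 6 2, x 6 3, - (x 2 2 * x 4 1), 0, x 1 1 * x 2 2 ^ 2]]"
| "aut_entry H14 x = entry
    [[x 1 1], [x 2 1, x 2 2], [x 3 1, x 3 2, x 2 2 ^ 2],
     [x 4 1, x 4 2, 0, x 1 1 * x 2 2],
     [x 5 1, x 5 2, x 5 3, x 1 1 * x 4 2, x 1 1 ^ 2 * x 2 2],
     [x 6 1, x 6 2, x 6 3, x 1 1 * x 3 2 + x 2 2 * x 4 1 - x 2 1 * x 4 2, - (x 1 1 * x 2 1 * x 2 2), x 1 1 * x 2 2 ^ 2]]"
| "aut_entry H18 x = entry
    [[x 1 1], [x 2 1, x 2 2], [x 3 1, - (x 2 1 * x 2 2 / (x 1 1)), x 2 2 ^ 2 / (x 1 1)],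
     [x 4 1, x 4 2, 0, x 1 1 * x 2 2],
     [x 5 1, x 5 2, x 5 3, - (x 2 1 * x 2 2), x 2 2 ^ 2],
     [x 6 1, x 6 2, x 6 3, x 1 1 * x 5 2 + x 2 1 * x 4 2 - x 2 2 * x 4 1, x 1 1 * x 5 3, x 1 1 * x 2 2 ^ 2]]"
| "aut_entry H19p x = entry
    [[x 1 1], [0, x 2 2], [0, 0, x 3 3],
     [x 4 1, x 4 2, x 4 3, x 2 2 * x 3 3],
     [x 1 1 * x 4 3 / (x 3 3), x 5 2, x 5 3, 0, x 1 1 * x 2 2],
     [x 6 1, x 6 2, x 6 3, - (x 3 3 * x 5 2), - (x 1 1 * x 4 2), x 1 1 * x 2 2 * x 3 3]]"
| "aut_entry H21 x = entry
    [[x 1 1], [x 2 1, x 2 2], [x 3 1, x 3 2, x 3 3],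
     [x 4 1, x 4 2, 0, x 1 1 * x 2 2],
     [x 5 1, x 5 2, 0, x 1 1 * x 4 2, x 1 1 ^ 2 * x 2 2],
     [x 6 1, x 6 2, x 6 3, x 1 1 * x 5 2, x 1 1 ^ 2 * x 4 2, x 1 1 ^ 3 * x 2 2]]"
| "aut_entry H22 x = entry
    [[x 1 1], [x 2 1, x 1 1 ^ 2], [x 3 1, x 3 2, x 3 3],
     [x 4 1, x 4 2, 0, x 1 1 ^ 3],
     [x 5 1, x 5 2, 0, x 1 1 * x 4 2, x 1 1 ^ 4],
     [x 6 1, x 6 2, x 6 3, x 1 1 * x 5 2 + x 2 1 * x 4 2 - x 1 1 ^ 2 * x 4 1, x 1 1 ^ 2 * x 4 2 + x 1 1 ^ 3 * x 2 1, x 1 1 ^ 5]]"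
| "aut_entry H23 x = entry
    [[x 1 1], [x 2 1, x 2 2], [x 3 1, x 3 2, x 1 1 * x 2 2],
     [x 4 1, x 4 2, x 1 1 * x 3 2, x 1 1 ^ 2 * x 2 2],
     [x 5 1, x 5 2, x 2 1 * x 3 2 - x 2 2 * x 3 1, x 1 1 * x 2 1 * x 2 2, x 1 1 * x 2 2 ^ 2],
     [x 6 1, x 6 2, x 1 1 * x 4 2, x 1 1 ^ 2 * x 3 2, 0, x 1 1 ^ 3 * x 2 2]]"
| "aut_entry H24 x = entry
    [[x 1 1], [x 2 1, x 1 1 ^ 2], [x 3 1, x 3 2, x 1 1 ^ 3],
     [x 4 1, x 4 2, 0, x 1 1 ^ 3],
     [x 5 1, x 5 2, - (x 1 1 ^ 2 * x 2 1), x 1 1 * x 4 2, x 1 1 ^ 4],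
     [x 6 1, x 6 2, x 6 3, x 1 1 * x 5 2 + x 2 1 * x 3 2 + x 2 1 * x 4 2 - x 1 1 ^ 2 * x 3 1 - x 1 1 ^ 2 * x 4 1, x 1 1 ^ 2 * x 4 2 + x 1 1 ^ 3 * x 2 1, x 1 1 ^ 5]]"
| "aut_entry H25 x = entry
    [[x 1 1], [x 2 1, x 2 2], [x 3 1, x 3 2, x 1 1 ^ 3],
     [x 4 1, x 4 2, 0, x 1 1 * x 2 2],
     [x 5 1, x 5 2, - (x 1 1 ^ 2 * x 2 1), x 1 1 * x 4 2, x 1 1 ^ 2 * x 2 2],
     [x 6 1, x 6 2, x 6 3, x 1 1 * x 5 2 + x 2 1 * x 3 2 - x 2 2 * x 3 1, x 1 1 ^ 2 * x 4 2, x 1 1 ^ 3 * x 2 2]]"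
| "aut_entry H26m x = entry
    [[x 1 1], [0, x 2 2], [x 3 1, x 3 2, x 1 1 * x 2 2],
     [x 4 1, x 4 2, - (x 1 1 * x 3 2), x 1 1 ^ 2 * x 2 2],
     [x 5 1, x 5 2, x 2 2 * x 3 1, 0, x 1 1 * x 2 2 ^ 2],
     [x 6 1, x 6 2, x 1 1 * x 5 2 - x 2 2 * x 4 1, - (x 1 1 * x 2 2 * x 3 1), x 1 1 * x 2 2 * x 3 2, x 1 1 ^ 2 * x 2 2 ^ 2]]"
| "aut_entry H27 x = entry
    [[x 1 1], [x 2 1, x 2 2], [0, 0, x 1 1 ^ 2],
     [x 4 1, x 4 2, x 1 1 * x 2 1, x 1 1 * x 2 2],
     [x 5 1, x 5 2, x 1 1 * x 4 1, x 1 1 * x 4 2, x 1 1 ^ 2 * x 2 2],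
     [x 6 1, x 6 2, x 6 3, x 1 1 * x 5 2, x 1 1 ^ 2 * x 4 2, x 1 1 ^ 3 * x 2 2]]"
| "aut_entry H28 x = entry
    [[x 1 1], [x 2 1, x 2 2], [x 3 1, x 3 2, x 1 1 * x 2 2],
     [x 4 1, x 4 2, x 1 1 * x 3 2, x 1 1 ^ 2 * x 2 2],
     [x 5 1, x 5 2, x 1 1 * x 4 2, x 1 1 ^ 2 * x 3 2, x 1 1 ^ 3 * x 2 2],
     [x 6 1, x 6 2, x 1 1 * x 5 2, x 1 1 ^ 2 * x 4 2, x 1 1 ^ 3 * x 3 2, x 1 1 ^ 4 * x 2 2]]"
| "aut_entry H29 x = entry
    [[x 1 1], [x 2 1, x 1 1 ^ 3], [x 3 1, x 3 2, x 1 1 ^ 4],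
     [x 4 1, x 4 2, x 1 1 * x 3 2, x 1 1 ^ 5],
     [x 5 1, x 5 2, x 1 1 * x 4 2, x 1 1 ^ 2 * x 3 2, x 1 1 ^ 6],
     [x 6 1, x 6 2, x 1 1 * x 5 2 + x 2 1 * x 3 2 - x 1 1 ^ 3 * x 3 1, x 1 1 ^ 2 * x 4 2 + x 1 1 ^ 4 * x 2 1, x 1 1 ^ 3 * x 3 2, x 1 1 ^ 7]]"
| "aut_entry H30 x = entry
    [[x 1 1], [0, x 1 1 ^ 2], [x 3 1, x 3 2, x 1 1 ^ 3],
     [x 4 1, x 4 2, x 1 1 * x 3 2, x 1 1 ^ 4],
     [x 5 1, x 5 2, x 1 1 * x 4 2 - x 1 1 ^ 2 * x 3 1, x 1 1 ^ 2 * x 3 2, x 1 1 ^ 5],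
     [x 6 1, x 6 2, x 1 1 * x 5 2 - x 1 1 ^ 2 * x 4 1, x 1 1 ^ 2 * x 4 2 - x 1 1 ^ 3 * x 3 1, x 1 1 ^ 3 * x 3 2, x 1 1 ^ 6]]"
| "aut_entry H31 x = entry
    [[x 1 1], [0, x 2 2], [x 3 1, x 3 2, x 1 1 * x 2 2],
     [x 4 1, x 3 2 ^ 2 / (2 * x 2 2), x 1 1 * x 3 2, x 1 1 ^ 2 * x 2 2],
     [x 5 1, x 5 2, x 1 1 * x 3 2 ^ 2 / (2 * x 2 2), x 1 1 ^ 2 * x 3 2, x 1 1 ^ 3 * x 2 2],
     [x 6 1, x 6 2, x 3 1 * x 3 2 ^ 2 / (2 * x 2 2) + x 2 2 * x 5 1 - x 3 2 * x 4 1, x 1 1 * x 3 1 * x 3 2 - x 1 1 * x 2 2 * x 4 1, x 1 1 ^ 2 * x 2 2 * x 3 1, x 1 1 ^ 3 * x 2 2 ^ 2]]"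
| "aut_entry H32 x = entry
    [[x 1 1], [0, x 1 1 ^ 2], [x 3 1, x 3 2, x 1 1 ^ 3],
     [x 4 1, x 3 2 ^ 2 / (2 * x 1 1 ^ 2), x 1 1 * x 3 2, x 1 1 ^ 4],
     [x 5 1, x 5 2, x 3 2 ^ 2 / (2 * x 1 1) - x 1 1 ^ 2 * x 3 1, x 1 1 ^ 2 * x 3 2, x 1 1 ^ 5],
     [x 6 1, x 6 2, x 3 1 * x 3 2 ^ 2 / (2 * x 1 1 ^ 2) + x 1 1 ^ 2 * x 5 1 - x 3 2 * x 4 1, x 1 1 * x 3 1 * x 3 2 - x 1 1 ^ 3 * x 4 1, x 1 1 ^ 4 * x 3 1, x 1 1 ^ 7]]"

definition row_index :: "6 \<Rightarrow> nat" where
  "row_index i = pos i - 1"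

definition aut_matrix :: "cslat6 \<Rightarrow> real^6^6 \<Rightarrow> real^6^6" where
  "aut_matrix n M = (\<chi> i j. if pos j \<le> pos i
     then aut_entry n (\<lambda>k l. M $ k $ l) (row_index i) (row_index j) else 0)"

text \<open>
  Successor form, so that selecting a row or an entry is a rewriting by the equations of \<open>nth\<close>.
\<close>

lemma row_index_simps: "row_index 1 = 0" "row_index 2 = Suc 0" "row_index 3 = Suc (Suc 0)"
  "row_index 4 = Suc (Suc (Suc 0))" "row_index 5 = Suc (Suc (Suc (Suc 0)))"
  "row_index 6 = Suc (Suc (Suc (Suc (Suc 0))))"
  by (simp_all add: row_index_def)

text \<open>
  Comparing indices through \<open>pos\<close> reduces the inequality of elements of the finite index type to
  arithmetic of numerals.
\<close>

lemma eq_iff_pos: "i = j \<longleftrightarrow> pos i = pos j"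
  by simp

lemma entry_simps: "entry (r # l) 0 j = r ! j" "entry (r # l) (Suc i) j = entry l i j"
  by (simp_all add: entry_def)

text \<open>
  With these congruence rules the simplifier rewrites an entry only after it has been selected, and
  not the whole table.
\<close>

lemma entry_cong: "i = i' \<Longrightarrow> j = j' \<Longrightarrow> entry l i j = entry l i' j'"
  by simp

lemma nth_index_cong: "i = j \<Longrightarrow> l ! i = l ! j"
  by simp

lemmas aut_entries = aut_matrix_def vec_lambda_beta row_index_simps pos_simps rel_simps order_refl if_True if_False
  aut_entry.simps entry_simps nth_Cons_0 nth_Cons_Suc

lemma matrix_vector_axis: "((M :: real^6^6) *v axis i 1) $ k = M $ k $ i"
  by (simp add: matrix_vector_mult_basis column_def)

lemma bracket_add_left: "bracket n (x + x') y = bracket n x y + bracket n x' y"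
proof -
  have "(\<Sum>(c, i, j)\<leftarrow>l. c * ((x + x') $ i * y $ j - (x + x') $ j * y $ i)) =
    (\<Sum>(c, i, j)\<leftarrow>l. c * (x $ i * y $ j - x $ j * y $ i)) + (\<Sum>(c, i, j)\<leftarrow>l. c * (x' $ i * y $ j - x' $ j * y $ i))"
    for l :: "(real \<times> 6 \<times> 6) list"
    by (induction l) (auto simp: algebra_simps)
  then show ?thesis by (simp add: vec_eq_iff bracket_def)
qed

lemma bracket_scale_left: "bracket n (r *\<^sub>R x) y = r *\<^sub>R bracket n x y"
proof -
  have "(\<Sum>(c, i, j)\<leftarrow>l. c * ((r *\<^sub>R x) $ i * y $ j - (r *\<^sub>R x) $ j * y $ i)) =
    r * (\<Sum>(c, i, j)\<leftarrow>l. c * (x $ i * y $ j - x $ j * y $ i))"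
    for l :: "(real \<times> 6 \<times> 6) list"
    by (induction l) (auto simp: algebra_simps)
  then show ?thesis by (simp add: vec_eq_iff bracket_def)
qed

lemma bracket_swap: "bracket n y x = - bracket n x y"
proof -
  have "(\<Sum>(c, i, j)\<leftarrow>l. c * (y $ i * x $ j - y $ j * x $ i)) =
    - (\<Sum>(c, i, j)\<leftarrow>l. c * (x $ i * y $ j - x $ j * y $ i))"
    for l :: "(real \<times> 6 \<times> 6) list"
    by (induction l) (auto simp: algebra_simps)
  then show ?thesis by (simp add: vec_eq_iff bracket_def)
qed

lemma bilinear_bracket: "bilinear (bracket n)"
  unfolding bilinear_def
proof (intro conjI allI linearI)
  fix x y z :: "real^6" and r :: real
  show "bracket n x (y + z) = bracket n x y + bracket n x z"
    using bracket_swap[of n x "y + z"] bracket_swap[of n x y] bracket_swap[of n x z] bracket_add_left by simp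
  show "bracket n x (r *\<^sub>R y) = r *\<^sub>R bracket n x y"
    using bracket_swap[of n x "r *\<^sub>R y"] bracket_swap[of n x y] bracket_scale_left by simp
qed (rule bracket_add_left bracket_scale_left)+


lemma axis_nth: "axis i (1::real) $ k = (if k = i then 1 else 0)"
  by (simp add: axis_def)

lemma matrix_vector_nth_6: "((M :: real^6^6) *v x) $ k = M $ k $ 1 * x $ 1 + M $ k $ 2 * x $ 2 + M $ k $ 3 * x $ 3
    + M $ k $ 4 * x $ 4 + M $ k $ 5 * x $ 5 + M $ k $ 6 * x $ 6"
  by (simp add: matrix_vector_mult_def sum_6)

text \<open>
  The sign in the definition of the bracket is absorbed by exchanging the two products.
\<close>

definition bracket_terms :: "(real \<times> 6 \<times> 6) list \<Rightarrow> real^6 \<Rightarrow> real^6 \<Rightarrow> real" where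
  "bracket_terms l x y = (\<Sum>(c, i, j)\<leftarrow>l. c * (x $ j * y $ i - x $ i * y $ j))"

lemma bracket_nth: "bracket n x y $ k = bracket_terms (tuple n ! row_index k) x y"
proof -
  have "- (\<Sum>(c, i, j)\<leftarrow>l. c * (x $ i * y $ j - x $ j * y $ i)) = bracket_terms l x y" for l
    by (induction l) (auto simp: algebra_simps bracket_terms_def)
  then show ?thesis by (simp add: bracket_def row_index_def)
qed

lemma bracket_terms_simps:
  "bracket_terms [] x y = 0"
  "bracket_terms [(c, i, j)] x y = c * (x $ j * y $ i - x $ i * y $ j)"
  "bracket_terms ((c, i, j) # t # l) x y = c * (x $ j * y $ i - x $ i * y $ j) + bracket_terms (t # l) x y"
  by (simp_all add: bracket_terms_def)

lemmas bracket_entries = bracket_nth tuple.simps row_index_simps nth_Cons_0 nth_Cons_Suc bracket_terms_simps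

lemmas bracket_axis_entries = axis_nth eq_iff_pos pos_simps rel_simps if_True if_False

lemmas free_entries = free.simps insert_iff empty_iff prod.inject eq_iff_pos pos_simps rel_simps order_refl

lemmas ring_zero_one = mult_zero_left mult_zero_right mult_1 mult_1_right add_0 add_0_right diff_0_right diff_0
  diff_self minus_zero

lemma aut_matrix_leading:
  assumes "pos j \<le> pos i" "(i, j) \<notin> free n" shows "aut_matrix n M $ i $ j = M $ i $ j"
proof -
  have "\<forall>i j. pos j \<le> pos i \<longrightarrow> (i, j) \<notin> free n \<longrightarrow> aut_matrix n M $ i $ j = M $ i $ j"
    by (cases n; simp only: forall_6 aut_entries cong: entry_cong nth_index_cong;
        simp only: free_entries simp_thms)
  then show ?thesis using assms by blast
qed

lemma aut_matrix_upper: "pos i < pos j \<Longrightarrow> aut_matrix n M $ i $ j = 0"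
  by (simp add: aut_matrix_def)

lemma aut_matrix_one: "aut_matrix n (mat 1) = mat 1"
  by (cases n; simp only: vec_eq_iff forall_6 aut_entries cong: entry_cong nth_index_cong;
      simp only: mat_nth eq_iff_pos pos_simps rel_simps simp_thms if_True if_False; simp)

lemma aut_matrix_diag:
  assumes "M \<in> pos_diag" shows "0 < aut_matrix n M $ i $ i"
proof -
  have d: "0 < M $ i $ i" for i using assms by (rule pos_diagD)
  have nz: "M $ i $ i \<noteq> 0" for i using d[of i] by simp
  have "\<forall>i. 0 < aut_matrix n M $ i $ i"
    by (cases n; simp only: forall_6 aut_entries cong: entry_cong nth_index_cong; simp add: d nz)
  then show ?thesis by blast
qed

lemma smooth_on_aut_matrix: "smooth_on pos_diag (aut_matrix n)"
proof (rule smooth_on_matrix)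
  have nz: "M $ i $ i \<noteq> 0" if "M \<in> pos_diag" for M :: "real^6^6" and i
    using pos_diagD[OF that, of i] by simp
  have "\<forall>i j. smooth_on pos_diag (\<lambda>M. aut_matrix n M $ i $ j)"
    by (cases n; simp only: forall_6 aut_entries cong: entry_cong nth_index_cong;
        intro conjI smooth_intros smooth_on_divide; simp add: nz)
  then show "smooth_on pos_diag (\<lambda>M. aut_matrix n M $ i $ j)" for i j by blast
qed

lemma aut_matrix_dep:
  assumes "(i, j) \<in> free n"
    and "\<And>k l. pos l \<le> pos k \<Longrightarrow> (k, l) \<notin> free n \<Longrightarrow> row_rank k l < row_rank i j \<Longrightarrow> M $ k $ l = N $ k $ l"
  shows "aut_matrix n M $ i $ j = aut_matrix n N $ i $ j"
proof -
  have "\<forall>i j. (i, j) \<in> free n \<longrightarrow>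
    (\<forall>k l. pos l \<le> pos k \<longrightarrow> (k, l) \<notin> free n \<longrightarrow> row_rank k l < row_rank i j \<longrightarrow> M $ k $ l = N $ k $ l) \<longrightarrow>
    aut_matrix n M $ i $ j = aut_matrix n N $ i $ j"
    by (cases n; simp only: forall_6 aut_entries cong: entry_cong nth_index_cong;
        simp only: free_entries simp_thms; simp add: row_rank_def)
  then show ?thesis using assms by blast
qed

text \<open>
  Compatibility with the bracket is a system of identities between rational functions of the leading
  entries, one for each pair of basis vectors and each component.
\<close>

lemma aut_matrix_bracket_axis:
  assumes "M \<in> pos_diag"
  shows "\<forall>i j k. pos i < pos j \<longrightarrow> (aut_matrix n M *v bracket n (axis i 1) (axis j 1)) $ k
    = bracket n (aut_matrix n M *v axis i 1) (aut_matrix n M *v axis j 1) $ k"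
proof -
  have nz: "M $ i $ i \<noteq> 0" for i using pos_diagD[OF assms, of i] by simp
  show ?thesis
    by (cases n; simp only: forall_6 pos_simps rel_simps simp_thms;
        simp only: bracket_entries matrix_vector_axis;
        simp only: matrix_vector_nth_6 bracket_entries bracket_axis_entries ring_zero_one;
        simp only: aut_entries ring_zero_one simp_thms cong: entry_cong nth_index_cong;
        simp add: nz field_simps power2_eq_square power_numeral_reduce)
qed

text \<open>
  The equations for a derivation without leading entries form a homogeneous linear system in the entries
  above the diagonal and at the free positions, which has only the trivial solution.
\<close>

lemma derivation_zero_axis:
  "\<forall>i j k. pos i < pos j \<longrightarrow> ((D :: real^6^6) *v bracket n (axis i 1) (axis j 1)) $ k
      = bracket n (D *v axis i 1) (axis j 1) $ k + bracket n (axis i 1) (D *v axis j 1) $ k \<Longrightarrow>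
    \<forall>i j. pos j \<le> pos i \<longrightarrow> (i, j) \<notin> free n \<longrightarrow> D $ i $ j = 0 \<Longrightarrow>
    \<forall>i j. D $ i $ j = 0"
  by (cases n; simp only: forall_6 pos_simps rel_simps simp_thms;
      simp only: free_entries simp_thms;
      simp only: bracket_entries matrix_vector_axis;
      simp only: matrix_vector_nth_6 bracket_entries bracket_axis_entries ring_zero_one;
      simp)

lemma free_lower: "(i, j) \<in> free n \<Longrightarrow> pos j \<le> pos i"
proof -
  have "\<forall>i j. (i, j) \<in> free n \<longrightarrow> pos j \<le> pos i"
    by (cases n; simp only: forall_6 free_entries simp_thms)
  then show "(i, j) \<in> free n \<Longrightarrow> pos j \<le> pos i" by blast
qed

lemma bracket_self: "bracket n x x = 0"
proof -
  have "2 *\<^sub>R bracket n x x = 0" using bracket_swap[of n x x] by (simp add: scaleR_2 eq_neg_iff_add_eq_0)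
  then show ?thesis by simp
qed

lemma aut_matrix_Aut:
  assumes M: "M \<in> pos_diag" shows "aut_matrix n M \<in> Aut (bracket n)"
proof -
  let ?A = "aut_matrix n M"
  have "?A \<in> T6"
    using aut_matrix_diag[OF M] by (simp add: T6_iff lower_triangular_def aut_matrix_upper)
  then have "invertible ?A" by (rule T6_invertible)
  moreover have "(\<lambda>x y. ?A *v bracket n x y) = (\<lambda>x y. bracket n (?A *v x) (?A *v y))"
  proof (rule bilinear_eq_stdbasis)
    note lin = bilinear_ladd[OF bilinear_bracket] bilinear_radd[OF bilinear_bracket]
      bilinear_lmul[OF bilinear_bracket] bilinear_rmul[OF bilinear_bracket]
      matrix_vector_right_distrib matrix_vector_mult_scaleR
    show "bilinear (\<lambda>x y. ?A *v bracket n x y)" "bilinear (\<lambda>x y. bracket n (?A *v x) (?A *v y))"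
      unfolding bilinear_def by (intro conjI allI linearI; simp add: lin)+
    have lt: "?A *v bracket n (axis i 1) (axis j 1) = bracket n (?A *v axis i 1) (?A *v axis j 1)"
      if "pos i < pos j" for i j
      using aut_matrix_bracket_axis[OF M, of n] that by (simp add: vec_eq_iff)
    fix x y :: "real^6" assume "x \<in> Basis" "y \<in> Basis"
    then obtain i j where xy: "x = axis i 1" "y = axis j 1" by (auto simp: Basis_vec_def)
    consider "i = j" | "pos i < pos j" | "pos j < pos i" using pos_neqD by blast
    then show "?A *v bracket n x y = bracket n (?A *v x) (?A *v y)"
    proof cases
      case 1
      then show ?thesis by (simp add: xy bracket_self)
    next
      case 2
      then show ?thesis by (simp add: xy lt)
    next
      case 3
      then show ?thesis
        using lt[OF 3] bracket_swap[of n x y] bracket_swap[of n "?A *v x" "?A *v y"]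
        by (simp add: xy linear_neg[OF matrix_vector_mul_linear])
    qed
  qed
  ultimately show ?thesis by (simp add: Aut_def fun_eq_iff)
qed

lemma derivation_zero:
  assumes "X \<in> Der (bracket n)" "\<And>i j. pos j \<le> pos i \<Longrightarrow> (i, j) \<notin> free n \<Longrightarrow> X $ i $ j = 0"
  shows "X = 0"
  using derivation_zero_axis[of X n] assms by (simp add: Der_def vec_eq_iff)

text \<open>
  Used for conjugation by the standard basis, in both directions.
\<close>

lemma component_image_subset:
  assumes "continuous_on S f" "f ` S \<subseteq> T" "x \<in> S"
  shows "f ` connected_component_set S x \<subseteq> connected_component_set T (f x)"
proof (rule connected_component_maximal)
  have sub: "connected_component_set S x \<subseteq> S" by (rule connected_component_subset)
  show "f x \<in> f ` connected_component_set S x"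
    using assms(3) by (intro imageI) (simp add: connected_component_refl)
  show "connected (f ` connected_component_set S x)"
    by (intro connected_continuous_image continuous_on_subset[OF assms(1) sub] connected_connected_component)
  show "f ` connected_component_set S x \<subseteq> T" using sub assms(2) by blast
qed

lemma Aut0_in_basis_eq:
  assumes "standard_basis n h E"
  shows "Aut0_in_basis h E = connected_component_set (Aut (bracket n)) (mat 1)"
proof -
  let ?I = "matrix_inv E"
  have inv: "invertible E" and hE: "h (E *v x) (E *v y) = E *v bracket n x y" for x y
    using assms by (auto simp: standard_basis_def)
  note i = matrix_inv_mult[OF inv]
  have EI: "E *v (?I *v x) = x" and IE: "?I *v (E *v x) = x" for x
    by (simp_all add: matrix_vector_mul_assoc i)
  have h: "h x y = E *v bracket n (?I *v x) (?I *v y)" for x y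
    using hE[of "?I *v x" "?I *v y"] by (simp add: EI)
  have invI: "invertible ?I" using i by (auto simp: invertible_def)
  define c where "c \<phi> = ?I ** \<phi> ** E" for \<phi>
  define d where "d \<psi> = E ** \<psi> ** ?I" for \<psi>
  have cd: "c (d \<psi>) = \<psi>" for \<psi>
  proof -
    have "c (d \<psi>) = (?I ** E) ** \<psi> ** (?I ** E)" by (simp only: c_def d_def matrix_mul_assoc)
    then show ?thesis by (simp add: i)
  qed
  have one: "c (mat 1) = mat 1" "d (mat 1) = mat 1" by (simp_all add: c_def d_def i)
  have cont: "continuous_on S c" "continuous_on S d" for S
    unfolding c_def d_def
    by (intro bounded_bilinear.continuous_on[OF bounded_bilinear_matrix_mult] continuous_intros)+
  have "c \<phi> \<in> Aut (bracket n)" if "\<phi> \<in> Aut h" for \<phi>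
  proof -
    have "E *v bracket n (?I *v (\<phi> *v (E *v x))) (?I *v (\<phi> *v (E *v y))) = \<phi> *v (E *v bracket n x y)" for x y
    proof -
      have "\<phi> *v h (E *v x) (E *v y) = h (\<phi> *v (E *v x)) (\<phi> *v (E *v y))"
        using that by (simp add: Aut_def)
      then show ?thesis by (simp add: h IE)
    qed
    then have "bracket n (?I *v (\<phi> *v (E *v x))) (?I *v (\<phi> *v (E *v y))) = ?I *v (\<phi> *v (E *v bracket n x y))" for x y
      by (metis IE)
    then show ?thesis using that inv invI
      by (simp add: Aut_def c_def invertible_mult flip: matrix_vector_mul_assoc)
  qed
  then have cA: "c ` Aut h \<subseteq> Aut (bracket n)" by blast
  have "d \<psi> \<in> Aut h" if "\<psi> \<in> Aut (bracket n)" for \<psi>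
    using that inv invI
    by (simp add: Aut_def d_def h IE invertible_mult flip: matrix_vector_mul_assoc)
  then have dA: "d ` Aut (bracket n) \<subseteq> Aut h" by blast
  have "Aut0_in_basis h E = c ` Aut0 h" by (simp add: Aut0_in_basis_def c_def[abs_def])
  also have "\<dots> = connected_component_set (Aut (bracket n)) (mat 1)"
  proof
    show "c ` Aut0 h \<subseteq> connected_component_set (Aut (bracket n)) (mat 1)"
      using component_image_subset[OF cont(1) cA mat_1_Aut] by (simp add: one Aut0_def)
    have "d ` connected_component_set (Aut (bracket n)) (mat 1) \<subseteq> Aut0 h"
      using component_image_subset[OF cont(2) dA mat_1_Aut] by (simp add: one Aut0_def)
    then show "connected_component_set (Aut (bracket n)) (mat 1) \<subseteq> c ` Aut0 h"
      using cd by (metis image_subset_iff image_eqI subsetI)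
  qed
  finally show ?thesis .
qed

theorem theorem4p1:
  fixes h :: "real^6 \<Rightarrow> real^6 \<Rightarrow> real^6" and E :: "real^6^6" and n :: cslat6
  assumes "cslat h" and "standard_basis n h E"
  shows "\<exists>(V :: (real^6^6) set) A.
      smooth_manifold V (orbit_space (Aut0_in_basis h E)) A \<and>
      smooth_submersion sym_matrices (top_of_set metrics) (slice_atlas sym_matrices metrics)
        V (orbit_space (Aut0_in_basis h E)) A (orbit (Aut0_in_basis h E)) \<and>
      Sigma_free (free n) \<subseteq> T6 \<and>
      transversal_in T6 (Sigma_free (free n)) (Aut0_in_basis h E) \<and>
      (\<exists>V'. submanifold V' (Sigma_free (free n)) \<and>
        diffeomorphic (orbit_space (Aut0_in_basis h E)) A
          (top_of_set (Sigma_free (free n))) (slice_atlas V' (Sigma_free (free n))))"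
proof -
  interpret automorphism_graph "free n" "aut_matrix n" "bracket n"
  proof
    fix i j and x y :: "real^6^6"
    assume "(i, j) \<in> free n"
      and "\<And>k l. pos l \<le> pos k \<Longrightarrow> (k, l) \<notin> free n \<Longrightarrow> row_rank k l < row_rank i j \<Longrightarrow> x $ k $ l = y $ k $ l"
    then show "aut_matrix n x $ i $ j = aut_matrix n y $ i $ j" by (rule aut_matrix_dep)
  next
    fix X :: "real^6^6" assume "X \<in> Der (bracket n)" "\<And>i j. pos j \<le> pos i \<Longrightarrow> (i, j) \<notin> free n \<Longrightarrow> X $ i $ j = 0"
    then show "X = 0" by (rule derivation_zero)
  qed (fact free_lower aut_matrix_upper aut_matrix_leading aut_matrix_diag smooth_on_aut_matrix
      aut_matrix_one bilinear_bracket aut_matrix_Aut)+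
  obtain s a where sa: "smooth_on pos_diag s" "smooth_on pos_diag a"
    "\<And>t. t \<in> pos_diag \<Longrightarrow> s t \<in> Sigma_free (free n)" "\<And>t. t \<in> pos_diag \<Longrightarrow> a t \<in> graph"
    "\<And>t. t \<in> T6 \<Longrightarrow> s t ** a t = t"
    using factorization_exists by blast
  have "Aut0_in_basis h E = graph"
    using Aut0_in_basis_eq[OF assms(2)] identity_component by simp
  moreover have "cross_section (free n) graph s a"
  proof
    fix t :: "real^6^6" assume "t \<in> T6"
    then show "s t \<in> Sigma_free (free n)" "a t \<in> graph"
      using sa(3,4) T6_subset_pos_diag by blast+
  qed (fact F_lower graph_subset_T6 mat_1_graph graph_mult graph_inverse sa factorization_unique)+
  ultimately show ?thesis
    using cross_section.orbit_space_diffeomorphic_cross_section by simp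
qed

end
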